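(* Let $p$ be a prime and $X_m=\{x_1,\dots,x_m\}\subset\mathbb{Z}_p$ an ordered set whose elements have pairwise distinct reductions modulo $p$. Let $(\varepsilon_n)_{n\ge1}$ be real numbers with $0<\varepsilon_n<1$ such that for every $\Delta>0$ we have $\varepsilon_n\ge \frac{\Delta\log n}{n}$ for all sufficiently large $n$. Let $A_n\in\operatorname{M}_n(\mathbb{Z}_p)$ be an $\varepsilon_n$-balanced random matrix for each $n\ge1$. Let $G_1,\dots,G_m$ be finite abelian $p$-groups, $p_k:\prod_{i=1}^m G_i\to G_k$ the natural projections, and $T_x\in\operatorname{End}(\prod_{i=1}^mG_i)$ the map $(g_1,\dots,g_m)\mapsto(x_1g_1,\dots,x_mg_m)$. Then $$\lim_{n\to\infty}\mathbb{E}\Big(\prod_{i=1}^m\#\operatorname{Sur}(\operatorname{cok}(A_n+px_iI_n),G_i)\Big)=\big|S_{G_1,\dots,G_m}(X_m)\big|,$$ where $S_{G_1,\dots,G_m}(X_m):=\{G\le\prod_{i=1}^mG_i:\ p_i(G)=G_i \text{ for each } i \text{ and } pT_x(G)\le G\}$.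
   Context: A random variable $x\in\mathbb{Z}_p$ is $\varepsilon$-balanced ($0<\varepsilon<1$) if $\mathbb{P}(x\equiv r \pmod p)\le 1-\varepsilon$ for every $r\in\mathbb{Z}/p\mathbb{Z}$; a random matrix is $\varepsilon$-balanced if its entries are independent and $\varepsilon$-balanced. $\operatorname{Sur}(X,G)$ is the set of surjective group homomorphisms $X\to G$; a finite abelian $p$-group is naturally a $\mathbb{Z}_p$-module, so $x_ig_i$ makes sense. $\operatorname{cok}(B)=\mathbb{Z}_p^n/B\mathbb{Z}_p^n$. *)

theory Defs
  imports "HOL-Probability.Probability" "HOL-Number_Theory.Cong" "HOL-Algebra.Multiplicative_Group"
    "HOL-Algebra.Product_Groups"
begin

section \<open>The ring of p-adic integers\<close>

text \<open>
  $\mathbf{Z}_p$ is the inverse limit of the rings $\mathbf{Z}/p^k$: an element is the sequence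
  \<open>x\<close> of its residues, \<open>x k\<close> being the representative in $\{0,\dots,p^k-1\}$ of the residue
  modulo $p^k$. In particular \<open>x 1\<close> is the reduction modulo \<open>p\<close>.
\<close>

definition Zp :: "nat \<Rightarrow> (nat \<Rightarrow> int) ring" where
  "Zp p = \<lparr>carrier = {x. \<forall>k. x k \<in> {0..<int p ^ k} \<and> x (Suc k) mod int p ^ k = x k},
           monoid.mult = (\<lambda>x y k. (x k * y k) mod int p ^ k),
           monoid.one = (\<lambda>k. 1 mod int p ^ k),
           ring.zero = (\<lambda>k. 0),
           ring.add = (\<lambda>x y k. (x k + y k) mod int p ^ k)\<rparr>"

text \<open>
  The Borel sigma-algebra of the p-adic topology, which is the inverse limit topology: the one
  induced on $\mathbf{Z}_p$ by the product topology on \<open>nat \<Rightarrow> int\<close>, with \<open>int\<close> discrete.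
\<close>

definition Zp_borel :: "nat \<Rightarrow> (nat \<Rightarrow> int) measure" where
  "Zp_borel p = restrict_space borel (carrier (Zp p))"

lemma Zp_cring:
  assumes "p > 0"
  shows "cring (Zp p)"
proof (rule cringI)
  let ?R = "Zp p"
  have pos: "int p ^ k > 0" for k
    using assms by simp
  have red: "(z mod int p ^ Suc k) mod int p ^ k = z mod int p ^ k" for z :: int and k
    by (rule mod_mod_cancel) simp
  have addc: "x \<oplus>\<^bsub>?R\<^esub> y \<in> carrier ?R" if "x \<in> carrier ?R" "y \<in> carrier ?R" for x y
  proof -
    have "(x (Suc k) + y (Suc k)) mod int p ^ k = (x k + y k) mod int p ^ k" for k
      using that by (simp add: Zp_def) (metis mod_add_eq)
    then show ?thesis
      using red pos by (simp add: Zp_def del: power_Suc)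
  qed
  have mulc: "x \<otimes>\<^bsub>?R\<^esub> y \<in> carrier ?R" if "x \<in> carrier ?R" "y \<in> carrier ?R" for x y
  proof -
    have "(x (Suc k) * y (Suc k)) mod int p ^ k = (x k * y k) mod int p ^ k" for k
      using that by (simp add: Zp_def) (metis mod_mult_eq)
    then show ?thesis
      using red pos by (simp add: Zp_def del: power_Suc)
  qed
  have small: "x k mod int p ^ k = x k" if "x \<in> carrier ?R" for x k
    using that by (simp add: Zp_def)
  have onec: "\<one>\<^bsub>?R\<^esub> \<in> carrier ?R"
    using red pos by (simp add: Zp_def del: power_Suc)
  show "abelian_group ?R"
  proof (rule abelian_groupI)
    fix x y z assume x: "x \<in> carrier ?R" and y: "y \<in> carrier ?R" and z: "z \<in> carrier ?R"
    show "x \<oplus>\<^bsub>?R\<^esub> y \<in> carrier ?R"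
      using x y by (rule addc)
    show "x \<oplus>\<^bsub>?R\<^esub> y \<oplus>\<^bsub>?R\<^esub> z = x \<oplus>\<^bsub>?R\<^esub> (y \<oplus>\<^bsub>?R\<^esub> z)"
      by (simp add: Zp_def fun_eq_iff mod_simps add.assoc)
    show "x \<oplus>\<^bsub>?R\<^esub> y = y \<oplus>\<^bsub>?R\<^esub> x"
      by (simp add: Zp_def fun_eq_iff add.commute)
  next
    show "\<zero>\<^bsub>?R\<^esub> \<in> carrier ?R"
      using pos by (simp add: Zp_def)
  next
    fix x assume x: "x \<in> carrier ?R"
    show "\<zero>\<^bsub>?R\<^esub> \<oplus>\<^bsub>?R\<^esub> x = x"
      using small[OF x] by (simp add: Zp_def fun_eq_iff)
    let ?y = "\<lambda>k. (- x k) mod int p ^ k"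
    have "(- x (Suc k)) mod int p ^ k = (- x k) mod int p ^ k" for k
      using x by (simp add: Zp_def) (metis mod_minus_eq)
    then have "?y \<in> carrier ?R"
      using red pos by (simp add: Zp_def del: power_Suc)
    moreover have "?y \<oplus>\<^bsub>?R\<^esub> x = \<zero>\<^bsub>?R\<^esub>"
      by (simp add: Zp_def fun_eq_iff mod_simps)
    ultimately show "\<exists>y\<in>carrier ?R. y \<oplus>\<^bsub>?R\<^esub> x = \<zero>\<^bsub>?R\<^esub>"
      by blast
  qed
  show "comm_monoid ?R"
  proof (rule comm_monoidI)
    fix x y z assume x: "x \<in> carrier ?R" and y: "y \<in> carrier ?R" and z: "z \<in> carrier ?R"
    show "x \<otimes>\<^bsub>?R\<^esub> y \<in> carrier ?R"
      using x y by (rule mulc)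
    show "x \<otimes>\<^bsub>?R\<^esub> y \<otimes>\<^bsub>?R\<^esub> z = x \<otimes>\<^bsub>?R\<^esub> (y \<otimes>\<^bsub>?R\<^esub> z)"
      by (simp add: Zp_def fun_eq_iff mod_simps mult.assoc)
    show "x \<otimes>\<^bsub>?R\<^esub> y = y \<otimes>\<^bsub>?R\<^esub> x"
      by (simp add: Zp_def fun_eq_iff mult.commute)
  next
    show "\<one>\<^bsub>?R\<^esub> \<in> carrier ?R"
      by (rule onec)
  next
    fix x assume x: "x \<in> carrier ?R"
    show "\<one>\<^bsub>?R\<^esub> \<otimes>\<^bsub>?R\<^esub> x = x"
      using small[OF x] by (simp add: Zp_def fun_eq_iff mod_simps)
  qed
  fix x y z assume x: "x \<in> carrier ?R" and y: "y \<in> carrier ?R" and z: "z \<in> carrier ?R"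
  show "(x \<oplus>\<^bsub>?R\<^esub> y) \<otimes>\<^bsub>?R\<^esub> z = x \<otimes>\<^bsub>?R\<^esub> z \<oplus>\<^bsub>?R\<^esub> y \<otimes>\<^bsub>?R\<^esub> z"
    by (simp add: Zp_def fun_eq_iff mod_simps distrib_right)
qed

section \<open>Cokernels of square matrices over a ring\<close>

text \<open>
  An \<open>n \<times> n\<close> matrix over \<open>R\<close> is a function of two indices, of which only the entries with both
  indices in \<open>{1..n}\<close> matter.
\<close>

definition free_mod :: "('a, 'b) ring_scheme \<Rightarrow> nat \<Rightarrow> (nat \<Rightarrow> 'a) monoid" where
  "free_mod R n = product_group {1..n} (\<lambda>_. add_monoid R)"

definition mat_vec ::
  "('a, 'b) ring_scheme \<Rightarrow> nat \<Rightarrow> (nat \<Rightarrow> nat \<Rightarrow> 'a) \<Rightarrow> (nat \<Rightarrow> 'a) \<Rightarrow> (nat \<Rightarrow> 'a)" where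
  "mat_vec R n B v = (\<lambda>i\<in>{1..n}. \<Oplus>\<^bsub>R\<^esub>j\<in>{1..n}. B i j \<otimes>\<^bsub>R\<^esub> v j)"

definition cok ::
  "('a, 'b) ring_scheme \<Rightarrow> nat \<Rightarrow> (nat \<Rightarrow> nat \<Rightarrow> 'a) \<Rightarrow> (nat \<Rightarrow> 'a) set monoid" where
  "cok R n B = free_mod R n Mod (mat_vec R n B ` carrier (free_mod R n))"

text \<open>The matrix $B + cI$.\<close>

definition add_scalar ::
  "('a, 'b) ring_scheme \<Rightarrow> (nat \<Rightarrow> nat \<Rightarrow> 'a) \<Rightarrow> 'a \<Rightarrow> (nat \<Rightarrow> nat \<Rightarrow> 'a)" where
  "add_scalar R B c = (\<lambda>i j. B i j \<oplus>\<^bsub>R\<^esub> (if i = j then c else \<zero>\<^bsub>R\<^esub>))"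

text \<open>
  Homomorphisms are only determined on the carrier, so extensionality is required in order that
  \<open>card (Sur X G)\<close> counts each of them once.
\<close>

definition Sur :: "('a, 'b) monoid_scheme \<Rightarrow> ('c, 'd) monoid_scheme \<Rightarrow> ('a \<Rightarrow> 'c) set" where
  "Sur X G = epi X G \<inter> extensional (carrier X)"

section \<open>Balanced random variables and matrices\<close>

definition balanced :: "nat \<Rightarrow> real \<Rightarrow> 'w measure \<Rightarrow> ('w \<Rightarrow> nat \<Rightarrow> int) \<Rightarrow> bool" where
  "balanced p \<epsilon> M X \<longleftrightarrow>
     X \<in> M \<rightarrow>\<^sub>M Zp_borel p \<and>
     (\<forall>r::int. measure M {w \<in> space M. [X w 1 = r] (mod int p)} \<le> 1 - \<epsilon>)"

definition balanced_matrix ::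
  "nat \<Rightarrow> real \<Rightarrow> nat \<Rightarrow> 'w measure \<Rightarrow> ('w \<Rightarrow> nat \<Rightarrow> nat \<Rightarrow> nat \<Rightarrow> int) \<Rightarrow> bool" where
  "balanced_matrix p \<epsilon> n M A \<longleftrightarrow>
     prob_space.indep_vars M (\<lambda>_. Zp_borel p) (\<lambda>(i, j) w. A w i j) ({1..n} \<times> {1..n}) \<and>
     (\<forall>i\<in>{1..n}. \<forall>j\<in>{1..n}. balanced p \<epsilon> M (\<lambda>w. A w i j))"

section \<open>Finite abelian p-groups as modules over the p-adic integers\<close>

definition finite_abelian_p_group :: "nat \<Rightarrow> ('g, 'b) monoid_scheme \<Rightarrow> bool" where
  "finite_abelian_p_group p G \<longleftrightarrow> comm_group G \<and> (\<exists>k. order G = p ^ k)"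

text \<open>
  The action \<open>x \<cdot> g\<close>: if \<open>G\<close> has order $p^k$, then \<open>g\<close> is raised to the residue of \<open>x\<close>
  modulo $p^k$ (the groups are written multiplicatively). Any modulus that kills \<open>g\<close> gives the
  same result, see \<open>Zp_act_eq\<close>.
\<close>

definition Zp_act :: "nat \<Rightarrow> ('g, 'b) monoid_scheme \<Rightarrow> (nat \<Rightarrow> int) \<Rightarrow> 'g \<Rightarrow> 'g" where
  "Zp_act p G x g = g [^]\<^bsub>G\<^esub> x (multiplicity p (order G))"

lemma Zp_mod_le:
  assumes "x \<in> carrier (Zp p)" "j \<le> k"
  shows "x k mod int p ^ j = x j"
  using assms(2)
proof (induction k rule: dec_induct)
  case base
  then show ?case using assms(1) by (simp add: Zp_def)
next
  case (step k)
  have "x (Suc k) mod int p ^ j = (x (Suc k) mod int p ^ k) mod int p ^ j"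
    using step by (simp add: mod_mod_cancel le_imp_power_dvd)
  also have "\<dots> = x k mod int p ^ j"
    using assms(1) by (simp add: Zp_def)
  finally show ?case using step by simp
qed

lemma Zp_act_eq:
  assumes "prime p" "finite_abelian_p_group p G" "x \<in> carrier (Zp p)" "g \<in> carrier G"
    and "g [^]\<^bsub>G\<^esub> (p ^ k) = \<one>\<^bsub>G\<^esub>"
  shows "Zp_act p G x g = g [^]\<^bsub>G\<^esub> x k"
proof -
  interpret comm_group G
    using assms(2) by (simp add: finite_abelian_p_group_def)
  obtain l where l: "order G = p ^ l"
    using assms(2) by (auto simp: finite_abelian_p_group_def)
  have m: "multiplicity p (order G) = l"
    unfolding l using assms(1) by (intro multiplicity_same_power) (auto simp: prime_nat_iff)
  have kill: "g [^]\<^bsub>G\<^esub> x j = g [^]\<^bsub>G\<^esub> x i"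
    if kj: "g [^]\<^bsub>G\<^esub> (p ^ j) = \<one>\<^bsub>G\<^esub>" and ji: "j \<le> i" for i j
  proof -
    define q where "q = x i div int p ^ j"
    have eq: "x i = int (p ^ j) * q + x j"
      using div_mult_mod_eq[of "x i" "int p ^ j"] Zp_mod_le[OF assms(3) ji]
      by (simp add: q_def mult.commute)
    have "g [^]\<^bsub>G\<^esub> (int (p ^ j) * q) = (g [^]\<^bsub>G\<^esub> int (p ^ j)) [^]\<^bsub>G\<^esub> q"
      by (rule int_pow_pow[OF assms(4), symmetric])
    also have "g [^]\<^bsub>G\<^esub> int (p ^ j) = \<one>\<^bsub>G\<^esub>"
      using kj by (simp only: int_pow_int)
    finally have "g [^]\<^bsub>G\<^esub> (int (p ^ j) * q) = \<one>\<^bsub>G\<^esub>"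
      by (simp only: int_pow_one)
    then show ?thesis
      using assms(4) by (simp only: eq int_pow_mult int_pow_closed l_one)
  qed
  have "g [^]\<^bsub>G\<^esub> (p ^ l) = \<one>\<^bsub>G\<^esub>"
    using pow_order_eq_1[OF assms(4)] l by simp
  then have "g [^]\<^bsub>G\<^esub> x l = g [^]\<^bsub>G\<^esub> x k"
    using kill[of l k] kill[of k l] assms(5) by (metis nat_le_linear)
  then show ?thesis
    by (simp add: Zp_act_def m)
qed

text \<open>The endomorphism $T_x$ of $\prod_{i=1}^m G_i$.\<close>

definition T_map ::
  "nat \<Rightarrow> nat \<Rightarrow> (nat \<Rightarrow> ('g, 'b) monoid_scheme) \<Rightarrow> (nat \<Rightarrow> nat \<Rightarrow> int) \<Rightarrow> (nat \<Rightarrow> 'g) \<Rightarrow> (nat \<Rightarrow> 'g)"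
  where "T_map p m G x g = (\<lambda>i\<in>{1..m}. Zp_act p (G i) (x i) (g i))"

definition S_set ::
  "nat \<Rightarrow> nat \<Rightarrow> (nat \<Rightarrow> ('g, 'b) monoid_scheme) \<Rightarrow> (nat \<Rightarrow> nat \<Rightarrow> int) \<Rightarrow> (nat \<Rightarrow> 'g) set set"
  where "S_set p m G x =
    {H. subgroup H (product_group {1..m} G) \<and>
        (\<forall>i\<in>{1..m}. (\<lambda>g. g i) ` H = carrier (G i)) \<and>
        (\<lambda>g. T_map p m G x g [^]\<^bsub>product_group {1..m} G\<^esub> p) ` H \<subseteq> H}"

end

theory Submission
  imports Defs
begin

text \<open>
  A tuple of surjections from the cokernels to the \<open>G i\<close> is a tuple \<open>F\<close> of \<open>n\<close> elements of the product
  \<open>P\<close> of the groups whose projections generate every \<open>G i\<close>, subject to one relation for each column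
  of \<open>A n\<close>: the combination of the \<open>F l\<close> given by column \<open>j\<close> is $-pT_x(F_j)$. All these combinations
  lie in the subgroup \<open>H\<close> generated by \<open>F\<close>, so the relations are solvable only if $pT_x(H) \le H$;
  this picks out the elements of \<open>S_set\<close>, and it remains to see that each such \<open>H\<close> contributes 1 in
  the limit.

  Fix \<open>H\<close>, of order $q$. By Fourier inversion a column satisfies its relation, whatever the target,
  with probability at most $q^{-1}\sum_\psi e^{-c\varepsilon_n w(\psi)}$, the sum being over the
  characters of \<open>H\<close> and $w(\psi)$ being the number of \<open>l\<close> with $\psi(F_l) \ne 1$. For most \<open>F\<close> all
  $w(\psi)$ with $\psi \ne 1$ are at least $\delta n$, the columns are nearly uniform, and the
  contribution is $1 + o(1)$. Otherwise let \<open>L\<close> be the common kernel of the characters of weight less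
  than $\delta n$ and let $d$ be the number of $F_l$ outside \<open>L\<close>. Then $d$ is at least 1 because \<open>F\<close>
  generates, it is at most $q\delta n$, and the characters that kill \<open>L\<close> have average
  $e^{-c\varepsilon_n w}$ at most $\max(e^{-c'\varepsilon_n d}, 1 - c')$. This gains a factor
  $e^{-c''n\varepsilon_n d}$ or $e^{-c''n}$ over all columns, which beats the number of such \<open>F\<close> since
  $n\varepsilon_n/\log n \to \infty$.
\<close>

section \<open>Characters of finite abelian groups\<close>

text \<open>The crude estimate is exactly critical. If \<open>k\<close> characters kill
  \<open>L\<close>, a column costs about k/q, and about |L|^n tuples have nearly all entries in
  \<open>L\<close>. Since k |L| = q, these factors cancel over \<open>n\<close> columns, so each
  proper \<open>L\<close> would still contribute a constant. All decay must come from the entries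
  outside \<open>L\<close>, in one of two ways. Put b = c \<epsilon>_n. If b d/q exceeds 1, the
  saving per column is saturated and amounts to e^{-n/(2q)} in total. It has to beat the choice of
  the exceptional entries, and \<delta> is taken so small that this choice costs at most
  e^{3n/(8q)}. Otherwise every exceptional entry saves a factor a = e^{-nb/(2q^2)}, and summing over
  the tuples with at least one such entry gives |L|^n ((1 + qa)^n - 1), which is negligible relative
  to |L|^n as soon as n a tends to 0. The characters of large weight add an error s = q e^{-b
  \<delta> n} per column, harmless once n s tends to 0. On the arithmetic side, one power p^K kills
  all groups, so a p-adic entry matters only through its residue modulo p^K. The constant c comes
  from the distance between 1 and the other p^K-th roots of unity, hence is uniform in n.\<close>

definition is_char_on :: "('a, 'b) monoid_scheme \<Rightarrow> 'a set \<Rightarrow> ('a \<Rightarrow> complex) \<Rightarrow> bool" where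
  "is_char_on G H \<psi> \<longleftrightarrow> \<psi> \<one>\<^bsub>G\<^esub> = 1 \<and> (\<forall>x\<in>H. \<forall>y\<in>H. \<psi> (x \<otimes>\<^bsub>G\<^esub> y) = \<psi> x * \<psi> y)"

text \<open>Extensional functions only, so that each character occurs once and sums over the dual
  group make sense.\<close>

definition chars :: "('a, 'b) monoid_scheme \<Rightarrow> ('a \<Rightarrow> complex) set" where
  "chars G = {\<psi> \<in> extensional (carrier G). is_char_on G (carrier G) \<psi>}"

text \<open>For a subgroup \<open>L\<close> this is the dual of the quotient by \<open>L\<close>,
  kept inside the dual of \<open>G\<close> so that no quotient group has to be formed.\<close>

definition ann :: "('a, 'b) monoid_scheme \<Rightarrow> 'a set \<Rightarrow> ('a \<Rightarrow> complex) set" where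
  "ann G L = {\<psi> \<in> chars G. \<forall>x\<in>L. \<psi> x = 1}"

lemma (in group) subgroup_nat_pow_closed:
  "subgroup H G \<Longrightarrow> x \<in> H \<Longrightarrow> x [^] (n::nat) \<in> H"
  by (induction n) (auto simp: subgroup.one_closed subgroup.m_closed)

lemma (in group) subgroup_int_pow_closed:
  assumes "subgroup H G" "x \<in> H"
  shows "x [^] (a::int) \<in> H"
proof -
  have nat: "x [^] n \<in> H" for n :: nat using assms by (rule subgroup_nat_pow_closed)
  have x: "x \<in> carrier G" using assms by (rule subgroup.mem_carrier)
  show ?thesis
  proof (cases a rule: int_cases2)
    case (nonneg n)
    then show ?thesis using nat by (simp only: int_pow_int)
  next
    case (nonpos n)
    then show ?thesis using subgroup.m_inv_closed[OF assms(1) nat] x by (simp only: int_pow_neg_int)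
  qed
qed

locale finite_comm_group = comm_group G for G (structure) +
  assumes fin: "finite (carrier G)"
begin

section \<open>Extending characters from a subgroup\<close>

lemma least_power_in_subgroup:
  assumes H: "subgroup H G" and a: "a \<in> carrier G"
  obtains k :: nat where "k > 0" "a [^] k \<in> H" "\<And>i::nat. a [^] i \<in> H \<Longrightarrow> k dvd i"
proof -
  \<comment> \<open>The order of the coset of \<open>a\<close> in the quotient by
    \<open>H\<close>.\<close>
  define k where "k = (LEAST k::nat. k > 0 \<and> a [^] k \<in> H)"
  have "order G > 0 \<and> a [^] order G \<in> H"
    using fin a H by (simp add: order_gt_0_iff_finite pow_order_eq_1 subgroup.one_closed)
  then have k: "k > 0 \<and> a [^] k \<in> H"
    unfolding k_def by (rule LeastI)
  have "k dvd i" if i: "a [^] i \<in> H" for i :: nat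
  proof (rule ccontr)
    assume "\<not> k dvd i"
    then have r: "i mod k > 0" by (simp add: dvd_eq_mod_eq_0)
    have "a [^] i = a [^] (k * (i div k) + i mod k)" by simp
    also have "\<dots> = (a [^] k) [^] (i div k) \<otimes> a [^] (i mod k)"
      using a by (simp add: nat_pow_pow nat_pow_mult)
    finally have "a [^] (i mod k) = inv ((a [^] k) [^] (i div k)) \<otimes> a [^] i"
      using a by (simp add: m_assoc[symmetric])
    moreover have "(a [^] k) [^] (i div k) \<in> H"
      using k H by (simp add: subgroup_nat_pow_closed)
    ultimately have "a [^] (i mod k) \<in> H"
      using H i by (simp add: subgroup.m_closed subgroup.m_inv_closed)
    then have "k \<le> i mod k" unfolding k_def[symmetric]
      using r unfolding k_def by (intro Least_le) auto
    then show False using k by (meson leD mod_less_divisor)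
  qed
  then show ?thesis using k that by blast
qed

lemma is_char_on_pow:
  assumes "subgroup H G" "is_char_on G H \<psi>" "x \<in> H"
  shows "\<psi> (x [^] (i::nat)) = \<psi> x ^ i"
proof (induction i)
  case 0
  then show ?case using assms by (simp add: is_char_on_def)
next
  case (Suc i)
  have "x [^] i \<in> H"
    using assms by (simp add: subgroup_nat_pow_closed)
  then show ?case using assms Suc by (simp add: is_char_on_def mult.commute)
qed

text \<open>On the subgroup generated by \<open>H\<close> and \<open>a\<close> the extension has to
  send h a^i to \<psi>(h) z^i. All relations between \<open>a\<close> and \<open>H\<close> follow
  from a^k lying in \<open>H\<close>, so the condition on \<open>z ^ k\<close> is the only
  obstruction. Leaving \<open>z\<close> free lets one construction serve both to extend characters
  and to separate points.\<close>

lemma char_extend_step: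
  assumes H: "subgroup H G" and \<psi>: "is_char_on G H \<psi>" and a: "a \<in> carrier G"
    and k: "k > 0" "a [^] k \<in> H" and div: "\<And>i::nat. a [^] i \<in> H \<Longrightarrow> k dvd i"
    and z: "z ^ k = \<psi> (a [^] (k::nat))"
  obtains H' \<psi>' where "subgroup H' G" "is_char_on G H' \<psi>'" "H \<subseteq> H'" "a \<in> H'"
    "\<And>h. h \<in> H \<Longrightarrow> \<psi>' h = \<psi> h" "\<psi>' a = z"
proof -
  have Hc: "h \<in> carrier G" if "h \<in> H" for h using that H by (meson subgroup.mem_carrier)
  define H' where "H' = {h \<otimes> a [^] (i::nat) | h i. h \<in> H}"
  define \<psi>' where "\<psi>' x = (THE y. \<exists>h\<in>H. \<exists>i::nat. x = h \<otimes> a [^] i \<and> y = \<psi> h * z ^ i)" for x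
  have *: "\<psi> h * z ^ i = \<psi> h' * z ^ j"
    if "h \<in> H" "h' \<in> H" "h \<otimes> a [^] i = h' \<otimes> a [^] j" "i \<le> j" for h h' and i j :: nat
  proof -
    have "h \<otimes> a [^] i = h' \<otimes> a [^] (j - i) \<otimes> a [^] i"
      using that a Hc by (simp add: m_assoc nat_pow_mult)
    then have h: "h = h' \<otimes> a [^] (j - i)"
      using a Hc that by (metis m_closed nat_pow_closed right_cancel)
    then have "a [^] (j - i) = inv h' \<otimes> h"
      using a Hc that by (simp add: m_assoc[symmetric])
    then have ai: "a [^] (j - i) \<in> H"
      using H that by (simp add: subgroup.m_closed subgroup.m_inv_closed)
    then obtain m where m: "j - i = k * m" using div by blast
    have "a [^] (j - i) = (a [^] k) [^] m"
      using a by (simp add: m nat_pow_pow)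
    then have "\<psi> (a [^] (j - i)) = z ^ (j - i)"
      using is_char_on_pow[OF H \<psi> k(2), of m] z by (simp add: m power_mult)
    then have "\<psi> h = \<psi> h' * z ^ (j - i)"
      using h ai that \<psi> by (simp add: is_char_on_def)
    then show ?thesis using that(4) by (simp add: mult.assoc flip: power_add)
  qed
  have **: "\<psi> h * z ^ i = \<psi> h' * z ^ j"
    if "h \<in> H" "h' \<in> H" "h \<otimes> a [^] i = h' \<otimes> a [^] j" for h h' and i j :: nat
    using *[of h h' i j] *[of h' h j i] that by (metis nat_le_linear)
  have \<psi>': "\<psi>' (h \<otimes> a [^] i) = \<psi> h * z ^ i" if "h \<in> H" for h and i :: nat
    unfolding \<psi>'_def
    using that by (intro the_equality bexI[of _ h] exI[of _ i]) (auto dest: **[OF that])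
  have one: "\<one> \<in> H" using H by (rule subgroup.one_closed)
  have \<psi>1: "\<psi> \<one> = 1" using \<psi> by (simp add: is_char_on_def)
  show ?thesis
  proof (rule that[of H' \<psi>'])
    have HH': "H \<subseteq> H'"
    proof
      fix h assume "h \<in> H"
      then have "h = h \<otimes> a [^] (0::nat)" using Hc by simp
      then show "h \<in> H'" unfolding H'_def using \<open>h \<in> H\<close> by blast
    qed
    then show "H \<subseteq> H'" .
    have "a = \<one> \<otimes> a [^] (1::nat)" using a by simp
    then show "a \<in> H'" unfolding H'_def using one by blast
    show "\<psi>' h = \<psi> h" if "h \<in> H" for h
      using \<psi>'[OF that, of 0] Hc[OF that] by simp
    show "\<psi>' a = z" using \<psi>'[OF one, of 1] a \<psi>1 by simp
    have mult: "(h \<otimes> a [^] i) \<otimes> (h' \<otimes> a [^] j) = (h \<otimes> h') \<otimes> a [^] (i + j)"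
      if "h \<in> H" "h' \<in> H" for h h' and i j :: nat
      using that Hc a by (simp add: nat_pow_mult[symmetric] m_ac)
    show "subgroup H' G"
    proof (rule subgroupI)
      show "H' \<subseteq> carrier G" unfolding H'_def using Hc a by auto
      show "H' \<noteq> {}" using HH' one by blast
    next
      fix x assume "x \<in> H'"
      then obtain h i where x: "x = h \<otimes> a [^] (i::nat)" "h \<in> H" unfolding H'_def by blast
      have shuffle: "(s \<otimes> b) \<otimes> ((t \<otimes> v) \<otimes> c) = (s \<otimes> t) \<otimes> (v \<otimes> (b \<otimes> c))"
        if "s \<in> carrier G" "b \<in> carrier G" "t \<in> carrier G" "v \<in> carrier G" "c \<in> carrier G" for s b t v c
        using that by (simp add: m_ac)
      \<comment> \<open>Elements of \<open>H'\<close> carry nonnegative exponents, so the inverse of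
        a^i is rewritten as a^((k-1)i) times the inverse of u = a^(ki), and \<open>u\<close> lies in
        \<open>H\<close>.\<close>
      have "a [^] i \<otimes> a [^] ((k - 1) * i) = (a [^] k) [^] i"
        using a k by (simp add: nat_pow_mult nat_pow_pow algebra_simps)
      moreover define u where "u = (a [^] k) [^] i"
      ultimately have u: "a [^] i \<otimes> a [^] ((k - 1) * i) = u" by simp
      have uH: "u \<in> H" unfolding u_def using k H by (simp add: subgroup_nat_pow_closed)
      have "(h \<otimes> a [^] i) \<otimes> ((inv h \<otimes> inv u) \<otimes> a [^] ((k - 1) * i)) = 
         (h \<otimes> inv h) \<otimes> (inv u \<otimes> (a [^] i \<otimes> a [^] ((k - 1) * i)))"
        using x(2) Hc a uH by (intro shuffle) auto
      also have "\<dots> = \<one>" unfolding u using x(2) Hc uH by simp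
      finally have "inv x = (inv h \<otimes> inv u) \<otimes> a [^] ((k - 1) * i)"
        unfolding x using x(2) Hc a uH 
        by (metis inv_equality m_closed m_comm nat_pow_closed inv_closed)
      moreover have "inv h \<otimes> inv u \<in> H"
        using x(2) uH H by (simp add: subgroup.m_closed subgroup.m_inv_closed)
      ultimately show "inv x \<in> H'" unfolding H'_def by blast
    next
      fix x y assume "x \<in> H'" "y \<in> H'"
      then obtain h i h' j where x: "x = h \<otimes> a [^] (i::nat)" "h \<in> H" 
         "y = h' \<otimes> a [^] (j::nat)" "h' \<in> H" unfolding H'_def by blast
      then have "x \<otimes> y = (h \<otimes> h') \<otimes> a [^] (i + j)" "h \<otimes> h' \<in> H"
        using mult H by (auto simp: subgroup.m_closed)
      then show "x \<otimes> y \<in> H'" unfolding H'_def by blast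
    qed
    show "is_char_on G H' \<psi>'"
      unfolding is_char_on_def
    proof safe
      show "\<psi>' \<one> = 1" using \<psi>'[OF one, of 0] \<psi>1 by simp
      fix x y assume "x \<in> H'" "y \<in> H'"
      then obtain h i h' j where x: "x = h \<otimes> a [^] (i::nat)" "h \<in> H" 
         "y = h' \<otimes> a [^] (j::nat)" "h' \<in> H" unfolding H'_def by blast
      have "h \<otimes> h' \<in> H" using x H by (simp add: subgroup.m_closed)
      then show "\<psi>' (x \<otimes> y) = \<psi>' x * \<psi>' y"
        using x \<psi> by (simp add: mult \<psi>' power_add is_char_on_def)
    qed
  qed
qed

lemma is_char_on_nonzero:
  assumes "subgroup H G" "is_char_on G H \<psi>" "x \<in> H"
  shows "\<psi> x \<noteq> 0"
proof
  assume "\<psi> x = 0"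
  moreover have "\<psi> (x \<otimes> inv x) = \<psi> x * \<psi> (inv x)"
    using assms by (simp add: is_char_on_def subgroup.m_inv_closed)
  moreover have "x \<in> carrier G" using assms by (meson subgroup.mem_carrier)
  ultimately show False using assms by (simp add: is_char_on_def)
qed

text \<open>Adjoin one element at a time. The value \<open>z\<close> demanded by
  \<open>char_extend_step\<close> exists because nonzero complex numbers have \<open>k\<close>-th
  roots.\<close>

lemma char_extend:
  assumes "subgroup H G" "is_char_on G H \<psi>"
  shows "\<exists>\<phi>\<in>chars G. \<forall>h\<in>H. \<phi> h = \<psi> h"
  using assms
proof (induction "card (carrier G) - card H" arbitrary: H \<psi> rule: less_induct)
  case less
  have sub: "H \<subseteq> carrier G" using less.prems by (simp add: subgroup.subset)
  show ?case
  proof (cases "H = carrier G")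
    case True
    then have "restrict \<psi> (carrier G) \<in> chars G"
      using less.prems by (auto simp: chars_def is_char_on_def)
    then show ?thesis using True by (intro bexI[of _ "restrict \<psi> (carrier G)"]) auto
  next
    case False
    then obtain a where a: "a \<in> carrier G" "a \<notin> H" using sub by blast
    obtain k :: nat where k: "k > 0" "a [^] k \<in> H" "\<And>i::nat. a [^] i \<in> H \<Longrightarrow> k dvd i"
      using least_power_in_subgroup[OF less.prems(1) a(1)] by blast
    obtain z where z: "z ^ k = \<psi> (a [^] k)"
      using is_char_on_nonzero[OF less.prems k(2)] k(1) 
      by (metis exists_complex_root_nonzero less_numeral_extra(3))
    obtain H' \<psi>' where H': "subgroup H' G" "is_char_on G H' \<psi>'" "H \<subseteq> H'" "a \<in> H'"
      "\<And>h. h \<in> H \<Longrightarrow> \<psi>' h = \<psi> h"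
      using char_extend_step[OF less.prems a(1) k z] by metis
    have "card H < card H'"
      using H' a by (intro psubset_card_mono) (auto intro: finite_subset[OF subgroup.subset fin])
    moreover have "card H' \<le> card (carrier G)"
      using H' fin by (simp add: card_mono subgroup.subset)
    ultimately have "card (carrier G) - card H' < card (carrier G) - card H" by simp
    from less.hyps[OF this H'(1,2)] obtain \<phi> where "\<phi> \<in> chars G" "\<forall>h\<in>H'. \<phi> h = \<psi>' h" by blast
    then show ?thesis using H' by (intro bexI[of _ \<phi>]) auto
  qed
qed

lemma char_separates:
  assumes H: "subgroup H G" and a: "a \<in> carrier G" "a \<notin> H"
  obtains \<psi> where "\<psi> \<in> ann G H" "\<psi> a \<noteq> 1"
proof -
  obtain k :: nat where k: "k > 0" "a [^] k \<in> H" "\<And>i::nat. a [^] i \<in> H \<Longrightarrow> k dvd i"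
    using least_power_in_subgroup[OF H a(1)] by blast
  have "k \<noteq> 1" using k(2) a by auto
  \<comment> \<open>A primitive \<open>k\<close>-th root of unity: it is compatible with the trivial
    character on \<open>H\<close>, and it differs from 1 because \<open>k \<noteq> 1\<close> for
    \<open>a\<close> outside \<open>H\<close>.\<close>
  define z where "z = cis (2 * pi / real k)"
  have zk: "z ^ k = 1" using k(1) by (simp add: z_def Complex.DeMoivre)
  have z1: "z \<noteq> 1"
  proof
    assume "z = 1"
    then have "cis (2 * pi / real k) = cis (2 * pi * real 0 / real k)" by (simp add: z_def)
    then have c: "cos (2 * pi / real k) = 1" by (metis cis.sel(1) \<open>z = 1\<close> z_def one_complex.sel(1))
    then obtain n :: int where n: "2 * pi / real k = of_int n * 2 * pi"
      using cos_one_2pi_int by blast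
    then have "1 / real k = of_int n" using k(1) by (simp add: field_simps)
    then have "real_of_int (n * int k) = 1" using k(1) by (simp add: field_simps)
    then have "n * int k = 1" by linarith
    then have "int k dvd 1" by (metis dvd_triv_right)
    then show False using \<open>k \<noteq> 1\<close> by simp
  qed
  have "is_char_on G H (\<lambda>_. 1)" by (simp add: is_char_on_def)
  then obtain H' \<psi>' where H': "subgroup H' G" "is_char_on G H' \<psi>'" "H \<subseteq> H'" "a \<in> H'"
      "\<And>h. h \<in> H \<Longrightarrow> \<psi>' h = 1" "\<psi>' a = z"
    using char_extend_step[OF H _ a(1) k, of "\<lambda>_. 1" z] zk by metis
  obtain \<phi> where "\<phi> \<in> chars G" "\<forall>h\<in>H'. \<phi> h = \<psi>' h"
    using char_extend[OF H'(1,2)] by blast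
  then show ?thesis using H' z1 by (intro that[of \<phi>]) (auto simp: ann_def)
qed

lemma chars_one: "\<psi> \<in> chars G \<Longrightarrow> \<psi> \<one> = 1"
  and chars_mult: "\<psi> \<in> chars G \<Longrightarrow> x \<in> carrier G \<Longrightarrow> y \<in> carrier G \<Longrightarrow> \<psi> (x \<otimes> y) = \<psi> x * \<psi> y"
  and chars_pow: "\<psi> \<in> chars G \<Longrightarrow> x \<in> carrier G \<Longrightarrow> \<psi> (x [^] (i::nat)) = \<psi> x ^ i"
  using is_char_on_pow[OF subgroup_self] by (auto simp: chars_def is_char_on_def)

lemma chars_power_order: "\<psi> \<in> chars G \<Longrightarrow> x \<in> carrier G \<Longrightarrow> \<psi> x ^ order G = 1"
  using chars_pow[of \<psi> x "order G"] by (simp add: pow_order_eq_1 chars_one)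

lemma order_pos: "order G > 0"
  using fin by (simp add: order_gt_0_iff_finite)

lemma chars_norm: "\<psi> \<in> chars G \<Longrightarrow> x \<in> carrier G \<Longrightarrow> norm (\<psi> x) = 1"
  using chars_power_order order_pos by (metis norm_power norm_one norm_ge_zero power_eq_1_iff less_numeral_extra(3))

lemma chars_cnj: "\<psi> \<in> chars G \<Longrightarrow> x \<in> carrier G \<Longrightarrow> \<psi> x * cnj (\<psi> x) = 1"
  using chars_norm[of \<psi> x] by (simp add: complex_norm_square[symmetric])

lemma chars_inv: "\<psi> \<in> chars G \<Longrightarrow> x \<in> carrier G \<Longrightarrow> \<psi> (inv x) = cnj (\<psi> x)"
proof -
  assume a: "\<psi> \<in> chars G" "x \<in> carrier G"
  have "\<psi> x * \<psi> (inv x) = 1" using a chars_mult[of \<psi> x "inv x"] chars_one[of \<psi>] by simp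
  moreover have "\<psi> x \<noteq> 0" using chars_norm[OF a] by auto
  ultimately show ?thesis using chars_cnj[OF a] by (metis mult_cancel_left)
qed

lemma finite_chars: "finite (chars G)"
proof (rule finite_subset)
  show "chars G \<subseteq> (\<Pi>\<^sub>E x\<in>carrier G. {z::complex. z ^ order G = 1})"
    using chars_power_order by (auto simp: PiE_iff chars_def extensional_def)
  show "finite (\<Pi>\<^sub>E x\<in>carrier G. {z::complex. z ^ order G = 1})"
    using fin order_pos by (intro finite_PiE finite_roots_unity) auto
qed

definition triv_char :: "'a \<Rightarrow> complex" where
  "triv_char = (\<lambda>x\<in>carrier G. 1)"

lemma triv_char: "triv_char \<in> chars G" "\<And>x. x \<in> carrier G \<Longrightarrow> triv_char x = 1"
  by (auto simp: triv_char_def chars_def is_char_on_def)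

lemma nontriv_char: 
  assumes "\<psi> \<in> chars G" "\<psi> \<noteq> triv_char" obtains x where "x \<in> carrier G" "\<psi> x \<noteq> 1"
proof -
  have "\<exists>x\<in>carrier G. \<psi> x \<noteq> 1"
  proof (rule ccontr)
    assume "\<not> ?thesis"
    then have "\<psi> = triv_char" using assms by (intro ext) (auto simp: triv_char_def chars_def extensional_def)
    then show False using assms by simp
  qed
  then show ?thesis using that by blast
qed

section \<open>Orthogonality relations\<close>

lemma finite_ann: "finite (ann G L)"
  using finite_chars by (rule finite_subset[rotated]) (auto simp: ann_def)

lemma triv_char_ann: "L \<subseteq> carrier G \<Longrightarrow> triv_char \<in> ann G L"
  using triv_char by (auto simp: ann_def)

text \<open>For \<open>g\<close> outside \<open>L\<close>, multiplication by a character of the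
  annihilator that is not 1 at \<open>g\<close> permutes the annihilator and scales the sum by a
  factor other than 1, so the sum vanishes.\<close>

lemma sum_ann:
  assumes L: "subgroup L G" and g: "g \<in> carrier G"
  shows "(\<Sum>\<psi>\<in>ann G L. \<psi> g) = (if g \<in> L then of_nat (card (ann G L)) else 0)"
proof (cases "g \<in> L")
  case True
  then show ?thesis by (simp add: ann_def)
next
  case False
  obtain \<phi> where \<phi>: "\<phi> \<in> ann G L" "\<phi> g \<noteq> 1" using char_separates[OF L g False] .
  have Lc: "L \<subseteq> carrier G" using L by (rule subgroup.subset)
  have \<phi>c: "\<phi> \<in> chars G" using \<phi> by (simp add: ann_def)
  let ?m = "\<lambda>\<psi>. (\<lambda>x\<in>carrier G. \<phi> x * \<psi> x)"
  let ?m' = "\<lambda>\<psi>. (\<lambda>x\<in>carrier G. cnj (\<phi> x) * \<psi> x)"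
  have cl: "?m \<psi> \<in> ann G L" "?m' \<psi> \<in> ann G L" if "\<psi> \<in> ann G L" for \<psi>
    using that \<phi> Lc by (auto simp: ann_def chars_def is_char_on_def)
  have inv: "?m (?m' \<psi>) = \<psi>" "?m' (?m \<psi>) = \<psi>" if "\<psi> \<in> ann G L" for \<psi>
  proof -
    have e: "\<psi> \<in> extensional (carrier G)" using that by (simp add: ann_def chars_def)
    show "?m (?m' \<psi>) = \<psi>" "?m' (?m \<psi>) = \<psi>"
      using chars_cnj[OF \<phi>c] e 
      by (auto simp: fun_eq_iff extensional_def mult.assoc[symmetric] mult.commute[of "cnj _"])
  qed
  have "(\<Sum>\<psi>\<in>ann G L. \<psi> g) = (\<Sum>\<psi>\<in>ann G L. ?m \<psi> g)"
    by (rule sum.reindex_bij_witness[of _ ?m ?m']) (use cl inv in auto)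
  also have "\<dots> = \<phi> g * (\<Sum>\<psi>\<in>ann G L. \<psi> g)"
    using g by (simp add: sum_distrib_left)
  finally have "(\<Sum>\<psi>\<in>ann G L. \<psi> g) = 0" using \<phi>(2) by simp
  then show ?thesis using False by simp
qed

lemma sum_char:
  assumes \<psi>: "\<psi> \<in> chars G" "\<psi> \<noteq> triv_char"
  shows "(\<Sum>g\<in>carrier G. \<psi> g) = 0"
proof -
  obtain a where a: "a \<in> carrier G" "\<psi> a \<noteq> 1" using nontriv_char[OF \<psi>] .
  have "(\<Sum>g\<in>carrier G. \<psi> g) = (\<Sum>g\<in>carrier G. \<psi> (a \<otimes> g))"
    by (rule sum.reindex_bij_witness[of _ "\<lambda>g. a \<otimes> g" "\<lambda>g. inv a \<otimes> g"])
       (use a in \<open>auto simp: m_assoc[symmetric]\<close>)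
  also have "\<dots> = \<psi> a * (\<Sum>g\<in>carrier G. \<psi> g)"
    using \<psi> a by (simp add: chars_mult sum_distrib_left)
  finally show ?thesis using a by simp
qed

text \<open>Double counting of the sum of \<psi>(g) over the annihilator and the group: summing over
  \<psi> first leaves the \<open>g\<close> in \<open>L\<close>, summing over \<open>g\<close> first
  leaves the trivial character.\<close>

lemma card_ann:
  assumes L: "subgroup L G"
  shows "card (ann G L) * card L = order G"
proof -
  have Lc: "L \<subseteq> carrier G" using L by (rule subgroup.subset)
  have "(\<Sum>g\<in>carrier G. \<Sum>\<psi>\<in>ann G L. \<psi> g) = (\<Sum>g\<in>carrier G. if g \<in> L then of_nat (card (ann G L)) else 0)"
    by (intro sum.cong refl sum_ann L)
  also have "\<dots> = of_nat (card (ann G L) * card L)"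
    using fin Lc by (simp add: sum.If_cases Int_absorb1 mult.commute)
  finally have 1: "(\<Sum>g\<in>carrier G. \<Sum>\<psi>\<in>ann G L. \<psi> g) = of_nat (card (ann G L) * card L)" .
  have "(\<Sum>g\<in>carrier G. \<Sum>\<psi>\<in>ann G L. \<psi> g) = (\<Sum>\<psi>\<in>ann G L. \<Sum>g\<in>carrier G. \<psi> g)"
    by (rule sum.swap)
  also have "\<dots> = (\<Sum>\<psi>\<in>ann G L. if \<psi> = triv_char then of_nat (order G) else 0)"
    by (intro sum.cong refl) (auto simp: sum_char ann_def triv_char order_def)
  also have "\<dots> = of_nat (order G)"
    using finite_ann triv_char_ann[OF Lc] by simp
  finally show ?thesis using 1 by (metis of_nat_eq_iff)
qed

lemma ann_one: "ann G {\<one>} = chars G"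
  by (auto simp: ann_def chars_one)

lemma sum_chars:
  assumes "g \<in> carrier G"
  shows "(\<Sum>\<psi>\<in>chars G. \<psi> g) = (if g = \<one> then of_nat (order G) else 0)"
  using sum_ann[OF triv_subgroup assms] card_ann[OF triv_subgroup] by (simp add: ann_one)

lemma card_chars: "card (chars G) = order G"
  using card_ann[OF triv_subgroup] by (simp add: ann_one)

section \<open>Counting generating tuples by the weights of characters\<close>

definition maps :: "nat \<Rightarrow> (nat \<Rightarrow> 'a) set" where
  "maps n = ({1..n} \<rightarrow>\<^sub>E carrier G)"

definition gens :: "nat \<Rightarrow> (nat \<Rightarrow> 'a) set" where
  "gens n = {f \<in> maps n. generate G (f ` {1..n}) = carrier G}"

definition wt :: "nat \<Rightarrow> (nat \<Rightarrow> 'a) \<Rightarrow> ('a \<Rightarrow> complex) \<Rightarrow> nat" where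
  "wt n f \<psi> = card {i \<in> {1..n}. \<psi> (f i) \<noteq> 1}"

definition dep :: "nat \<Rightarrow> 'a set \<Rightarrow> (nat \<Rightarrow> 'a) \<Rightarrow> nat" where
  "dep n L f = card {i \<in> {1..n}. f i \<notin> L}"

text \<open>
  The characters outside \<open>ann G (low n \<delta> f)\<close> have weight at least \<open>\<delta> * n\<close>, while few entries of \<open>f\<close> lie
  outside \<open>low n \<delta> f\<close>.
\<close>

definition low :: "nat \<Rightarrow> real \<Rightarrow> (nat \<Rightarrow> 'a) \<Rightarrow> 'a set" where
  "low n \<delta> f = {g \<in> carrier G. \<forall>\<psi>\<in>chars G. real (wt n f \<psi>) < \<delta> * real n \<longrightarrow> \<psi> g = 1}"

section \<open>Tuples with few entries outside a subgroup\<close>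

lemma finite_maps: "finite (maps n)"
  unfolding maps_def using fin by (intro finite_PiE) auto

lemma card_maps: "card (maps n) = order G ^ n"
  by (simp add: maps_def card_PiE order_def)

lemma maps_mem: "f \<in> maps n \<Longrightarrow> i \<in> {1..n} \<Longrightarrow> f i \<in> carrier G"
  by (auto simp: maps_def)

text \<open>The summand is a product over the coordinates, so the sum factorises into
  \<open>n\<close> equal sums over the group.\<close>

lemma sum_power_dep:
  fixes a :: real
  assumes "L \<subseteq> carrier G"
  shows "(\<Sum>f\<in>maps n. a ^ dep n L f) = (card L + (real (order G) - card L) * a) ^ n"
proof -
  have "a ^ dep n L f = (\<Prod>i\<in>{1..n}. if f i \<in> L then 1 else a)" for f
    by (simp add: dep_def prod.If_cases Int_def)
  then have "(\<Sum>f\<in>maps n. a ^ dep n L f) = (\<Prod>i\<in>{1..n}. \<Sum>x\<in>carrier G. if x \<in> L then 1 else a)"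
    unfolding maps_def by (subst prod_sum_PiE) (use fin in auto)
  also have "(\<Sum>x\<in>carrier G. if x \<in> L then 1 else a) = card L + (real (order G) - card L) * a"
    using fin assms card_mono[OF fin assms]
    by (simp add: sum.If_cases Int_absorb1 Diff_eq[symmetric] card_Diff_subset finite_subset order_def
        of_nat_diff)
  finally show ?thesis by simp
qed

text \<open>Exponential moment bound, with parameter \<open>t\<close>.\<close>

lemma card_dep_le:
  fixes t \<eta> :: real
  assumes "L \<subseteq> carrier G" "0 < t" "t \<le> 1" "0 \<le> \<eta>"
  shows "card {f \<in> maps n. dep n L f \<le> \<eta> * n} \<le> (t powr (- \<eta>)) ^ n * (card L + (real (order G) - card L) * t) ^ n"
proof -
  have *: "t powr (\<eta> * n) \<le> t ^ dep n L f" if "dep n L f \<le> \<eta> * n" for f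
    using that assms by (subst powr_realpow[symmetric]) (auto intro: powr_mono')
  have "card {f \<in> maps n. dep n L f \<le> \<eta> * n} * t powr (\<eta> * n)
      = (\<Sum>f\<in>{f \<in> maps n. dep n L f \<le> \<eta> * n}. t powr (\<eta> * n))" by simp
  also have "\<dots> \<le> (\<Sum>f\<in>{f \<in> maps n. dep n L f \<le> \<eta> * n}. t ^ dep n L f)"
    by (intro sum_mono) (use * in auto)
  also have "\<dots> \<le> (\<Sum>f\<in>maps n. t ^ dep n L f)"
    using assms finite_maps by (intro sum_mono2) auto
  also have "\<dots> = (card L + (real (order G) - card L) * t) ^ n"
    using assms by (simp add: sum_power_dep)
  finally have le: "card {f \<in> maps n. dep n L f \<le> \<eta> * n} * t powr (\<eta> * n) \<le> \<dots>" .
  have inv: "(t powr (- \<eta>)) ^ n * t powr (\<eta> * n) = 1"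
    using assms by (simp add: powr_minus power_inverse powr_power mult.commute)
  have "real (card {f \<in> maps n. dep n L f \<le> \<eta> * n})
      = (t powr (- \<eta>)) ^ n * (card {f \<in> maps n. dep n L f \<le> \<eta> * n} * t powr (\<eta> * n))"
    using inv by (simp add: mult.left_commute)
  also have "\<dots> \<le> (t powr (- \<eta>)) ^ n * (card L + (real (order G) - card L) * t) ^ n"
    using le assms by (intro mult_left_mono) auto
  finally show ?thesis .
qed

lemma subgroup_low: "subgroup (low n \<delta> f) G"
proof (rule subgroupI)
  have "\<one> \<in> low n \<delta> f" by (simp add: low_def chars_one)
  then show "low n \<delta> f \<noteq> {}" by blast
qed (auto simp: low_def chars_mult chars_inv)

lemma not_ann_low:
  fixes \<delta> :: real
  assumes "\<psi> \<in> chars G" "\<psi> \<notin> ann G (low n \<delta> f)"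
  shows "wt n f \<psi> \<ge> \<delta> * n"
  using assms by (force simp: ann_def low_def)

text \<open>An entry outside \<open>low n \<delta> f\<close> is moved by some character of weight
  below \<delta> n. There are at most \<open>order G\<close> such characters, and each moves fewer
  than \<delta> n entries.\<close>

lemma dep_low:
  fixes \<delta> :: real
  assumes "\<delta> \<ge> 0" "f \<in> maps n"
  shows "dep n (low n \<delta> f) f \<le> order G * \<delta> * n"
proof -
  let ?B = "{\<psi> \<in> chars G. real (wt n f \<psi>) < \<delta> * real n}"
  have "dep n (low n \<delta> f) f \<le> card (\<Union>\<psi>\<in>?B. {i \<in> {1..n}. \<psi> (f i) \<noteq> 1})"
    unfolding dep_def low_def using assms(2) finite_chars
    by (intro card_mono) (auto dest: maps_mem)
  also have "\<dots> \<le> (\<Sum>\<psi>\<in>?B. wt n f \<psi>)"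
    unfolding wt_def using finite_chars by (intro card_UN_le) auto
  finally have "real (dep n (low n \<delta> f) f) \<le> real (\<Sum>\<psi>\<in>?B. wt n f \<psi>)"
    by (rule of_nat_mono)
  also have "\<dots> = (\<Sum>\<psi>\<in>?B. real (wt n f \<psi>))" by simp
  also have "\<dots> \<le> (\<Sum>\<psi>\<in>?B. \<delta> * n)" by (intro sum_mono) auto
  also have "\<dots> \<le> (\<Sum>\<psi>\<in>chars G. \<delta> * n)" 
    using assms(1) finite_chars by (intro sum_mono2) auto
  finally show ?thesis by (simp add: card_chars mult.assoc)
qed

lemma dep_pos:
  assumes "f \<in> gens n" "subgroup L G" "L \<noteq> carrier G"
  shows "dep n L f \<ge> 1"
proof (rule ccontr)
  assume "\<not> ?thesis"
  then have "dep n L f = 0" by simp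
  then have "{i \<in> {1..n}. f i \<notin> L} = {}" unfolding dep_def by (subst (asm) card_0_eq) auto
  then have "f ` {1..n} \<subseteq> L" by auto
  then have "generate G (f ` {1..n}) \<subseteq> L"
    using assms(2) by (intro generate_subgroup_incl)
  then show False using assms subgroup.subset[OF assms(2)] by (auto simp: gens_def)
qed

text \<open>If \<open>f\<close> did not generate, a nontrivial character killing all its entries
  would have weight 0, and \<open>low n \<delta> f\<close> would be contained in its kernel.\<close>

lemma low_carrier_gens:
  fixes \<delta> :: real
  assumes "\<delta> > 0" "n \<ge> 1" "f \<in> maps n" "low n \<delta> f = carrier G"
  shows "f \<in> gens n"
proof (rule ccontr)
  assume n: "\<not> ?thesis"
  have sub: "f ` {1..n} \<subseteq> carrier G" using assms(3) maps_mem by auto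
  let ?H = "generate G (f ` {1..n})"
  have H: "subgroup ?H G" using sub by (rule generate_is_subgroup)
  then have "?H \<noteq> carrier G" using n assms(3) by (auto simp: gens_def)
  then obtain a where a: "a \<in> carrier G" "a \<notin> ?H" using subgroup.subset[OF H] by blast
  obtain \<psi> where \<psi>: "\<psi> \<in> ann G ?H" "\<psi> a \<noteq> 1" using char_separates[OF H a] .
  have "\<psi> (f i) = 1" if "i \<in> {1..n}" for i
    using \<psi>(1) generate.incl[of "f i" "f ` {1..n}" G] that by (auto simp: ann_def)
  then have "wt n f \<psi> = 0" by (simp add: wt_def)
  moreover have "a \<in> low n \<delta> f" using a assms by simp
  ultimately show False using \<psi> assms by (auto simp: low_def ann_def)
qed

text \<open>Some character that kills \<open>L\<close> has at least the average weight, and the average is at least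
  \<open>dep n L f / card (ann G L)\<close>.\<close>

lemma sum_ann_exp:
  fixes b :: real
  assumes L: "subgroup L G" and f: "f \<in> maps n" and b: "b \<ge> 0"
  shows "(\<Sum>\<psi>\<in>ann G L. exp (- b * wt n f \<psi>)) 
      \<le> card (ann G L) - (1 - exp (- b * dep n L f / card (ann G L)))"
proof -
  let ?K = "ann G L" let ?k = "card (ann G L)" let ?d = "dep n L f"
  have fK: "finite ?K" by (rule finite_ann)
  have tK: "triv_char \<in> ?K" using L by (intro triv_char_ann subgroup.subset)
  then have k: "?k > 0" using fK by (auto simp: card_gt_0_iff)
  have "?d \<le> card (\<Union>\<psi>\<in>?K. {i \<in> {1..n}. \<psi> (f i) \<noteq> 1})"
    unfolding dep_def using fK
    by (intro card_mono) (auto intro: char_separates[OF L maps_mem[OF f]])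
  also have "\<dots> \<le> (\<Sum>\<psi>\<in>?K. wt n f \<psi>)"
    unfolding wt_def using fK by (intro card_UN_le) auto
  finally have d: "?d \<le> (\<Sum>\<psi>\<in>?K. wt n f \<psi>)" .
  have "\<exists>\<psi>\<in>?K. ?d \<le> ?k * wt n f \<psi>"
  proof (rule ccontr)
    assume "\<not> ?thesis"
    then have lt: "?k * wt n f \<psi> < ?d" if "\<psi> \<in> ?K" for \<psi> using that by auto
    have "(\<Sum>\<psi>\<in>?K. ?k * wt n f \<psi>) < (\<Sum>\<psi>\<in>?K. ?d)"
      using fK tK lt by (intro sum_strict_mono) auto
    then have "?k * (\<Sum>\<psi>\<in>?K. wt n f \<psi>) < ?k * ?d"
      by (simp add: sum_distrib_left)
    then show False using d by simp
  qed
  then obtain \<phi> where \<phi>: "\<phi> \<in> ?K" "?d \<le> ?k * wt n f \<phi>" by blast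
  have "(\<Sum>\<psi>\<in>?K. exp (- b * wt n f \<psi>)) = exp (- b * wt n f \<phi>) + (\<Sum>\<psi>\<in>?K - {\<phi>}. exp (- b * wt n f \<psi>))"
    using fK \<phi> by (simp add: sum.remove)
  \<comment> \<open>Only the saving of the single character \<phi> is kept.\<close>
  also have "(\<Sum>\<psi>\<in>?K - {\<phi>}. exp (- b * wt n f \<psi>)) \<le> (\<Sum>\<psi>\<in>?K - {\<phi>}. 1)"
    using b by (intro sum_mono) auto
  also have "\<dots> = real ?k - 1" using \<phi> fK k by simp
  also have "exp (- b * wt n f \<phi>) \<le> exp (- b * ?d / ?k)"
  proof -
    have "real ?d \<le> real ?k * real (wt n f \<phi>)" using \<phi>(2) by (metis of_nat_le_iff of_nat_mult)
    then have "?d / ?k \<le> wt n f \<phi>" using k by (simp add: field_simps)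
    then have "b * (?d / ?k) \<le> b * wt n f \<phi>" using b by (intro mult_left_mono)
    then show ?thesis by simp
  qed
  finally show ?thesis by simp
qed

end

section \<open>The contribution of the tuples with a given \<open>low\<close>\<close>

lemma one_minus_exp_ge: "1 - exp (- x) \<ge> min x 1 / 2" if "x \<ge> 0" for x :: real
proof (cases "x \<le> 1")
  case True
  have "exp (-x) \<le> 1 / (1 + x)"
    using exp_ge_add_one_self[of x] that by (simp add: exp_minus field_simps)
  also have "\<dots> \<le> 1 - x / 2" 
  proof -
    have "x * x \<le> x * 1" using True that by (intro mult_left_mono) auto
    then show ?thesis using that True by (simp add: field_simps)
  qed
  finally show ?thesis using True by simp
next
  case False
  have "exp (-x) \<le> exp (-1)" using False by simp
  also have "\<dots> \<le> 1 / 2" using exp_ge_add_one_self[of 1] by (simp add: exp_minus field_simps)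
  finally show ?thesis using False by simp
qed

context finite_comm_group begin

lemma card_ann_bounds:
  assumes "subgroup L G"
  shows "card (ann G L) > 0" "card (ann G L) \<le> order G" "card L > 0"
proof -
  have "card (ann G L) * card L > 0" using card_ann[OF assms] order_pos by simp
  then show 1: "card (ann G L) > 0" and 2: "card L > 0" by simp_all
  then have "card (ann G L) * 1 \<le> card (ann G L) * card L" by (intro mult_le_mono) auto
  then show "card (ann G L) \<le> order G" using card_ann[OF assms] by simp
qed

text \<open>Characters outside the annihilator of \<open>L\<close> have weight at least \<delta> n
  and contribute at most \<open>s\<close> together; those inside are handled by
  \<open>sum_ann_exp\<close>. After factoring out \<open>k\<close>, the inequality 1 + u \<le> e^u
  turns the \<open>n\<close>-th power into an exponential.\<close>

lemma char_sum_power_le: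
  fixes b \<delta> :: real
  assumes f: "f \<in> maps n" and b: "b \<ge> 0" and L: "L = low n \<delta> f"
  defines "q \<equiv> real (order G)"
  defines "s \<equiv> q * exp (- b * \<delta> * n)"
  shows "(\<Sum>\<psi>\<in>chars G. exp (- b * wt n f \<psi>)) ^ n \<le>
      card (ann G L) ^ n * exp (n * s) * (exp (- n / (2 * q)) + exp (- n * b / (2 * q\<^sup>2)) ^ dep n L f)"
proof -
  have Ls: "subgroup L G" unfolding L by (rule subgroup_low)
  define k where "k = real (card (ann G L))"
  define d where "d = real (dep n L f)"
  have k: "0 < k" "1 \<le> k" "k \<le> q" using card_ann_bounds[OF Ls] by (auto simp: k_def q_def)
  have s0: "s \<ge> 0" using k by (simp add: s_def)
  have sub: "ann G L \<subseteq> chars G" by (auto simp: ann_def)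
  have "(\<Sum>\<psi>\<in>chars G. exp (- b * wt n f \<psi>)) = 
     (\<Sum>\<psi>\<in>chars G - ann G L. exp (- b * wt n f \<psi>)) + (\<Sum>\<psi>\<in>ann G L. exp (- b * wt n f \<psi>))"
    by (rule sum.subset_diff[OF sub finite_chars])
  also have "(\<Sum>\<psi>\<in>ann G L. exp (- b * wt n f \<psi>)) \<le> k - (1 - exp (- (b * d / k)))"
    using sum_ann_exp[OF Ls f b] by (simp add: k_def d_def)
  also have "\<dots> \<le> k - min (b * d / k) 1 / 2"
    using one_minus_exp_ge[of "b * d / k"] b k by (simp add: d_def)
  also have "\<dots> \<le> k - min (b * d / q) 1 / 2"
  proof -
    have "b * d / q \<le> b * d / k" using b k by (intro divide_left_mono) (auto simp: d_def)
    then show ?thesis by simp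
  qed
  \<comment> \<open>Since k \<le> q, the saving may be shrunk to a multiple of \<open>k\<close>,
    which lets \<open>k\<close> be factored out of the whole sum.\<close>
  also have "\<dots> \<le> k - k * (min (b * d / q) 1 / (2 * q))"
  proof -
    have "0 \<le> min (b * d / q) 1" using b k by (simp add: d_def)
    then have "k * min (b * d / q) 1 \<le> q * min (b * d / q) 1" using k by (intro mult_right_mono) auto
    then show ?thesis using k by (simp add: field_simps)
  qed
  also have "(\<Sum>\<psi>\<in>chars G - ann G L. exp (- b * wt n f \<psi>)) \<le> (\<Sum>\<psi>\<in>chars G - ann G L. exp (- b * \<delta> * n))"
  proof (intro sum_mono)
    fix \<psi> assume "\<psi> \<in> chars G - ann G L"
    then have "\<delta> * n \<le> wt n f \<psi>" using not_ann_low unfolding L by simp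
    then have "b * (\<delta> * n) \<le> b * wt n f \<psi>" using b by (intro mult_left_mono)
    then show "exp (- b * wt n f \<psi>) \<le> exp (- b * \<delta> * n)" by (simp add: mult.assoc)
  qed
  also have "\<dots> \<le> (\<Sum>\<psi>\<in>chars G. exp (- b * \<delta> * n))"
    using finite_chars by (intro sum_mono2) auto
  also have "\<dots> = s" by (simp add: s_def q_def card_chars)
  also have "s \<le> k * s" using k s0 by (simp add: mult_le_cancel_right1)
  finally have "(\<Sum>\<psi>\<in>chars G. exp (- b * wt n f \<psi>)) \<le> k * (1 + (s - min (b * d / q) 1 / (2 * q)))"
    by (simp add: algebra_simps)
  also have "\<dots> \<le> k * exp (s - min (b * d / q) 1 / (2 * q))"
    using k by (intro mult_left_mono) (auto simp: exp_ge_add_one_self)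
  finally have "(\<Sum>\<psi>\<in>chars G. exp (- b * wt n f \<psi>)) ^ n \<le> (k * exp (s - min (b * d / q) 1 / (2 * q))) ^ n"
    by (intro power_mono sum_nonneg) auto
  also have "\<dots> = k ^ n * exp (n * s) * exp (- n * (min (b * d / q) 1 / (2 * q)))"
    by (simp add: power_mult_distrib exp_of_nat_mult[symmetric] mult_exp_exp algebra_simps)
  \<comment> \<open>The exponential of the minimum is the larger of two exponentials. Their sum is
    used instead, so that the sum over \<open>f\<close> splits into a plain count and a moment of
    \<open>dep\<close>.\<close>
  also have "exp (- n * (min (b * d / q) 1 / (2 * q))) \<le> exp (- n / (2 * q)) + exp (- n * b / (2 * q\<^sup>2)) ^ dep n L f"
  proof (cases "b * d / q \<le> 1")
    case True
    have "exp (- n * b / (2 * q\<^sup>2)) ^ dep n L f = exp (- n * (min (b * d / q) 1 / (2 * q)))"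
      using True by (simp add: exp_of_nat_mult[symmetric] d_def power2_eq_square mult_ac)
    then show ?thesis by simp
  next
    case False
    then show ?thesis by simp
  qed
  finally show ?thesis using k by (simp add: k_def mult_left_mono)
qed

lemma finite_subgroups: "finite {L. subgroup L G}"
proof (rule finite_subset)
  show "{L. subgroup L G} \<subseteq> Pow (carrier G)" by (auto dest: subgroup.subset)
  show "finite (Pow (carrier G))" using fin by simp
qed

lemma proper_subgroup_index:
  assumes L: "subgroup L G" "L \<noteq> carrier G"
  shows "card (ann G L) \<ge> 2"
proof (rule ccontr)
  assume "\<not> ?thesis"
  then have "card (ann G L) = 1" using card_ann_bounds(1)[OF L(1)] by simp
  then have "card L = card (carrier G)" using card_ann[OF L(1)] by (simp add: order_def)
  then show False using L fin card_subset_eq[OF fin subgroup.subset[OF L(1)]] by simp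
qed

text \<open>\<open>dep_low\<close> leaves at most \<eta> n entries outside \<open>L\<close>, so
  \<open>card_dep_le\<close> applies with parameter 1/(4q^2). This parameter keeps the correction
  (k-1)/(4q^2) below 1/(4q), and the hypothesis on \<eta> limits the price of the exponential moment
  to e^{1/(8q)} per coordinate.\<close>

lemma card_low_eq_le:
  fixes \<eta> \<delta> q :: real
  defines "q \<equiv> real (order G)"
  assumes L: "subgroup L G" and \<eta>: "\<eta> = q * \<delta>" "0 \<le> \<delta>"
    and t: "(1 / (4 * q\<^sup>2)) powr (- \<eta>) \<le> exp (1 / (8 * q))"
  shows "card {f \<in> maps n. low n \<delta> f = L} \<le> (exp (1 / (8 * q)) * (card L * (1 + (real (card (ann G L)) - 1) / (4 * q\<^sup>2)))) ^ n"
proof -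
  have q: "q \<ge> 1" using order_pos by (simp add: q_def)
  have q2: "q\<^sup>2 \<ge> 1" using q by simp
  let ?t = "1 / (4 * q\<^sup>2)" let ?l = "real (card L)" let ?k = "real (card (ann G L))"
  have qkl: "q = ?k * ?l" using card_ann[OF L] by (simp add: q_def flip: of_nat_mult)
  have "1 \<le> 4 * q\<^sup>2" using q2 by linarith
  then have t1: "0 < ?t" "?t \<le> 1" using q by (simp_all add: divide_le_eq)
  have sub: "{f \<in> maps n. low n \<delta> f = L} \<subseteq> {f \<in> maps n. dep n L f \<le> \<eta> * n}"
    using dep_low[of \<delta> _ n] \<eta> by (auto simp: q_def)
  have "real (card {f \<in> maps n. low n \<delta> f = L}) \<le> card {f \<in> maps n. dep n L f \<le> \<eta> * n}"
    using finite_maps sub by (simp add: card_mono)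
  also have "\<dots> \<le> (?t powr (- \<eta>)) ^ n * (?l + (q - ?l) * ?t) ^ n"
    unfolding q_def by (rule card_dep_le) (use t1 \<eta> q L in \<open>auto simp: q_def subgroup.subset\<close>)
  also have "\<dots> \<le> exp (1 / (8 * q)) ^ n * (?l + (q - ?l) * ?t) ^ n"
    using t card_mono[OF fin subgroup.subset[OF L]] t1
    by (intro mult_right_mono power_mono zero_le_power add_nonneg_nonneg mult_nonneg_nonneg) (auto simp: q_def order_def)
  also have "?l + (q - ?l) * ?t = ?l * (1 + (?k - 1) * ?t)" by (simp add: qkl algebra_simps)
  finally show ?thesis by (simp add: power_mult_distrib)
qed

text \<open>Because k |L| = q, the powers k^n and |L|^n combine to q^n and only the savings remain:
  the saturated one is set against the size of the class, the saving a^d is summed over all tuples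
  with some entry outside \<open>L\<close>.\<close>

lemma class_sum_le:
  fixes b \<eta> \<delta> q s a :: real and n :: nat
  defines "q \<equiv> real (order G)"
  defines "s \<equiv> q * exp (- b * \<delta> * n)"
  defines "a \<equiv> exp (- n * b / (2 * q\<^sup>2))"
  assumes L: "subgroup L G" "L \<noteq> carrier G" and \<eta>: "\<eta> = q * \<delta>" "0 \<le> \<delta>" and b: "b \<ge> 0"
    and t: "(1 / (4 * q\<^sup>2)) powr (- \<eta>) \<le> exp (1 / (8 * q))"
  shows "(\<Sum>f\<in>{f \<in> gens n. low n \<delta> f = L}. (\<Sum>\<psi>\<in>chars G. exp (- b * wt n f \<psi>)) ^ n)
     \<le> q ^ n * exp (n * s) * (exp (- n / (8 * q)) + ((1 + q * a) ^ n - 1))"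
proof -
  have q: "q \<ge> 1" using order_pos by (simp add: q_def)
  let ?l = "real (card L)" let ?k = "real (card (ann G L))"
  have qkl: "q = ?k * ?l" using card_ann[OF L(1)] by (simp add: q_def flip: of_nat_mult)
  have k: "1 \<le> ?k" "?k \<le> q" using card_ann_bounds[OF L(1)] by (auto simp: q_def)
  have Lc: "L \<subseteq> carrier G" using L by (simp add: subgroup.subset)
  have a: "a > 0" by (simp add: a_def)
  let ?C = "{f \<in> gens n. low n \<delta> f = L}"
  have fC: "finite ?C" using finite_maps by (rule finite_subset[rotated]) (auto simp: gens_def)
  have "(\<Sum>f\<in>?C. (\<Sum>\<psi>\<in>chars G. exp (- b * wt n f \<psi>)) ^ n)
     \<le> (\<Sum>f\<in>?C. ?k ^ n * exp (n * s) * (exp (- n / (2 * q)) + a ^ dep n L f))"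
    unfolding s_def a_def q_def
    by (intro sum_mono order.trans[OF char_sum_power_le]) (use b in \<open>auto simp: gens_def\<close>)
  also have "\<dots> = ?k ^ n * exp (n * s) * (card ?C * exp (- n / (2 * q)) + (\<Sum>f\<in>?C. a ^ dep n L f))"
    by (simp add: sum_distrib_left sum.distrib algebra_simps)
  also have "\<dots> \<le> ?k ^ n * exp (n * s) * (?l ^ n * exp (- n / (8 * q)) + ?l ^ n * ((1 + q * a) ^ n - 1))"
  proof (intro mult_left_mono add_mono)
    have "real (card ?C) \<le> card {f \<in> maps n. low n \<delta> f = L}"
      using finite_maps by (intro of_nat_mono card_mono) (auto simp: gens_def)
    also have "\<dots> \<le> (exp (1 / (8 * q)) * (?l * (1 + (?k - 1) / (4 * q\<^sup>2)))) ^ n"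
      unfolding q_def by (rule card_low_eq_le[OF L(1) \<eta>(1)[unfolded q_def] \<eta>(2) t[unfolded q_def]])
    also have "\<dots> \<le> (exp (1 / (8 * q)) * (?l * exp (1 / (4 * q)))) ^ n"
    proof (intro power_mono mult_left_mono)
      have "(?k - 1) / (4 * q\<^sup>2) \<le> q / (4 * q\<^sup>2)" using k by (intro divide_right_mono) auto
      also have "\<dots> = 1 / (4 * q)" using q by (simp add: power2_eq_square)
      finally show "1 + (?k - 1) / (4 * q\<^sup>2) \<le> exp (1 / (4 * q))"
        using exp_ge_add_one_self[of "1 / (4 * q)"] by linarith
    qed (use k in auto)
    \<comment> \<open>The exponents 1/(8q) and 1/(4q) add up to 3/(8q), which leaves 1/(8q) of the
      saving 1/(2q).\<close>
    also have "\<dots> = ?l ^ n * exp (n * (3 / (8 * q)))"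
      using q by (simp add: power_mult_distrib exp_of_nat_mult[symmetric] mult_exp_exp field_simps)
    finally have "card ?C * exp (- n / (2 * q)) \<le> ?l ^ n * exp (n * (3 / (8 * q))) * exp (- n / (2 * q))"
      by (intro mult_right_mono) auto
    also have "\<dots> = ?l ^ n * exp (- n / (8 * q))"
      using q by (simp add: mult.assoc mult_exp_exp field_simps)
    finally show "card ?C * exp (- n / (2 * q)) \<le> ?l ^ n * exp (- n / (8 * q))" .
    \<comment> \<open>Tuples with all entries in \<open>L\<close> are the part d = 0 of the moment
      sum. They do not generate, and removing them subtracts |L|^n, which cancels the leading
      term.\<close>
    let ?Z = "{1..n} \<rightarrow>\<^sub>E L"
    have Z: "?Z \<subseteq> maps n" using Lc by (auto simp: maps_def PiE_iff)
    have dZ: "dep n L f = 0" if "f \<in> ?Z" for f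
    proof -
      have "{i \<in> {1..n}. f i \<notin> L} = {}" using that by (auto simp: PiE_iff)
      then show ?thesis unfolding dep_def by simp
    qed
    from dZ have Z0: "(\<Sum>f\<in>?Z. a ^ dep n L f) = ?l ^ n" by (simp add: card_PiE)
    have CZ: "?C \<subseteq> maps n - ?Z"
    proof
      fix f assume f: "f \<in> ?C"
      then have "dep n L f \<ge> 1" using dep_pos[OF _ L] by simp
      then have "f \<notin> ?Z" using dZ[of f] by linarith
      then show "f \<in> maps n - ?Z" using f by (simp add: gens_def)
    qed
    have "(\<Sum>f\<in>?C. a ^ dep n L f) \<le> (\<Sum>f\<in>maps n - ?Z. a ^ dep n L f)"
      using a finite_maps CZ by (intro sum_mono2) auto
    also have "\<dots> = (?l + (q - ?l) * a) ^ n - ?l ^ n"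
      using finite_maps Z Z0 sum_power_dep[OF Lc, of a n] by (simp add: sum_diff q_def)
    also have "?l + (q - ?l) * a = ?l * (1 + (?k - 1) * a)" by (simp add: qkl algebra_simps)
    also have "(?l * (1 + (?k - 1) * a)) ^ n \<le> (?l * (1 + q * a)) ^ n"
      using k a by (intro power_mono mult_left_mono add_left_mono mult_right_mono) auto
    finally show "(\<Sum>f\<in>?C. a ^ dep n L f) \<le> ?l ^ n * ((1 + q * a) ^ n - 1)"
      by (simp only: power_mult_distrib right_diff_distrib mult_1_right)
  qed auto
  also have "\<dots> = q ^ n * exp (n * s) * (exp (- n / (8 * q)) + ((1 + q * a) ^ n - 1))"
    by (simp add: qkl power_mult_distrib algebra_simps)
  finally show ?thesis .
qed

text \<open>Only the class with \<open>low\<close> equal to the whole group has the full order q^n: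
  one character kills the group and \<open>dep\<close> is 0, so each of its tuples costs about 1.
  All other classes fall under \<open>class_sum_le\<close>.\<close>

lemma gens_sum_le:
  fixes b \<eta> \<delta> q s a :: real and n :: nat
  defines "q \<equiv> real (order G)"
  defines "s \<equiv> q * exp (- b * \<delta> * n)"
  defines "a \<equiv> exp (- n * b / (2 * q\<^sup>2))"
  assumes \<eta>: "\<eta> = q * \<delta>" "0 \<le> \<delta>" and b: "b \<ge> 0"
    and t: "(1 / (4 * q\<^sup>2)) powr (- \<eta>) \<le> exp (1 / (8 * q))"
  shows "(\<Sum>f\<in>gens n. (\<Sum>\<psi>\<in>chars G. exp (- b * wt n f \<psi>)) ^ n)
     \<le> q ^ n * exp (n * s) * (1 + exp (- n / (2 * q)) + 
         card {L. subgroup L G} * (exp (- n / (8 * q)) + ((1 + q * a) ^ n - 1)))"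
proof -
  let ?w = "\<lambda>f. (\<Sum>\<psi>\<in>chars G. exp (- b * wt n f \<psi>)) ^ n"
  let ?S = "{L. subgroup L G}"
  let ?e = "q ^ n * exp (n * s) * (exp (- n / (8 * q)) + ((1 + q * a) ^ n - 1))"
  have q: "q \<ge> 1" using order_pos by (simp add: q_def)
  have a: "a > 0" by (simp add: a_def)
  have "(1 + q * a) ^ n \<ge> 1" using q a by (intro one_le_power) auto
  then have e: "?e \<ge> 0" using q by simp
  have fg: "finite (gens n)" using finite_maps by (rule finite_subset[rotated]) (auto simp: gens_def)
  have "(\<Sum>f\<in>gens n. ?w f) = (\<Sum>L\<in>?S. \<Sum>f\<in>{f \<in> gens n. low n \<delta> f = L}. ?w f)"
    using fg finite_subgroups subgroup_low by (subst sum.group) auto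
  also have "\<dots> = (\<Sum>f\<in>{f \<in> gens n. low n \<delta> f = carrier G}. ?w f)
      + (\<Sum>L\<in>?S - {carrier G}. \<Sum>f\<in>{f \<in> gens n. low n \<delta> f = L}. ?w f)"
    using finite_subgroups subgroup_self by (intro sum.remove) auto
  also have "(\<Sum>L\<in>?S - {carrier G}. \<Sum>f\<in>{f \<in> gens n. low n \<delta> f = L}. ?w f) \<le> (\<Sum>L\<in>?S - {carrier G}. ?e)"
    unfolding q_def s_def a_def
    by (intro sum_mono class_sum_le[OF _ _ \<eta>(1)[unfolded q_def] \<eta>(2) b t[unfolded q_def]]) auto
  also have "\<dots> \<le> (\<Sum>L\<in>?S. ?e)"
    using e finite_subgroups by (intro sum_mono2) auto
  also have "\<dots> = card ?S * ?e" by simp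
  also have "(\<Sum>f\<in>{f \<in> gens n. low n \<delta> f = carrier G}. ?w f)
    \<le> (\<Sum>f\<in>{f \<in> gens n. low n \<delta> f = carrier G}. exp (n * s) * (exp (- n / (2 * q)) + 1))"
  proof (intro sum_mono)
    fix f assume f: "f \<in> {f \<in> gens n. low n \<delta> f = carrier G}"
    then have fm: "f \<in> maps n" by (simp add: gens_def)
    have "{i \<in> {1..n}. f i \<notin> carrier G} = {}" using maps_mem[OF fm] by auto
    then have d: "dep n (carrier G) f = 0" unfolding dep_def by simp
    have "card (ann G (carrier G)) = 1" using card_ann[OF subgroup_self] order_pos by (simp add: order_def)
    then show "?w f \<le> exp (n * s) * (exp (- n / (2 * q)) + 1)"
      using char_sum_power_le[OF fm b, of "carrier G" \<delta>] f d by (simp add: s_def q_def)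
  qed
  also have "\<dots> \<le> (\<Sum>f\<in>maps n. exp (n * s) * (exp (- n / (2 * q)) + 1))"
    using finite_maps by (intro sum_mono2) (auto simp: gens_def)
  also have "\<dots> = q ^ n * exp (n * s) * (1 + exp (- n / (2 * q)))"
    by (simp add: card_maps q_def algebra_simps)
  finally show ?thesis by (simp add: algebra_simps)
qed

text \<open>For all but exponentially few tuples every nontrivial character has weight at least
  \<delta> n. A proper subgroup has index at least 2, and this factor 1/2 outweighs the entropy in
  \<open>card_low_eq_le\<close>.\<close>

lemma bad_maps_le:
  fixes \<eta> \<delta> q :: real
  defines "q \<equiv> real (order G)"
  assumes \<eta>: "\<eta> = q * \<delta>" "0 \<le> \<delta>"
    and t: "(1 / (4 * q\<^sup>2)) powr (- \<eta>) \<le> exp (1 / (8 * q))"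
  shows "card {f \<in> maps n. low n \<delta> f \<noteq> carrier G} \<le> card {L. subgroup L G} * (q ^ n * (3 / 4) ^ n)"
proof -
  let ?S = "{L. subgroup L G}"
  have q: "q \<ge> 1" using order_pos by (simp add: q_def)
  have cl: "card {f \<in> maps n. low n \<delta> f = L} \<le> q ^ n * (3 / 4) ^ n" if L: "subgroup L G" "L \<noteq> carrier G" for L
  proof -
    let ?l = "real (card L)" let ?k = "real (card (ann G L))"
    have qkl: "q = ?k * ?l" using card_ann[OF L(1)] by (simp add: q_def flip: of_nat_mult)
    have k: "2 \<le> ?k" "?k \<le> q" using card_ann_bounds[OF L(1)] proper_subgroup_index[OF L] by (auto simp: q_def)
    have "real (card {f \<in> maps n. low n \<delta> f = L}) \<le> (exp (1 / (8 * q)) * (?l * (1 + (?k - 1) / (4 * q\<^sup>2)))) ^ n"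
      unfolding q_def by (rule card_low_eq_le[OF L(1) \<eta>(1)[unfolded q_def] \<eta>(2) t[unfolded q_def]])
    also have "\<dots> \<le> (q * (3 / 4)) ^ n"
    proof (intro power_mono)
      \<comment> \<open>Index at least 2 forces q \<ge> 2, and the three factors 6/5, 1/2 and 9/8
        multiply to 27/40, below 3/4.\<close>
      have "exp (1 / (8 * q)) \<le> exp (1 / 16)" using k by (simp add: field_simps)
      also have "\<dots> \<le> 1 + 1 / 16 + (1 / 16)\<^sup>2" by (rule exp_bound) auto
      finally have e: "exp (1 / (8 * q)) \<le> 6 / 5" by (simp add: power2_eq_square)
      have "(?k - 1) / (4 * q\<^sup>2) \<le> q / (4 * q\<^sup>2)" using k by (intro divide_right_mono) auto
      also have "\<dots> = 1 / (4 * q)" using q by (simp add: power2_eq_square)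
      also have "\<dots> \<le> 1 / 8" using k by (simp add: field_simps)
      finally have "?l * (1 + (?k - 1) / (4 * q\<^sup>2)) \<le> q / 2 * (1 + 1 / 8)"
        using k by (intro mult_mono) (auto simp: qkl mult_right_mono[of 2 ?k ?l])
      note X = this
      have "exp (1 / (8 * q)) * (?l * (1 + (?k - 1) / (4 * q\<^sup>2))) \<le> 6 / 5 * (q / 2 * (1 + 1 / 8))"
        by (rule mult_mono[OF e X])
          (use k in \<open>auto intro!: mult_nonneg_nonneg add_nonneg_nonneg divide_nonneg_nonneg\<close>)
      also have "\<dots> \<le> q * (3 / 4)" using q by simp
      finally show "exp (1 / (8 * q)) * (?l * (1 + (?k - 1) / (4 * q\<^sup>2))) \<le> q * (3 / 4)" .
    qed (use k in auto)
    finally show ?thesis by (simp only: power_mult_distrib)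
  qed
  have "{f \<in> maps n. low n \<delta> f \<noteq> carrier G} = (\<Union>L\<in>?S - {carrier G}. {f \<in> maps n. low n \<delta> f = L})"
    using subgroup_low by auto
  then have "real (card {f \<in> maps n. low n \<delta> f \<noteq> carrier G}) \<le> real (\<Sum>L\<in>?S - {carrier G}. card {f \<in> maps n. low n \<delta> f = L})"
    using finite_subgroups by (simp add: card_UN_le del: of_nat_sum)
  also have "\<dots> = (\<Sum>L\<in>?S - {carrier G}. real (card {f \<in> maps n. low n \<delta> f = L}))" by simp
  also have "\<dots> \<le> (\<Sum>L\<in>?S - {carrier G}. q ^ n * (3 / 4) ^ n)"
    using cl by (intro sum_mono) auto
  also have "\<dots> \<le> (\<Sum>L\<in>?S. q ^ n * (3 / 4) ^ n)"
    using q finite_subgroups by (intro sum_mono2) auto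
  finally show ?thesis by simp
qed

end

section \<open>The limit of the sum over generating tuples\<close>

lemma rare_exp_tendsto:
  fixes \<epsilon> :: "nat \<Rightarrow> real"
  assumes \<epsilon>: "\<And>\<Delta>::real. \<Delta> > 0 \<Longrightarrow> \<forall>\<^sub>F n in sequentially. \<epsilon> n \<ge> \<Delta> * ln (real n) / real n"
    and b: "b > 0"
  shows "(\<lambda>n. real n * exp (- (b * \<epsilon> n) * n)) \<longlonglongrightarrow> 0"
proof (rule tendsto_sandwich)
  show "\<forall>\<^sub>F n in sequentially. 0 \<le> real n * exp (- (b * \<epsilon> n) * n)" by simp
  show "(\<lambda>n. 1 / real n) \<longlonglongrightarrow> 0" by (rule lim_1_over_n)
  show "(\<lambda>n. 0::real) \<longlonglongrightarrow> 0" by simp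
  \<comment> \<open>With \<Delta> = 2/b the growth hypothesis bounds the exponential by n^{-2}, and
    the factor n leaves 1/n.\<close>
  have "\<forall>\<^sub>F n in sequentially. \<epsilon> n \<ge> (2 / b) * ln (real n) / real n"
    using b by (intro \<epsilon>) simp
  then show "\<forall>\<^sub>F n in sequentially. real n * exp (- (b * \<epsilon> n) * n) \<le> 1 / real n"
    using eventually_gt_at_top[of 0]
  proof eventually_elim
    case (elim n)
    have "2 * ln n = b * ((2 / b) * ln (real n) / real n) * n" using b elim by simp
    also have "\<dots> \<le> b * \<epsilon> n * n" using elim b by (intro mult_right_mono mult_left_mono) auto
    finally have "exp (- (b * \<epsilon> n) * n) \<le> exp (- (2 * ln n))" by simp
    also have "\<dots> = 1 / (real n)\<^sup>2" using elim by (simp add: exp_minus exp_double field_simps)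
    finally have "real n * exp (- (b * \<epsilon> n) * n) \<le> real n * (1 / (real n)\<^sup>2)"
      by (intro mult_left_mono) auto
    then show ?case using elim by (simp add: power2_eq_square)
  qed
qed

context finite_comm_group begin

text \<open>\<open>P n f j\<close> stands for the probability that column \<open>j\<close> satisfies
  its relation; only its closeness to 1/q enters. The upper bound sums over all classes. The lower
  bound keeps the tuples whose \<open>low\<close> is everything: they generate by
  \<open>low_carrier_gens\<close>, and they are almost all tuples by
  \<open>bad_maps_le\<close>.\<close>

theorem gens_sum_tendsto:
  fixes \<epsilon> :: "nat \<Rightarrow> real" and c :: real and P :: "nat \<Rightarrow> (nat \<Rightarrow> 'a) \<Rightarrow> nat \<Rightarrow> real"
  assumes \<epsilon>: "\<And>\<Delta>::real. \<Delta> > 0 \<Longrightarrow> \<forall>\<^sub>F n in sequentially. \<epsilon> n \<ge> \<Delta> * ln (real n) / real n"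
    and \<epsilon>0: "\<And>n. n \<ge> 1 \<Longrightarrow> 0 < \<epsilon> n" and c: "c > 0"
    and P0: "\<And>n f j. n \<ge> 1 \<Longrightarrow> f \<in> maps n \<Longrightarrow> j \<in> {1..n} \<Longrightarrow> 0 \<le> P n f j"
    and P: "\<And>n f j. n \<ge> 1 \<Longrightarrow> f \<in> maps n \<Longrightarrow> j \<in> {1..n} \<Longrightarrow>
      \<bar>order G * P n f j - 1\<bar> \<le> (\<Sum>\<psi>\<in>chars G - {triv_char}. exp (- (c * \<epsilon> n) * wt n f \<psi>))"
  shows "(\<lambda>n. \<Sum>f\<in>gens n. \<Prod>j\<in>{1..n}. P n f j) \<longlonglongrightarrow> 1"
proof -
  define q where "q = real (order G)"
  \<comment> \<open>\<open>\<eta>\<close> makes the moment factor \<open>(1 / (4 * q\<^sup>2)) powr (- \<eta>)\<close> equal to \<open>exp (1 / (8 * q))\<close>.\<close>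
  define \<eta> where "\<eta> = 1 / (8 * q * ln (4 * q\<^sup>2))"
  define \<delta> where "\<delta> = \<eta> / q"
  define N where "N = real (card {L. subgroup L G})"
  define b where "b n = c * \<epsilon> n" for n
  define s where "s n = q * exp (- b n * \<delta> * n)" for n
  define a where "a n = exp (- n * b n / (2 * q\<^sup>2))" for n
  have q: "q \<ge> 1" using order_pos by (simp add: q_def)
  have q2: "q\<^sup>2 \<ge> 1" using q by simp
  then have ln: "ln (4 * q\<^sup>2) > 0" by (intro ln_gt_zero) linarith
  have \<eta>: "\<eta> > 0" unfolding \<eta>_def using q ln by simp
  have \<delta>: "\<delta> > 0" "\<eta> = q * \<delta>" unfolding \<delta>_def using q \<eta> by auto
  have "(1 / (4 * q\<^sup>2)) powr (- \<eta>) = exp (\<eta> * ln (4 * q\<^sup>2))"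
    using q by (simp add: powr_def ln_div)
  also have "\<eta> * ln (4 * q\<^sup>2) = 1 / (8 * q)" using ln q by (simp add: \<eta>_def)
  finally have t: "(1 / (4 * q\<^sup>2)) powr (- \<eta>) \<le> exp (1 / (8 * q))" by simp
  have s0: "s n \<ge> 0" for n using q by (simp add: s_def)
  have b0: "b n \<ge> 0" if "n \<ge> 1" for n using \<epsilon>0[OF that] c by (simp add: b_def)

  \<comment> \<open>The factor n stands for the n columns, each of which may deviate from uniform by
    the relative error \<open>s n\<close>.\<close>
  have ns: "(\<lambda>n. real n * s n) \<longlonglongrightarrow> 0"
  proof -
    have "(\<lambda>n. q * (real n * exp (- (c * \<delta> * \<epsilon> n) * n))) \<longlonglongrightarrow> q * 0"
      using c \<delta> by (intro tendsto_mult_left rare_exp_tendsto \<epsilon>) auto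
    then show ?thesis by (simp add: s_def b_def mult_ac)
  qed
  have na: "(\<lambda>n. real n * a n) \<longlonglongrightarrow> 0"
  proof -
    have "(\<lambda>n. real n * exp (- (c / (2 * q\<^sup>2) * \<epsilon> n) * n)) \<longlonglongrightarrow> 0"
      using c q by (intro rare_exp_tendsto \<epsilon>) auto
    then show ?thesis by (simp add: a_def b_def mult_ac)
  qed
  have expn: "(\<lambda>n. exp (- real n / r)) \<longlonglongrightarrow> 0" if "r > 0" for r
  proof -
    have "(\<lambda>n. exp (- 1 / r) ^ n) \<longlonglongrightarrow> 0" using that by (intro LIMSEQ_realpow_zero) auto
    then show ?thesis by (simp add: exp_of_nat_mult[symmetric])
  qed

  have triv: "wt n f triv_char = 0" if "f \<in> maps n" for n f
  proof -
    have "{i \<in> {1..n}. triv_char (f i) \<noteq> 1} = {}" using maps_mem[OF that] triv_char(2) by blast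
    then show ?thesis unfolding wt_def by simp
  qed
  have split: "(\<Sum>\<psi>\<in>chars G. exp (- b n * wt n f \<psi>)) = 1 + (\<Sum>\<psi>\<in>chars G - {triv_char}. exp (- b n * wt n f \<psi>))"
    if "f \<in> maps n" for n f
    using triv[OF that] finite_chars triv_char(1) by (simp add: sum.remove)
  have gm: "gens n \<subseteq> maps n" for n by (auto simp: gens_def)

  \<comment> \<open>The bound of \<open>gens_sum_le\<close> divided by q^n, with (1 + qa)^n replaced
    by e^{q n a} so that the limit can be read off.\<close>
  define U where "U n = exp (n * s n) * (1 + exp (- real n / (2 * q)) + 
      N * (exp (- real n / (8 * q)) + (exp (q * (n * a n)) - 1)))" for n
  have "U \<longlonglongrightarrow> exp 0 * (1 + 0 + N * (0 + (exp (q * 0) - 1)))"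
    unfolding U_def using q by (intro tendsto_intros ns na expn) auto
  then have U: "U \<longlonglongrightarrow> 1" by simp
  have upper: "(\<Sum>f\<in>gens n. \<Prod>j\<in>{1..n}. P n f j) \<le> U n" if n: "n \<ge> 1" for n
  proof -
    have "(\<Prod>j\<in>{1..n}. P n f j) \<le> ((\<Sum>\<psi>\<in>chars G. exp (- b n * wt n f \<psi>)) / q) ^ n" if f: "f \<in> gens n" for f
    proof -
      have fm: "f \<in> maps n" using f gm by blast
      have "P n f j \<le> (\<Sum>\<psi>\<in>chars G. exp (- b n * wt n f \<psi>)) / q" if j: "j \<in> {1..n}" for j
        using P[OF n fm j] q split[OF fm] by (simp add: q_def[symmetric] b_def field_simps abs_le_iff)
      then have "(\<Prod>j\<in>{1..n}. P n f j) \<le> (\<Prod>j\<in>{1..n}. (\<Sum>\<psi>\<in>chars G. exp (- b n * wt n f \<psi>)) / q)"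
        using P0[OF n fm] by (intro prod_mono) auto
      then show ?thesis by simp
    qed
    then have "(\<Sum>f\<in>gens n. \<Prod>j\<in>{1..n}. P n f j) 
        \<le> (\<Sum>f\<in>gens n. ((\<Sum>\<psi>\<in>chars G. exp (- b n * wt n f \<psi>)) / q) ^ n)"
      by (rule sum_mono)
    also have "\<dots> = (\<Sum>f\<in>gens n. (\<Sum>\<psi>\<in>chars G. exp (- b n * wt n f \<psi>)) ^ n) / q ^ n"
      by (simp only: power_divide flip: sum_divide_distrib)
    also have "\<dots> \<le> q ^ n * exp (n * s n) * (1 + exp (- real n / (2 * q)) + 
         N * (exp (- real n / (8 * q)) + ((1 + q * a n) ^ n - 1))) / q ^ n"
      using gens_sum_le[OF \<delta>(2)[unfolded q_def] _ b0[OF n] t[unfolded q_def], of n] \<delta>(1) q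
      by (intro divide_right_mono) (auto simp: q_def s_def a_def N_def)
    also have "\<dots> = exp (n * s n) * (1 + exp (- real n / (2 * q)) + 
         N * (exp (- real n / (8 * q)) + ((1 + q * a n) ^ n - 1)))"
      using q by simp
    also have "\<dots> \<le> U n"
    proof -
      have "(1 + q * a n) ^ n \<le> exp (q * a n) ^ n" 
        using q by (intro power_mono exp_ge_add_one_self) (auto simp: a_def add_nonneg_nonneg)
      also have "\<dots> = exp (q * (n * a n))" by (simp add: exp_of_nat_mult[symmetric] mult_ac)
      finally show ?thesis unfolding U_def by (intro mult_left_mono add_left_mono) (auto simp: N_def)
    qed
    finally show ?thesis .
  qed

  define W where "W n = (1 - N * (3 / 4) ^ n) * (1 - n * s n)" for n
  have "W \<longlonglongrightarrow> (1 - N * 0) * (1 - 0)"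
    unfolding W_def by (intro tendsto_intros ns LIMSEQ_realpow_zero) auto
  then have W: "W \<longlonglongrightarrow> 1" by simp
  have "(\<lambda>n. N * (3 / 4) ^ n) \<longlonglongrightarrow> N * 0" by (intro tendsto_intros LIMSEQ_realpow_zero) auto
  then have "\<forall>\<^sub>F n in sequentially. N * (3 / 4) ^ n < 1" by (intro order_tendstoD(2)) auto
  moreover have "\<forall>\<^sub>F n in sequentially. n * s n < 1" using ns by (intro order_tendstoD(2)) auto
  ultimately have lower: "\<forall>\<^sub>F n in sequentially. W n \<le> (\<Sum>f\<in>gens n. \<Prod>j\<in>{1..n}. P n f j)"
    using eventually_ge_at_top[of 1]
  proof eventually_elim
    case (elim n)
    let ?good = "{f \<in> maps n. low n \<delta> f = carrier G}"
    have s1: "s n \<le> 1" 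
    proof -
      have "1 * s n \<le> n * s n" using elim s0 by (intro mult_right_mono) auto
      then show ?thesis using elim by simp
    qed
    have good: "?good \<subseteq> gens n" using low_carrier_gens \<delta> elim by auto
    have P1: "(1 - s n) / q \<le> P n f j" if f: "f \<in> ?good" and j: "j \<in> {1..n}" for f j
    proof -
      have fm: "f \<in> maps n" using f by simp
      have "(\<Sum>\<psi>\<in>chars G - {triv_char}. exp (- b n * wt n f \<psi>)) \<le> (\<Sum>\<psi>\<in>chars G - {triv_char}. exp (- b n * \<delta> * n))"
      proof (intro sum_mono)
        fix \<psi> assume \<psi>: "\<psi> \<in> chars G - {triv_char}"
        obtain x where "x \<in> carrier G" "\<psi> x \<noteq> 1" using \<psi> nontriv_char by blast
        then have "\<psi> \<notin> ann G (low n \<delta> f)" using f by (auto simp: ann_def)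
        then have "\<delta> * n \<le> wt n f \<psi>" using not_ann_low \<psi> by simp
        then have "b n * (\<delta> * n) \<le> b n * wt n f \<psi>" using b0[of n] elim by (intro mult_left_mono) auto
        then show "exp (- b n * wt n f \<psi>) \<le> exp (- b n * \<delta> * n)" by (simp add: mult.assoc)
      qed
      also have "\<dots> \<le> (\<Sum>\<psi>\<in>chars G. exp (- b n * \<delta> * n))"
        using finite_chars by (intro sum_mono2) auto
      also have "\<dots> = s n" by (simp add: s_def q_def card_chars)
      finally show ?thesis
        using P[OF _ fm j] elim q by (simp add: q_def[symmetric] b_def field_simps abs_le_iff)
    qed
    have "card ?good + card {f \<in> maps n. low n \<delta> f \<noteq> carrier G} = card (maps n)"
      using finite_maps by (subst card_Un_disjoint[symmetric]) (auto intro: arg_cong[where f = card])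
    then have "real (card ?good) = q ^ n - card {f \<in> maps n. low n \<delta> f \<noteq> carrier G}"
      by (simp add: card_maps q_def flip: of_nat_power)
    moreover have "card {f \<in> maps n. low n \<delta> f \<noteq> carrier G} \<le> N * (q ^ n * (3 / 4) ^ n)"
      unfolding N_def q_def using \<delta>(1)
      by (intro bad_maps_le[OF \<delta>(2)[unfolded q_def] _ t[unfolded q_def]]) auto
    ultimately have g: "q ^ n * (1 - N * (3 / 4) ^ n) \<le> card ?good" by (simp add: algebra_simps)
    \<comment> \<open>Bernoulli's inequality keeps the total loss over all columns at n s.\<close>
    have "1 + real n * (- s n) \<le> (1 + (- s n)) ^ n"
      using s1 by (intro Bernoulli_inequality) auto
    then have bern: "1 - n * s n \<le> (1 - s n) ^ n" by simp
    have "W n \<le> (1 - N * (3 / 4) ^ n) * (1 - s n) ^ n"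
      unfolding W_def using elim bern by (intro mult_left_mono) auto
    also have "\<dots> = q ^ n * (1 - N * (3 / 4) ^ n) * ((1 - s n) / q) ^ n"
      using q by (simp add: power_divide)
    also have "\<dots> \<le> card ?good * ((1 - s n) / q) ^ n"
      using g s1 q by (intro mult_right_mono) auto
    also have "\<dots> = (\<Sum>f\<in>?good. \<Prod>j\<in>{1..n}. (1 - s n) / q)" by simp
    also have "\<dots> \<le> (\<Sum>f\<in>?good. \<Prod>j\<in>{1..n}. P n f j)"
      using P1 s1 q by (intro sum_mono prod_mono) auto
    also have "\<dots> \<le> (\<Sum>f\<in>gens n. \<Prod>j\<in>{1..n}. P n f j)"
    proof (rule sum_mono2[OF _ good])
      show "finite (gens n)" using finite_maps gm by (rule finite_subset[rotated])
      show "0 \<le> (\<Prod>j\<in>{1..n}. P n f j)" if "f \<in> gens n - ?good" for f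
        using that P0 gm[of n] elim by (intro prod_nonneg ballI P0) auto
    qed
    finally show ?case .
  qed
  show ?thesis
    by (rule tendsto_sandwich[OF lower eventually_mono[OF eventually_ge_at_top[of 1] upper] W U])
qed

end

section \<open>Balanced variables and Fourier inversion\<close>

lemma root_of_unity_gap:
  assumes "Q > 0"
  obtains c :: real where "c > 0" "\<And>w::complex. w ^ Q = 1 \<Longrightarrow> w \<noteq> 1 \<Longrightarrow> c \<le> 1 - Re w"
proof -
  \<comment> \<open>The inserted 1 keeps the minimum defined when no root other than 1 exists, that
    is for \<open>Q = 1\<close>.\<close>
  let ?S = "insert 1 ((\<lambda>w. 1 - Re w) ` ({w. w ^ Q = 1} - {1}))"
  have fin: "finite ?S" using assms by (intro finite.insertI finite_imageI finite_Diff finite_roots_unity) auto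
  have pos: "x > 0" if x: "x \<in> ?S" for x
  proof -
    have "Re w < 1" if w: "w ^ Q = 1" "w \<noteq> 1" for w :: complex
    proof (rule ccontr)
      assume "\<not> Re w < 1"
      moreover have "norm w = 1" using w(1) assms
        by (metis norm_power norm_one norm_ge_zero power_eq_1_iff less_numeral_extra(3))
      moreover have "Re w \<le> norm w" by (rule complex_Re_le_cmod)
      ultimately have "Re w = 1" "norm w = 1" by auto
      then have "Im w = 0" by (metis add_cancel_left_right cmod_power2 one_power2 zero_eq_power2)
      then show False using w(2) \<open>Re w = 1\<close> by (simp add: complex_eq_iff)
    qed
    then show ?thesis using x by force
  qed
  show ?thesis
  proof (rule that[of "Min ?S"])
    show "Min ?S > 0" using fin pos by (subst Min_gr_iff) auto
    fix w :: complex assume "w ^ Q = 1" "w \<noteq> 1"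
    then show "Min ?S \<le> 1 - Re w" using fin by (intro Min_le) auto
  qed
qed

text \<open>The order of \<open>z\<close> is a power of \<open>p\<close>. An exponent difference
  prime to \<open>p\<close> would be invertible modulo p^K and force \<open>z = 1\<close>.\<close>

lemma power_eq_power_imp_cong:
  fixes z :: complex
  assumes p: "prime p" and z: "z ^ (p ^ K) = 1" "z \<noteq> 1" and eq: "z ^ r = z ^ s"
  shows "[r = s] (mod p)"
proof -
  have *: "[r = s] (mod p)" if eq: "z ^ r = z ^ s" and le: "r \<le> s" for r s
  proof (rule ccontr)
    assume n: "\<not> ?thesis"
    have "z \<noteq> 0" using z(1) p by (auto simp: power_0_left prime_gt_0_nat split: if_splits)
    moreover have "z ^ s = z ^ r * z ^ (s - r)" using le by (simp flip: power_add)
    ultimately have d: "z ^ (s - r) = 1" using eq by simp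
    have "\<not> p dvd s - r" using n le by (metis cong_altdef_nat cong_sym)
    then have "coprime (s - r) (p ^ K)" using p
      by (metis coprime_commute coprime_power_left_iff prime_imp_coprime)
    moreover have "s - r \<noteq> 0" using \<open>\<not> p dvd s - r\<close> by (metis dvd_0_right)
    ultimately obtain x y where "(s - r) * x = p ^ K * y + 1" 
      using bezout_nat[of "s - r" "p ^ K"] by auto
    then have "z ^ ((s - r) * x) = z ^ (p ^ K * y + 1)" by simp
    then show False using d z by (simp add: power_mult power_add)
  qed
  show ?thesis
    using *[of r s] *[of s r] eq by (metis cong_sym nat_le_linear)
qed

text \<open>The squared modulus is the expectation of $z^{X - X'}$ for independent copies \<open>X\<close>, \<open>X'\<close>, which
  are incongruent modulo \<open>p\<close> with probability at least \<open>\<epsilon>\<close>.\<close>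

lemma balanced_char_sum:
  fixes a :: "nat \<Rightarrow> real" and z :: complex
  assumes p: "prime p" and z: "z ^ (p ^ K) = 1" "z \<noteq> 1"
    and R: "finite R" and a: "\<And>r. a r \<ge> 0" "(\<Sum>r\<in>R. a r) = 1"
    and bal: "\<And>r. r \<in> R \<Longrightarrow> (\<Sum>s\<in>{s\<in>R. [s = r] (mod p)}. a s) \<le> 1 - \<epsilon>"
    and c0: "c0 \<ge> 0" "\<And>w::complex. w ^ (p ^ K) = 1 \<Longrightarrow> w \<noteq> 1 \<Longrightarrow> c0 \<le> 1 - Re w"
  shows "norm (\<Sum>r\<in>R. a r * z ^ r) \<le> exp (- (c0 / 2 * \<epsilon>))"
proof -
  have "p ^ K > 0" using p by (simp add: prime_gt_0_nat)
  then have nz: "norm z = 1" using z(1)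
    by (metis norm_power norm_one norm_ge_zero power_eq_1_iff less_numeral_extra(3))
  have zc: "z * cnj z = 1" using nz by (simp add: complex_norm_square[symmetric])
  \<comment> \<open>The product is z^(r-s). For incongruent exponents it is a p^K-th root of unity
    other than 1 and its real part drops by \<open>c0\<close>; congruent pairs get the trivial
    bound.\<close>
  have pair: "Re (z ^ r * cnj (z ^ s)) \<le> 1 - (if [s = r] (mod p) then 0 else c0)" for r s
  proof (cases "[s = r] (mod p)")
    case True
    have "Re (z ^ r * cnj (z ^ s)) \<le> norm (z ^ r * cnj (z ^ s))" by (rule complex_Re_le_cmod)
    then show ?thesis using True nz by (simp add: norm_mult norm_power)
  next
    case False
    let ?w = "z ^ r * cnj (z ^ s)"
    have "(cnj z) ^ (p ^ K) = 1" using z(1) by (metis complex_cnj_one complex_cnj_power)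
    then have "?w ^ (p ^ K) = 1" using z(1)
      by (simp add: power_mult_distrib power_commutes flip: power_mult) (simp add: mult.commute[of _ "p ^ K"] power_mult)
    moreover have "?w \<noteq> 1"
    proof
      assume "?w = 1"
      moreover have "z ^ s * cnj (z ^ s) = 1" using zc by (simp flip: power_mult_distrib)
      moreover have "cnj (z ^ s) \<noteq> 0" using nz by auto
      ultimately have "z ^ r = z ^ s" by (metis mult_right_cancel)
      then show False using power_eq_power_imp_cong[OF p z] False by (metis cong_sym)
    qed
    ultimately have "c0 \<le> 1 - Re ?w" by (rule c0(2))
    then show ?thesis using False by simp
  qed
  have Re_mult: "Re (of_real x * w) = x * Re w" for x w by simp
  let ?S = "\<Sum>r\<in>R. a r * z ^ r"
  have "(norm ?S)\<^sup>2 = Re (?S * cnj ?S)" by (subst complex_norm_square[symmetric]) (rule Re_complex_of_real[symmetric])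
  also have "?S * cnj ?S = (\<Sum>r\<in>R. \<Sum>s\<in>R. of_real (a r * a s) * (z ^ r * cnj (z ^ s)))"
    by (simp add: sum_product mult_ac)
  also have "Re \<dots> = (\<Sum>r\<in>R. \<Sum>s\<in>R. a r * a s * Re (z ^ r * cnj (z ^ s)))"
    by (simp only: Re_sum Re_mult)
  also have "\<dots> \<le> (\<Sum>r\<in>R. \<Sum>s\<in>R. a r * a s * (1 - (if [s = r] (mod p) then 0 else c0)))"
    using a by (intro sum_mono mult_left_mono pair) auto
  also have "\<dots> = (\<Sum>r\<in>R. a r * (\<Sum>s\<in>R. (1 - c0) * a s + c0 * (if [s = r] (mod p) then a s else 0)))"
    by (intro sum.cong refl) (auto simp: sum_distrib_left algebra_simps intro!: sum.cong)
  also have "\<dots> = (\<Sum>r\<in>R. a r * ((1 - c0) + c0 * (\<Sum>s\<in>{s\<in>R. [s = r] (mod p)}. a s)))"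
    using a R by (simp add: sum.distrib sum.inter_filter flip: sum_distrib_left)
  also have "\<dots> \<le> (\<Sum>r\<in>R. a r * ((1 - c0) + c0 * (1 - \<epsilon>)))"
    using a bal c0(1) by (intro sum_mono mult_left_mono add_left_mono) auto
  also have "\<dots> = 1 - c0 * \<epsilon>" by (simp only: sum_distrib_right[symmetric] a(2)) (simp add: algebra_simps)
  also have "\<dots> \<le> exp (- (c0 * \<epsilon>))" using exp_ge_add_one_self[of "- (c0 * \<epsilon>)"] by simp
  \<comment> \<open>So far the square of the norm was bounded; taking the root produces the 2 in
    c0/2.\<close>
  also have "\<dots> = (exp (- (c0 / 2 * \<epsilon>)))\<^sup>2" by (simp flip: exp_double)
  finally show ?thesis by (rule power2_le_imp_le) simp
qed

lemma (in prob_space) expectation_power_char: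
  fixes z :: complex and Y :: "'a \<Rightarrow> nat"
  assumes Y: "Y \<in> M \<rightarrow>\<^sub>M count_space UNIV" "\<And>w. w \<in> space M \<Longrightarrow> Y w < Q"
  shows "expectation (\<lambda>w. z ^ Y w) = (\<Sum>r<Q. prob {w \<in> space M. Y w = r} * z ^ r)"
proof -
  have ms: "{w \<in> space M. Y w = r} \<in> events" for r
    using Y(1) by (rule measurable_sets_Collect) auto
  have "expectation (\<lambda>w. z ^ Y w) = expectation (\<lambda>w. \<Sum>r<Q. indicator {w \<in> space M. Y w = r} w *\<^sub>R z ^ r)"
  proof (rule Bochner_Integration.integral_cong[OF refl])
    fix w assume w: "w \<in> space M"
    have "(\<Sum>r<Q. indicator {w \<in> space M. Y w = r} w *\<^sub>R z ^ r) = (\<Sum>r<Q. if r = Y w then z ^ r else 0)"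
      using w by (intro sum.cong refl) (auto simp: indicator_def)
    then show "z ^ Y w = (\<Sum>r<Q. indicator {w \<in> space M. Y w = r} w *\<^sub>R z ^ r)" using Y(2)[OF w] by simp
  qed
  also have "\<dots> = (\<Sum>r<Q. expectation (\<lambda>w. indicator {w \<in> space M. Y w = r} w *\<^sub>R z ^ r))"
    using ms by (intro Bochner_Integration.integral_sum) (auto simp: emeasure_eq_measure)
  also have "\<dots> = (\<Sum>r<Q. prob {w \<in> space M. Y w = r} * z ^ r)"
    using ms by (intro sum.cong refl) (simp add: scaleR_conv_of_real emeasure_eq_measure Int_absorb2)
  finally show ?thesis .
qed

lemma (in prob_space) balanced_char_expectation:
  fixes z :: complex and Y :: "'a \<Rightarrow> nat"
  assumes p: "prime p" and z: "z ^ (p ^ K) = 1" "z \<noteq> 1"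
    and Y: "Y \<in> M \<rightarrow>\<^sub>M count_space UNIV" "\<And>w. w \<in> space M \<Longrightarrow> Y w < p ^ K"
    and bal: "\<And>r. prob {w \<in> space M. [Y w = r] (mod p)} \<le> 1 - \<epsilon>"
    and c0: "c0 \<ge> 0" "\<And>w::complex. w ^ (p ^ K) = 1 \<Longrightarrow> w \<noteq> 1 \<Longrightarrow> c0 \<le> 1 - Re w"
  shows "norm (expectation (\<lambda>w. z ^ Y w)) \<le> exp (- (c0 / 2 * \<epsilon>))"
proof -
  have ms: "{w \<in> space M. Y w = r} \<in> events" for r
    using Y(1) by (rule measurable_sets_Collect) auto
  have un: "(\<Sum>r\<in>{r \<in> {..<p ^ K}. B r}. prob {w \<in> space M. Y w = r}) = prob {w \<in> space M. B (Y w)}" for B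
  proof -
    have "(\<Sum>r\<in>{r \<in> {..<p ^ K}. B r}. prob {w \<in> space M. Y w = r}) = prob (\<Union>r\<in>{r \<in> {..<p ^ K}. B r}. {w \<in> space M. Y w = r})"
      using ms by (intro finite_measure_finite_Union[symmetric]) (auto simp: disjoint_family_on_def)
    also have "(\<Union>r\<in>{r \<in> {..<p ^ K}. B r}. {w \<in> space M. Y w = r}) = {w \<in> space M. B (Y w)}"
      using Y(2) by auto
    finally show ?thesis .
  qed
  have "norm (\<Sum>r<p ^ K. prob {w \<in> space M. Y w = r} * z ^ r) \<le> exp (- (c0 / 2 * \<epsilon>))"
  proof (rule balanced_char_sum[OF p z _ _ _ _ c0])
    show "(\<Sum>r<p ^ K. prob {w \<in> space M. Y w = r}) = 1"
      using un[of "\<lambda>_. True"] by (simp add: prob_space lessThan_def)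
    show "(\<Sum>s\<in>{s \<in> {..<p ^ K}. [s = r] (mod p)}. prob {w \<in> space M. Y w = s}) \<le> 1 - \<epsilon>" for r
      unfolding un by (rule bal)
  qed auto
  then show ?thesis using expectation_power_char[OF Y, of z] by simp
qed

context finite_comm_group begin

lemma inv_mult_eq_one:
  assumes "x \<in> carrier G" "y \<in> carrier G"
  shows "inv x \<otimes> y = \<one> \<longleftrightarrow> y = x"
proof
  assume "inv x \<otimes> y = \<one>"
  then have "x \<otimes> (inv x \<otimes> y) = x" using assms by simp
  then show "y = x" using assms by (simp add: m_assoc[symmetric])
qed (use assms in simp)

lemma chars_finprod:
  assumes "\<psi> \<in> chars G" "finite I" "g \<in> I \<rightarrow> carrier G"
  shows "\<psi> (\<Otimes>i\<in>I. g i) = (\<Prod>i\<in>I. \<psi> (g i))"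
  using assms(2,3)
proof (induction I rule: finite_induct)
  case (insert i I)
  then show ?case using assms(1) by (simp add: chars_mult finprod_closed)
qed (use assms in \<open>simp add: chars_one\<close>)

text \<open>Fourier inversion on the column: only the nontrivial characters contribute to the error.\<close>

lemma column_prob_bound:
  fixes Y :: "nat \<Rightarrow> 'w \<Rightarrow> nat"
  assumes M: "prob_space M" and p: "prime p" and exponent: "\<And>g. g \<in> carrier G \<Longrightarrow> g [^] (p ^ K) = \<one>"
    and c0: "c0 \<ge> 0" "\<And>w::complex. w ^ (p ^ K) = 1 \<Longrightarrow> w \<noteq> 1 \<Longrightarrow> c0 \<le> 1 - Re w"
    and ind: "prob_space.indep_vars M (\<lambda>_. count_space UNIV) Y {1..n}"
    and Y: "\<And>l w. l \<in> {1..n} \<Longrightarrow> w \<in> space M \<Longrightarrow> Y l w < p ^ K"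
    and bal: "\<And>l r. l \<in> {1..n} \<Longrightarrow> measure M {w \<in> space M. [Y l w = r] (mod p)} \<le> 1 - \<epsilon>"
    and f: "f \<in> maps n" and h: "h \<in> carrier G"
  shows "\<bar>order G * measure M {w \<in> space M. (\<Otimes>l\<in>{1..n}. f l [^] Y l w) = h} - 1\<bar>
     \<le> (\<Sum>\<psi>\<in>chars G - {triv_char}. exp (- (c0 / 2 * \<epsilon>) * wt n f \<psi>))"
proof -
  interpret prob_space M by (rule M)
  let ?g = "\<lambda>w. \<Otimes>l\<in>{1..n}. f l [^] Y l w"
  let ?E = "{w \<in> space M. ?g w = h}"
  have Ym: "Y l \<in> M \<rightarrow>\<^sub>M count_space UNIV" if "l \<in> {1..n}" for l
    using ind that unfolding indep_vars_def by simp
  have fc: "f l \<in> carrier G" if "l \<in> {1..n}" for l using f that by (rule maps_mem)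
  have gc: "?g w \<in> carrier G" for w using fc by (intro finprod_closed) auto
  have ind2: "indep_vars (\<lambda>_. borel) (\<lambda>l w. \<psi> (f l) ^ Y l w) {1..n}" for \<psi>
    by (rule indep_vars_compose2[OF ind]) auto
  have int: "integrable M (\<lambda>w. \<psi> (f l) ^ Y l w)" if "\<psi> \<in> chars G" "l \<in> {1..n}" for \<psi> l
    using Ym[OF that(2)] chars_norm[OF that(1) fc[OF that(2)]]
    by (intro integrable_const_bound[where B = 1]) (auto simp: norm_power intro: measurable_compose)
  have intp: "integrable M (\<lambda>w. \<Prod>l\<in>{1..n}. \<psi> (f l) ^ Y l w)" if "\<psi> \<in> chars G" for \<psi>
    using that by (intro indep_vars_integrable ind2 int) auto
  \<comment> \<open>The indicator of the relation becomes a sum of products of functions of single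
    entries, to which independence applies.\<close>
  have fourier: "(\<Sum>\<psi>\<in>chars G. \<psi> (inv h) * (\<Prod>l\<in>{1..n}. \<psi> (f l) ^ Y l w)) = of_nat (order G) * of_bool (?g w = h)" for w
  proof -
    have "(\<Sum>\<psi>\<in>chars G. \<psi> (inv h) * (\<Prod>l\<in>{1..n}. \<psi> (f l) ^ Y l w)) = (\<Sum>\<psi>\<in>chars G. \<psi> (inv h \<otimes> ?g w))"
      using h gc fc by (intro sum.cong refl) (simp add: chars_mult chars_finprod chars_pow Pi_iff)
    also have "\<dots> = (if inv h \<otimes> ?g w = \<one> then of_nat (order G) else 0)"
      using h gc by (intro sum_chars) auto
    also have "inv h \<otimes> ?g w = \<one> \<longleftrightarrow> ?g w = h"
      by (rule inv_mult_eq_one[OF h gc])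
    finally show ?thesis by simp
  qed
  have gm: "?g \<in> M \<rightarrow>\<^sub>M count_space UNIV"
  proof -
    have "(\<lambda>w. \<lambda>l\<in>{1..n}. Y l w) \<in> M \<rightarrow>\<^sub>M PiM {1..n} (\<lambda>_. count_space (UNIV :: nat set))"
      using Ym by (intro measurable_restrict) auto
    moreover have "PiM {1..n} (\<lambda>_. count_space (UNIV :: nat set)) = count_space ({1..n} \<rightarrow>\<^sub>E UNIV)"
      by (intro count_space_PiM_finite) auto
    ultimately have "(\<lambda>w. \<lambda>l\<in>{1..n}. Y l w) \<in> M \<rightarrow>\<^sub>M count_space ({1..n} \<rightarrow>\<^sub>E UNIV)" by simp
    then have "(\<lambda>w. \<Otimes>l\<in>{1..n}. f l [^] (\<lambda>l\<in>{1..n}. Y l w) l) \<in> M \<rightarrow>\<^sub>M count_space UNIV"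
      by (rule measurable_compose[where g = "\<lambda>y. \<Otimes>l\<in>{1..n}. f l [^] y l"]) simp
    also have "(\<lambda>w. \<Otimes>l\<in>{1..n}. f l [^] (\<lambda>l\<in>{1..n}. Y l w) l) = ?g"
      by (intro ext finprod_cong) (use fc in \<open>auto simp: simp_implies_def\<close>)
    finally show ?thesis .
  qed
  have Ev: "?E \<in> events" using gm by (rule measurable_sets_Collect) auto
  have "complex_of_real (order G * prob ?E) = expectation (\<lambda>w. of_nat (order G) * (indicator ?E w *\<^sub>R 1))"
    using Ev by (simp add: emeasure_eq_measure scaleR_conv_of_real Int_absorb2)
  also have "\<dots> = expectation (\<lambda>w. \<Sum>\<psi>\<in>chars G. \<psi> (inv h) * (\<Prod>l\<in>{1..n}. \<psi> (f l) ^ Y l w))"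
    by (intro Bochner_Integration.integral_cong refl, subst fourier) (auto simp: indicator_def)
  also have "\<dots> = (\<Sum>\<psi>\<in>chars G. expectation (\<lambda>w. \<psi> (inv h) * (\<Prod>l\<in>{1..n}. \<psi> (f l) ^ Y l w)))"
    using intp by (intro Bochner_Integration.integral_sum integrable_mult_right) auto
  also have "\<dots> = (\<Sum>\<psi>\<in>chars G. \<psi> (inv h) * (\<Prod>l\<in>{1..n}. expectation (\<lambda>w. \<psi> (f l) ^ Y l w)))"
  proof (intro sum.cong refl)
    fix \<psi> assume \<psi>: "\<psi> \<in> chars G"
    have "expectation (\<lambda>w. \<Prod>l\<in>{1..n}. \<psi> (f l) ^ Y l w) = (\<Prod>l\<in>{1..n}. expectation (\<lambda>w. \<psi> (f l) ^ Y l w))"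
      by (rule indep_vars_lebesgue_integral[OF _ ind2 int[OF \<psi>]]) auto
    then show "expectation (\<lambda>w. \<psi> (inv h) * (\<Prod>l\<in>{1..n}. \<psi> (f l) ^ Y l w))
        = \<psi> (inv h) * (\<Prod>l\<in>{1..n}. expectation (\<lambda>w. \<psi> (f l) ^ Y l w))"
      using intp[OF \<psi>] by simp
  qed
  also have "\<dots> = triv_char (inv h) * (\<Prod>l\<in>{1..n}. expectation (\<lambda>w. triv_char (f l) ^ Y l w))
     + (\<Sum>\<psi>\<in>chars G - {triv_char}. \<psi> (inv h) * (\<Prod>l\<in>{1..n}. expectation (\<lambda>w. \<psi> (f l) ^ Y l w)))"
    using finite_chars triv_char(1) by (rule sum.remove)
  \<comment> \<open>The trivial character yields the main term.\<close>
  also have "triv_char (inv h) * (\<Prod>l\<in>{1..n}. expectation (\<lambda>w. triv_char (f l) ^ Y l w)) = 1"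
    using h fc by (simp add: triv_char prob_space)
  finally have "complex_of_real (order G * prob ?E - 1) = 
      (\<Sum>\<psi>\<in>chars G - {triv_char}. \<psi> (inv h) * (\<Prod>l\<in>{1..n}. expectation (\<lambda>w. \<psi> (f l) ^ Y l w)))" by simp
  then have "\<bar>order G * prob ?E - 1\<bar> = 
      norm (\<Sum>\<psi>\<in>chars G - {triv_char}. \<psi> (inv h) * (\<Prod>l\<in>{1..n}. expectation (\<lambda>w. \<psi> (f l) ^ Y l w)))"
    by (simp only: flip: norm_of_real[where ?'a = complex])
  also have "\<dots> \<le> (\<Sum>\<psi>\<in>chars G - {triv_char}. norm (\<psi> (inv h) * (\<Prod>l\<in>{1..n}. expectation (\<lambda>w. \<psi> (f l) ^ Y l w))))"
    by (rule norm_sum)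
  also have "\<dots> \<le> (\<Sum>\<psi>\<in>chars G - {triv_char}. exp (- (c0 / 2 * \<epsilon>) * wt n f \<psi>))"
  proof (intro sum_mono)
    fix \<psi> assume "\<psi> \<in> chars G - {triv_char}"
    then have \<psi>: "\<psi> \<in> chars G" by simp
    \<comment> \<open>The target \<open>h\<close> enters only through a phase of modulus 1, so the
      bound is uniform in \<open>h\<close>.\<close>
    have "norm (\<psi> (inv h) * (\<Prod>l\<in>{1..n}. expectation (\<lambda>w. \<psi> (f l) ^ Y l w)))
       = (\<Prod>l\<in>{1..n}. norm (expectation (\<lambda>w. \<psi> (f l) ^ Y l w)))"
      using chars_norm[OF \<psi>, of "inv h"] h by (simp add: norm_mult prod_norm)
    also have "\<dots> \<le> (\<Prod>l\<in>{1..n}. if \<psi> (f l) \<noteq> 1 then exp (- (c0 / 2 * \<epsilon>)) else 1)"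
    proof (intro prod_mono conjI norm_ge_zero)
      fix l assume l: "l \<in> {1..n}"
      show "norm (expectation (\<lambda>w. \<psi> (f l) ^ Y l w)) \<le> (if \<psi> (f l) \<noteq> 1 then exp (- (c0 / 2 * \<epsilon>)) else 1)"
      proof (cases "\<psi> (f l) = 1")
        case True
        then show ?thesis by (simp add: prob_space)
      next
        case False
        have "\<psi> (f l) ^ (p ^ K) = 1"
          using chars_pow[OF \<psi> fc[OF l], of "p ^ K"] exponent[OF fc[OF l]] chars_one[OF \<psi>] by simp
        then show ?thesis
          using balanced_char_expectation[OF p _ False Ym[OF l] Y[OF l] bal[OF l] c0] False by simp
      qed
    qed
    also have "\<dots> = exp (- (c0 / 2 * \<epsilon>)) ^ wt n f \<psi>"
      by (simp add: prod.If_cases wt_def Int_def)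
    also have "\<dots> = exp (- (c0 / 2 * \<epsilon>) * wt n f \<psi>)" by (simp add: exp_of_nat_mult[symmetric] mult_ac)
    finally show "norm (\<psi> (inv h) * (\<Prod>l\<in>{1..n}. expectation (\<lambda>w. \<psi> (f l) ^ Y l w))) \<le> exp (- (c0 / 2 * \<epsilon>) * wt n f \<psi>)" .
  qed
  finally show ?thesis .
qed

end

section \<open>Surjections from cokernels\<close>

lemma Zp_simps:
  "(x \<oplus>\<^bsub>Zp p\<^esub> y) k = (x k + y k) mod int p ^ k"
  "(x \<otimes>\<^bsub>Zp p\<^esub> y) k = (x k * y k) mod int p ^ k"
  "\<one>\<^bsub>Zp p\<^esub> k = 1 mod int p ^ k"
  "\<zero>\<^bsub>Zp p\<^esub> k = 0"
  by (simp_all add: Zp_def)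

lemma Zp_carrier_iff:
  "x \<in> carrier (Zp p) \<longleftrightarrow> (\<forall>k. 0 \<le> x k \<and> x k < int p ^ k \<and> x (Suc k) mod int p ^ k = x k)"
  by (simp add: Zp_def)

lemma Zp_add_pow:
  fixes n :: nat
  assumes "p > 0" "y \<in> carrier (Zp p)"
  shows "([n] \<cdot>\<^bsub>Zp p\<^esub> y) k = (int n * y k) mod int p ^ k"
proof -
  interpret cring "Zp p" using Zp_cring[OF assms(1)] .
  show ?thesis
  proof (induction n)
    case 0
    then show ?case by (simp add: add_pow_def Zp_simps)
  next
    case (Suc n)
    have "([(Suc n)] \<cdot>\<^bsub>Zp p\<^esub> y) k = (([n] \<cdot>\<^bsub>Zp p\<^esub> y) \<oplus>\<^bsub>Zp p\<^esub> y) k"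
      by (simp add: add_pow_def)
    also have "\<dots> = (int n * y k + y k) mod int p ^ k"
      by (simp only: Zp_simps Suc mod_add_left_eq)
    also have "int n * y k + y k = int (Suc n) * y k" by (simp add: distrib_right)
    finally show ?case .
  qed
qed

lemma (in group) int_pow_mod:
  assumes "x \<in> carrier G" "x [^] (q::nat) = \<one>"
  shows "x [^] (a mod int q) = x [^] (a::int)"
proof -
  have "x [^] a = x [^] (int q * (a div int q) + a mod int q)" by simp
  also have "\<dots> = (x [^] int q) [^] (a div int q) \<otimes> x [^] (a mod int q)"
    using assms(1) by (simp only: int_pow_mult int_pow_pow)
  also have "x [^] int q = \<one>" using assms(2) by (simp only: int_pow_int)
  finally show ?thesis using assms(1) by (simp add: int_pow_one)
qed

text \<open>An abstract homomorphism to a group of exponent \<open>p ^ K\<close> factors through the residue modulo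
  \<open>p ^ K\<close> since \<open>x - x K\<close> is divisible by \<open>p ^ K\<close>.\<close>

lemma hom_add_Zp:
  assumes p: "p > 0" and H: "group H" and exponent: "\<And>g. g \<in> carrier H \<Longrightarrow> g [^]\<^bsub>H\<^esub> (p ^ K) = \<one>\<^bsub>H\<^esub>"
    and \<theta>: "\<theta> \<in> hom (add_monoid (Zp p)) H" and x: "x \<in> carrier (Zp p)"
  shows "\<theta> x = \<theta> \<one>\<^bsub>Zp p\<^esub> [^]\<^bsub>H\<^esub> x K"
proof -
  interpret R: cring "Zp p" using Zp_cring[OF p] .
  interpret A: comm_group "add_monoid (Zp p)" by (rule R.a_comm_group)
  interpret H: group H by (rule H)
  interpret group_hom "add_monoid (Zp p)" H \<theta>
    using \<theta> by unfold_locales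
  \<comment> \<open>The p-adic integer (x - x K) / p^K. Division costs \<open>K\<close> digits, so
    its residue at level \<open>k\<close> is read from \<open>x\<close> at level
    \<open>k + K\<close>.\<close>
  define u where "u k = x (k + K) div int p ^ K" for k
  have pos: "int p ^ j > 0" for j using p by simp
  have mod: "x (j + i) mod int p ^ j = x j" for i j
    using Zp_mod_le[OF x, of j "j + i"] by simp
  have u: "u \<in> carrier (Zp p)"
    unfolding Zp_carrier_iff
  proof safe
    fix k
    have xk: "0 \<le> x (k + K)" "x (k + K) < int p ^ k * int p ^ K"
      using x unfolding power_add[symmetric] Zp_carrier_iff by blast+
    show "0 \<le> u k" unfolding u_def using xk pos[of K] by (simp add: pos_imp_zdiv_nonneg_iff)
    have "u k * int p ^ K \<le> x (k + K)"
      unfolding u_def using div_mult_mod_eq[of "x (k + K)" "int p ^ K"] pos_mod_sign[OF pos[of K], of "x (k + K)"]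
      by linarith
    then have "u k * int p ^ K < int p ^ k * int p ^ K" using xk(2) by linarith
    then show "u k < int p ^ k" using pos[of K] by simp
    have "x (k + K) = x (k + K + 1) mod (int p ^ K * int p ^ k)"
      using mod[of "k + K" 1] by (simp add: power_add mult.commute)
    also have "\<dots> = int p ^ K * (x (k + K + 1) div int p ^ K mod int p ^ k) + x (k + K + 1) mod int p ^ K"
      using pos by (intro zmod_zmult2_eq) (simp add: less_imp_le)
    finally have "x (k + K) div int p ^ K = x (k + K + 1) div int p ^ K mod int p ^ k"
      using pos[of K] by simp
    then show "u (Suc k) mod int p ^ k = u k" by (simp add: u_def)
  qed
  have x0: "0 \<le> x K" using x unfolding Zp_carrier_iff by blast
  have "x = ([(nat (x K))] \<cdot>\<^bsub>Zp p\<^esub> \<one>\<^bsub>Zp p\<^esub>) \<oplus>\<^bsub>Zp p\<^esub> ([(p ^ K)] \<cdot>\<^bsub>Zp p\<^esub> u)"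
  proof
    fix k
    \<comment> \<open>The decomposition is an identity of integers at level \<open>k + K\<close>;
      reducing modulo p^k gives it at level \<open>k\<close>.\<close>
    have "x (k + K) = x K + int p ^ K * u k"
      using mod[of K k] by (metis add.commute mult_div_mod_eq u_def)
    then have "x k = (x K + int p ^ K * u k) mod int p ^ k"
      using mod[of k K] by simp
    then show "x k = (([(nat (x K))] \<cdot>\<^bsub>Zp p\<^esub> \<one>\<^bsub>Zp p\<^esub>) \<oplus>\<^bsub>Zp p\<^esub> ([(p ^ K)] \<cdot>\<^bsub>Zp p\<^esub> u)) k"
      using x0 by (simp add: Zp_simps Zp_add_pow[OF p] u mod_simps)
  qed
  then have "\<theta> x = \<theta> (([(nat (x K))] \<cdot>\<^bsub>Zp p\<^esub> \<one>\<^bsub>Zp p\<^esub>) \<oplus>\<^bsub>Zp p\<^esub> ([(p ^ K)] \<cdot>\<^bsub>Zp p\<^esub> u))" by (rule arg_cong)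
  also have "\<dots> = \<theta> (\<one>\<^bsub>Zp p\<^esub> [^]\<^bsub>add_monoid (Zp p)\<^esub> nat (x K)) \<otimes>\<^bsub>H\<^esub> \<theta> (u [^]\<^bsub>add_monoid (Zp p)\<^esub> (p ^ K))"
    using hom_mult[of "\<one>\<^bsub>Zp p\<^esub> [^]\<^bsub>add_monoid (Zp p)\<^esub> nat (x K)" "u [^]\<^bsub>add_monoid (Zp p)\<^esub> (p ^ K)"] u
      R.add.nat_pow_closed[of "\<one>\<^bsub>Zp p\<^esub>"] R.add.nat_pow_closed[of u]
    by (simp add: add_pow_def)
  also have "\<dots> = \<theta> \<one>\<^bsub>Zp p\<^esub> [^]\<^bsub>H\<^esub> nat (x K) \<otimes>\<^bsub>H\<^esub> \<theta> u [^]\<^bsub>H\<^esub> (p ^ K)"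
    using u hom_nat_pow[of u] hom_nat_pow[of "\<one>\<^bsub>Zp p\<^esub>"] by simp
  also have "\<theta> u [^]\<^bsub>H\<^esub> (p ^ K) = \<one>\<^bsub>H\<^esub>" using u hom_closed[of u] by (intro exponent) simp
  also have "\<theta> \<one>\<^bsub>Zp p\<^esub> [^]\<^bsub>H\<^esub> nat (x K) \<otimes>\<^bsub>H\<^esub> \<one>\<^bsub>H\<^esub> = \<theta> \<one>\<^bsub>Zp p\<^esub> [^]\<^bsub>H\<^esub> nat (x K)"
    using hom_closed[of "\<one>\<^bsub>Zp p\<^esub>"] by (intro H.r_one H.nat_pow_closed) simp
  also have "\<dots> = \<theta> \<one>\<^bsub>Zp p\<^esub> [^]\<^bsub>H\<^esub> int (nat (x K))" by (rule int_pow_int[symmetric])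
  also have "int (nat (x K)) = x K" using x0 by simp
  finally show ?thesis .
qed

section \<open>Homomorphisms out of the free module\<close>

lemma comm_group_product_group:
  assumes "\<And>i. i \<in> I \<Longrightarrow> comm_group (G i)"
  shows "comm_group (product_group I G)"
proof (rule group.group_comm_groupI)
  show "group (product_group I G)" using assms by (simp add: comm_group.axioms(2))
  fix x y assume "x \<in> carrier (product_group I G)" "y \<in> carrier (product_group I G)"
  then have "x i \<otimes>\<^bsub>G i\<^esub> y i = y i \<otimes>\<^bsub>G i\<^esub> x i" if "i \<in> I" for i
    using assms[OF that] that by (auto simp: PiE_iff intro: comm_monoid.m_comm comm_group.axioms(1))
  then show "x \<otimes>\<^bsub>product_group I G\<^esub> y = y \<otimes>\<^bsub>product_group I G\<^esub> x"
    by (auto intro: restrict_ext)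
qed

lemma (in comm_group) finprod_in_subgroup:
  assumes H: "subgroup H G" and "finite I" "\<And>i. i \<in> I \<Longrightarrow> g i \<in> H"
  shows "(\<Otimes>i\<in>I. g i) \<in> H"
  using assms(2,3)
proof (induction I rule: finite_induct)
  case (insert i I)
  then have "g \<in> I \<rightarrow> carrier G" "g i \<in> carrier G" using subgroup.subset[OF H] by auto
  then show ?case using insert H by (simp add: subgroup.m_closed)
qed (use H in \<open>simp add: subgroup.one_closed\<close>)

locale Zp_target = comm_group G for G (structure) +
  fixes p K :: nat
  assumes p: "p > 0" and exponent: "\<And>g. g \<in> carrier G \<Longrightarrow> g [^] (p ^ K) = \<one>"
begin

sublocale R: cring "Zp p" using Zp_cring[OF p] .

text \<open>The homomorphism from the free module that sends the \<open>i\<close>-th standard basis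
  vector to \<open>f i\<close>.\<close>

definition Phi :: "nat \<Rightarrow> (nat \<Rightarrow> 'a) \<Rightarrow> (nat \<Rightarrow> nat \<Rightarrow> int) \<Rightarrow> 'a" where
  "Phi n f v = (\<Otimes>i\<in>{1..n}. f i [^] v i K)"

text \<open>The multiple by \<open>x\<close> of the \<open>j\<close>-th standard basis
  vector.\<close>

definition coord :: "nat \<Rightarrow> nat \<Rightarrow> (nat \<Rightarrow> int) \<Rightarrow> nat \<Rightarrow> nat \<Rightarrow> int" where
  "coord n j x = (\<lambda>l\<in>{1..n}. if l = j then x else \<zero>\<^bsub>Zp p\<^esub>)"

lemma free_mod_simps:
  "carrier (free_mod (Zp p) n) = ({1..n} \<rightarrow>\<^sub>E carrier (Zp p))"
  "x \<otimes>\<^bsub>free_mod (Zp p) n\<^esub> y = (\<lambda>i\<in>{1..n}. x i \<oplus>\<^bsub>Zp p\<^esub> y i)"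
  "\<one>\<^bsub>free_mod (Zp p) n\<^esub> = (\<lambda>i\<in>{1..n}. \<zero>\<^bsub>Zp p\<^esub>)"
  by (simp_all add: free_mod_def)

lemma comm_group_free_mod: "comm_group (free_mod (Zp p) n)"
  unfolding free_mod_def by (intro comm_group_product_group R.a_comm_group)

lemma int_pow_residue: "g \<in> carrier G \<Longrightarrow> g [^] (a mod int p ^ K) = g [^] (a::int)"
  using int_pow_mod[OF _ exponent, of g a] by simp

lemma Phi_closed: "f \<in> {1..n} \<rightarrow> carrier G \<Longrightarrow> Phi n f v \<in> carrier G"
  unfolding Phi_def by (intro finprod_closed) auto

lemma Phi_hom:
  assumes f: "f \<in> {1..n} \<rightarrow> carrier G"
  shows "Phi n f \<in> hom (free_mod (Zp p) n) G"
proof (rule homI)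
  fix v w
  have "Phi n f (v \<otimes>\<^bsub>free_mod (Zp p) n\<^esub> w) = (\<Otimes>i\<in>{1..n}. f i [^] v i K \<otimes> f i [^] w i K)"
    unfolding Phi_def
  proof (intro finprod_cong' refl)
    fix i assume i: "i \<in> {1..n}"
    then have "f i \<in> carrier G" using f by auto
    then show "f i [^] (v \<otimes>\<^bsub>free_mod (Zp p) n\<^esub> w) i K = f i [^] v i K \<otimes> f i [^] w i K"
      using i by (simp add: free_mod_simps Zp_simps int_pow_residue int_pow_mult)
  qed (use f in auto)
  then show "Phi n f (v \<otimes>\<^bsub>free_mod (Zp p) n\<^esub> w) = Phi n f v \<otimes> Phi n f w"
    unfolding Phi_def using f by (simp add: finprod_multf Pi_iff)
qed (use f in \<open>simp add: Phi_closed\<close>)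

lemma coord_hom: "coord n j \<in> hom (add_monoid (Zp p)) (free_mod (Zp p) n)"
  by (rule homI) (auto simp: free_mod_simps coord_def intro!: restrict_ext)

text \<open>By \<open>hom_add_Zp\<close> a group homomorphism is automatically compatible with the
  p-adic scalars on each coordinate axis. The coordinates are then added one at a time.\<close>

lemma hom_free_mod:
  assumes \<psi>: "\<psi> \<in> hom (free_mod (Zp p) n) G" and v: "v \<in> carrier (free_mod (Zp p) n)"
  shows "\<psi> v = Phi n (\<lambda>j. \<psi> (coord n j \<one>\<^bsub>Zp p\<^esub>)) v"
proof -
  interpret V: comm_group "free_mod (Zp p) n" by (rule comm_group_free_mod)
  interpret group_hom "free_mod (Zp p) n" G \<psi> using \<psi> by unfold_locales
  have vi: "v i \<in> carrier (Zp p)" if "i \<in> {1..n}" for i using v that by (auto simp: free_mod_simps)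
  define mask where "mask S = (\<lambda>l\<in>{1..n}. if l \<in> S then v l else \<zero>\<^bsub>Zp p\<^esub>)" for S
  have maskc: "mask S \<in> carrier (free_mod (Zp p) n)" for S
    using vi by (auto simp: mask_def free_mod_simps)
  have coordc: "coord n j x \<in> carrier (free_mod (Zp p) n)" if "x \<in> carrier (Zp p)" for j x
    using that by (auto simp: coord_def free_mod_simps)
  have step: "\<psi> (coord n j (v j)) = \<psi> (coord n j \<one>\<^bsub>Zp p\<^esub>) [^] v j K" if "j \<in> {1..n}" for j
  proof -
    have "\<psi> \<circ> coord n j \<in> hom (add_monoid (Zp p)) G" using coord_hom \<psi> by (rule Group.hom_compose)
    note comp = this
    have "(\<psi> \<circ> coord n j) (v j) = (\<psi> \<circ> coord n j) \<one>\<^bsub>Zp p\<^esub> [^] v j K"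
      by (rule hom_add_Zp[OF p is_group _ comp vi[OF that]]) (rule exponent)
    then show ?thesis by simp
  qed
  have "\<psi> (mask S) = (\<Otimes>i\<in>S. \<psi> (coord n i \<one>\<^bsub>Zp p\<^esub>) [^] v i K)" if "finite S" "S \<subseteq> {1..n}" for S
    using that
  proof (induction S rule: finite_induct)
    case empty
    have "mask {} = \<one>\<^bsub>free_mod (Zp p) n\<^esub>" by (simp add: mask_def free_mod_simps)
    then show ?case by simp
  next
    case (insert j S)
    have "mask (insert j S) = coord n j (v j) \<otimes>\<^bsub>free_mod (Zp p) n\<^esub> mask S"
      using insert vi by (auto simp: mask_def coord_def free_mod_simps intro!: restrict_ext)
    then have "\<psi> (mask (insert j S)) = \<psi> (coord n j (v j)) \<otimes> \<psi> (mask S)"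
      using insert coordc vi maskc by simp
    also have "\<psi> (coord n j (v j)) = \<psi> (coord n j \<one>\<^bsub>Zp p\<^esub>) [^] v j K" using insert by (intro step) auto
    finally show ?case
      using insert coordc by (subst finprod_insert) auto
  qed
  from this[of "{1..n}"] have "\<psi> (mask {1..n}) = Phi n (\<lambda>j. \<psi> (coord n j \<one>\<^bsub>Zp p\<^esub>)) v"
    by (simp add: Phi_def)
  moreover have "mask {1..n} = v"
    using v by (auto simp: mask_def free_mod_simps fun_eq_iff PiE_iff extensional_def)
  ultimately show ?thesis by simp
qed

lemma Phi_coord:
  assumes f: "f \<in> {1..n} \<rightarrow> carrier G" and j: "j \<in> {1..n}"
  shows "Phi n f (coord n j \<one>\<^bsub>Zp p\<^esub>) = f j"
proof -
  have fj: "f i \<in> carrier G" if "i \<in> {1..n}" for i using f that by auto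
  have "Phi n f (coord n j \<one>\<^bsub>Zp p\<^esub>) = (\<Otimes>i\<in>{1..n}. if j = i then f i else \<one>)"
    unfolding Phi_def
  proof (intro finprod_cong' refl)
    fix i assume i: "i \<in> {1..n}"
    \<comment> \<open>The residue of the unit is 1 modulo p^K, which is 0 for \<open>K = 0\<close>;
      \<open>int_pow_residue\<close> covers that case, where the exponent condition makes the group
      trivial.\<close>
    show "f i [^] coord n j \<one>\<^bsub>Zp p\<^esub> i K = (if j = i then f i else \<one>)"
      using int_pow_residue[OF fj[OF i], of 1] fj[OF i] i by (auto simp: coord_def Zp_simps)
  qed (use f in auto)
  also have "\<dots> = f j" using finprod_singleton[OF j, of f] f by simp
  finally show ?thesis .
qed

lemma coord_one_closed: "coord n j \<one>\<^bsub>Zp p\<^esub> \<in> carrier (free_mod (Zp p) n)"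
  by (auto simp: coord_def free_mod_simps)

text \<open>Generating as a group and as a p-adic module is the same, since p-adic scalars act
  through integer powers.\<close>

lemma Phi_image:
  assumes f: "f \<in> {1..n} \<rightarrow> carrier G"
  shows "Phi n f ` carrier (free_mod (Zp p) n) = generate G (f ` {1..n})"
proof
  interpret V: comm_group "free_mod (Zp p) n" by (rule comm_group_free_mod)
  interpret group_hom "free_mod (Zp p) n" G "Phi n f" using Phi_hom[OF f] by unfold_locales
  have sub: "f ` {1..n} \<subseteq> carrier G" using f by auto
  have H: "subgroup (generate G (f ` {1..n})) G" using sub by (rule generate_is_subgroup)
  show "Phi n f ` carrier (free_mod (Zp p) n) \<subseteq> generate G (f ` {1..n})"
  proof (rule image_subsetI)
    fix v :: "nat \<Rightarrow> nat \<Rightarrow> int"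
    have "f i [^] v i K \<in> generate G (f ` {1..n})" if "i \<in> {1..n}" for i
      by (rule subgroup_int_pow_closed[OF H generate.incl[OF imageI[OF that]]])
    then show "Phi n f v \<in> generate G (f ` {1..n})"
      unfolding Phi_def by (intro finprod_in_subgroup[OF H]) auto
  qed
  show "generate G (f ` {1..n}) \<subseteq> Phi n f ` carrier (free_mod (Zp p) n)"
  proof (rule generate_subgroup_incl[OF _ img_is_subgroup])
    show "f ` {1..n} \<subseteq> Phi n f ` carrier (free_mod (Zp p) n)"
    proof (rule image_subsetI)
      fix i assume "i \<in> {1..n}"
      then show "f i \<in> Phi n f ` carrier (free_mod (Zp p) n)"
        using Phi_coord[OF f] coord_one_closed by (intro image_eqI[of _ _ "coord n i \<one>\<^bsub>Zp p\<^esub>"]) auto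
    qed
  qed
qed

lemma mat_vec_hom:
  assumes B: "\<And>i j. i \<in> {1..n} \<Longrightarrow> j \<in> {1..n} \<Longrightarrow> B i j \<in> carrier (Zp p)"
  shows "mat_vec (Zp p) n B \<in> hom (free_mod (Zp p) n) (free_mod (Zp p) n)"
proof (rule homI)
  fix v w assume v: "v \<in> carrier (free_mod (Zp p) n)" and w: "w \<in> carrier (free_mod (Zp p) n)"
  have c: "v j \<in> carrier (Zp p)" "w j \<in> carrier (Zp p)" if "j \<in> {1..n}" for j
    using v w that by (auto simp: free_mod_simps)
  show "mat_vec (Zp p) n B v \<in> carrier (free_mod (Zp p) n)"
    using B c by (auto simp: mat_vec_def free_mod_simps intro!: R.finsum_closed)
  show "mat_vec (Zp p) n B (v \<otimes>\<^bsub>free_mod (Zp p) n\<^esub> w) = mat_vec (Zp p) n B v \<otimes>\<^bsub>free_mod (Zp p) n\<^esub> mat_vec (Zp p) n B w"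
    unfolding mat_vec_def free_mod_simps
  proof (intro restrict_ext)
    fix i assume i: "i \<in> {1..n}"
    have "(\<Oplus>\<^bsub>Zp p\<^esub>j\<in>{1..n}. B i j \<otimes>\<^bsub>Zp p\<^esub> (\<lambda>i\<in>{1..n}. v i \<oplus>\<^bsub>Zp p\<^esub> w i) j)
        = (\<Oplus>\<^bsub>Zp p\<^esub>j\<in>{1..n}. (B i j \<otimes>\<^bsub>Zp p\<^esub> v j) \<oplus>\<^bsub>Zp p\<^esub> (B i j \<otimes>\<^bsub>Zp p\<^esub> w j))"
      using B[OF i] c by (intro R.finsum_cong') (auto simp: R.r_distr)
    also have "\<dots> = (\<Oplus>\<^bsub>Zp p\<^esub>j\<in>{1..n}. B i j \<otimes>\<^bsub>Zp p\<^esub> v j) \<oplus>\<^bsub>Zp p\<^esub> (\<Oplus>\<^bsub>Zp p\<^esub>j\<in>{1..n}. B i j \<otimes>\<^bsub>Zp p\<^esub> w j)"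
      using B[OF i] c by (intro R.finsum_addf) auto
    finally show "(\<Oplus>\<^bsub>Zp p\<^esub>j\<in>{1..n}. B i j \<otimes>\<^bsub>Zp p\<^esub> (\<lambda>i\<in>{1..n}. v i \<oplus>\<^bsub>Zp p\<^esub> w i) j) =
         (\<lambda>i\<in>{1..n}. \<Oplus>\<^bsub>Zp p\<^esub>j\<in>{1..n}. B i j \<otimes>\<^bsub>Zp p\<^esub> v j) i \<oplus>\<^bsub>Zp p\<^esub>
         (\<lambda>i\<in>{1..n}. \<Oplus>\<^bsub>Zp p\<^esub>j\<in>{1..n}. B i j \<otimes>\<^bsub>Zp p\<^esub> w j) i"
      using i by simp
  qed
qed

lemma mat_vec_coord:
  assumes B: "\<And>i j. i \<in> {1..n} \<Longrightarrow> j \<in> {1..n} \<Longrightarrow> B i j \<in> carrier (Zp p)" and j: "j \<in> {1..n}"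
  shows "mat_vec (Zp p) n B (coord n j \<one>\<^bsub>Zp p\<^esub>) = (\<lambda>i\<in>{1..n}. B i j)"
  unfolding mat_vec_def
proof (intro restrict_ext)
  fix i assume i: "i \<in> {1..n}"
  have "(\<Oplus>\<^bsub>Zp p\<^esub>l\<in>{1..n}. B i l \<otimes>\<^bsub>Zp p\<^esub> coord n j \<one>\<^bsub>Zp p\<^esub> l)
      = (\<Oplus>\<^bsub>Zp p\<^esub>l\<in>{1..n}. if j = l then B i l else \<zero>\<^bsub>Zp p\<^esub>)"
    using B[OF i] by (intro R.finsum_cong') (auto simp: coord_def)
  also have "\<dots> = B i j"
    using B[OF i] j by (intro R.finsum_singleton) auto
  finally show "(\<Oplus>\<^bsub>Zp p\<^esub>l\<in>{1..n}. B i l \<otimes>\<^bsub>Zp p\<^esub> coord n j \<one>\<^bsub>Zp p\<^esub> l) = B i j" .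
qed

text \<open>A homomorphism on the free module is trivial as soon as it kills the basis vectors,
  which \<open>mat_vec\<close> sends to the columns of \<open>B\<close>.\<close>

lemma Phi_mat_vec_eq_one_iff:
  assumes B: "\<And>i j. i \<in> {1..n} \<Longrightarrow> j \<in> {1..n} \<Longrightarrow> B i j \<in> carrier (Zp p)"
    and f: "f \<in> {1..n} \<rightarrow> carrier G"
  shows "(\<forall>v\<in>carrier (free_mod (Zp p) n). Phi n f (mat_vec (Zp p) n B v) = \<one>) \<longleftrightarrow>
     (\<forall>j\<in>{1..n}. (\<Otimes>i\<in>{1..n}. f i [^] B i j K) = \<one>)"
proof -
  have eq: "Phi n f (mat_vec (Zp p) n B (coord n j \<one>\<^bsub>Zp p\<^esub>)) = (\<Otimes>i\<in>{1..n}. f i [^] B i j K)" if j: "j \<in> {1..n}" for j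
  proof -
    have mv: "mat_vec (Zp p) n B (coord n j \<one>\<^bsub>Zp p\<^esub>) = (\<lambda>i\<in>{1..n}. B i j)"
      by (rule mat_vec_coord[OF _ j]) (rule B)
    show ?thesis unfolding mv Phi_def using f by (intro finprod_cong') auto
  qed
  have hom: "Phi n f \<circ> mat_vec (Zp p) n B \<in> hom (free_mod (Zp p) n) G"
    by (rule Group.hom_compose[OF mat_vec_hom Phi_hom[OF f]]) (rule B)
  show ?thesis
  proof (intro iffI ballI)
    fix j assume "\<forall>v\<in>carrier (free_mod (Zp p) n). Phi n f (mat_vec (Zp p) n B v) = \<one>" "j \<in> {1..n}"
    then show "(\<Otimes>i\<in>{1..n}. f i [^] B i j K) = \<one>" using eq coord_one_closed by metis
  next
    fix v assume *: "\<forall>j\<in>{1..n}. (\<Otimes>i\<in>{1..n}. f i [^] B i j K) = \<one>" and v: "v \<in> carrier (free_mod (Zp p) n)"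
    have "(Phi n f \<circ> mat_vec (Zp p) n B) v = Phi n (\<lambda>j. (Phi n f \<circ> mat_vec (Zp p) n B) (coord n j \<one>\<^bsub>Zp p\<^esub>)) v"
      by (rule hom_free_mod[OF hom v])
    also have "\<dots> = Phi n (\<lambda>j. \<one>) v"
      unfolding Phi_def[of n _ v] by (intro finprod_cong') (use eq * in auto)
    also have "\<dots> = \<one>" by (simp add: Phi_def)
    finally show "Phi n f (mat_vec (Zp p) n B v) = \<one>" by simp
  qed
qed

text \<open>A surjection from the cokernel is determined by the images of the standard basis vectors.\<close>

lemma card_Sur_cok:
  assumes B: "\<And>i j. i \<in> {1..n} \<Longrightarrow> j \<in> {1..n} \<Longrightarrow> B i j \<in> carrier (Zp p)"
  shows "card (Sur (cok (Zp p) n B) G) = card {f \<in> {1..n} \<rightarrow>\<^sub>E carrier G. generate G (f ` {1..n}) = carrier G \<and>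
     (\<forall>j\<in>{1..n}. (\<Otimes>i\<in>{1..n}. f i [^] B i j K) = \<one>)}" (is "_ = card ?F")
proof -
  let ?V = "free_mod (Zp p) n" let ?N = "mat_vec (Zp p) n B ` carrier ?V"
  let ?C = "cok (Zp p) n B"
  interpret V: comm_group ?V by (rule comm_group_free_mod)
  interpret B: group_hom ?V ?V "mat_vec (Zp p) n B"
    by unfold_locales (rule mat_vec_hom, rule B)
  have iff: "(\<forall>v\<in>carrier ?V. Phi n f (mat_vec (Zp p) n B v) = \<one>) \<longleftrightarrow>
     (\<forall>j\<in>{1..n}. (\<Otimes>i\<in>{1..n}. f i [^] B i j K) = \<one>)" if "f \<in> {1..n} \<rightarrow> carrier G" for f
    by (rule Phi_mat_vec_eq_one_iff[OF _ that]) (rule B)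
  have Ns: "subgroup ?N ?V" by (rule B.img_is_subgroup)
  then have N: "?N \<lhd> ?V" by (rule V.subgroup_imp_normal)
  interpret N: normal ?N ?V by (rule N)
  have C: "?C = ?V Mod ?N" by (simp add: cok_def)
  have Cc: "carrier ?C = (\<lambda>v. ?N #>\<^bsub>?V\<^esub> v) ` carrier ?V" unfolding C by (rule carrier_FactGroup)
  let ?ev = "\<lambda>\<phi>. \<lambda>j\<in>{1..n}. \<phi> (?N #>\<^bsub>?V\<^esub> coord n j \<one>\<^bsub>Zp p\<^esub>)"
  have ev: "?ev \<phi> \<in> ?F \<and> (\<forall>v\<in>carrier ?V. \<phi> (?N #>\<^bsub>?V\<^esub> v) = Phi n (?ev \<phi>) v)" if \<phi>: "\<phi> \<in> Sur ?C G" for \<phi>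
  proof -
    have \<phi>h: "\<phi> \<in> hom ?C G" and \<phi>s: "\<phi> ` carrier ?C = carrier G" using \<phi> by (auto simp: Sur_def epi_def)
    have h: "\<phi> \<circ> (\<lambda>v. ?N #>\<^bsub>?V\<^esub> v) \<in> hom ?V G"
      using N.r_coset_hom_Mod \<phi>h unfolding C by (rule Group.hom_compose)
    have f: "?ev \<phi> \<in> {1..n} \<rightarrow>\<^sub>E carrier G"
      using coord_one_closed \<phi>s Cc by auto
    then have f': "?ev \<phi> \<in> {1..n} \<rightarrow> carrier G" by auto
    have ext: "\<phi> (?N #>\<^bsub>?V\<^esub> v) = Phi n (?ev \<phi>) v" if "v \<in> carrier ?V" for v
    proof -
      have "\<phi> (?N #>\<^bsub>?V\<^esub> v) = Phi n (\<lambda>j. (\<phi> \<circ> (\<lambda>v. ?N #>\<^bsub>?V\<^esub> v)) (coord n j \<one>\<^bsub>Zp p\<^esub>)) v"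
        using hom_free_mod[OF h that] by simp
      also have "\<dots> = Phi n (?ev \<phi>) v"
        unfolding Phi_def
      proof (intro finprod_cong' refl)
        show "(\<lambda>i. ?ev \<phi> i [^] v i K) \<in> {1..n} \<rightarrow> carrier G"
          using f' by (intro Pi_I int_pow_closed) (rule funcset_mem)
      qed auto
      finally show ?thesis .
    qed
    have "generate G (?ev \<phi> ` {1..n}) = Phi n (?ev \<phi>) ` carrier ?V" by (rule Phi_image[OF f', symmetric])
    also have "\<dots> = \<phi> ` carrier ?C" unfolding Cc image_image using ext by (intro image_cong) auto
    finally have gen: "generate G (?ev \<phi> ` {1..n}) = carrier G" using \<phi>s by simp
    have "Phi n (?ev \<phi>) (mat_vec (Zp p) n B v) = \<one>" if "v \<in> carrier ?V" for v
    proof -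
      have "mat_vec (Zp p) n B v \<in> ?N" using that by simp
      then have "?N #>\<^bsub>?V\<^esub> mat_vec (Zp p) n B v = ?N"
        using that Ns by (intro V.coset_join2) auto
      moreover have "\<phi> ?N = \<one>"
        using hom_one[OF \<phi>h] N.factorgroup_is_group is_group unfolding C by simp
      ultimately show ?thesis using ext[of "mat_vec (Zp p) n B v"] that by simp
    qed
    then have "\<forall>j\<in>{1..n}. (\<Otimes>i\<in>{1..n}. ?ev \<phi> i [^] B i j K) = \<one>"
      using iff[OF f'] by blast
    then show ?thesis using f gen ext by blast
  qed
  have "bij_betw ?ev (Sur ?C G) ?F"
  proof (rule bij_betw_imageI)
    show "inj_on ?ev (Sur ?C G)"
    proof (rule inj_onI)
      fix \<phi> \<phi>' assume a: "\<phi> \<in> Sur ?C G" "\<phi>' \<in> Sur ?C G" "?ev \<phi> = ?ev \<phi>'"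
      have "\<phi> (?N #>\<^bsub>?V\<^esub> v) = \<phi>' (?N #>\<^bsub>?V\<^esub> v)" if "v \<in> carrier ?V" for v
        using ev[OF a(1)] ev[OF a(2)] a(3) that by simp
      then have "\<phi> c = \<phi>' c" if "c \<in> carrier ?C" for c using that unfolding Cc by auto
      then show "\<phi> = \<phi>'" using a by (intro extensionalityI[of _ "carrier ?C"]) (auto simp: Sur_def)
    qed
    show "?ev ` Sur ?C G = ?F"
    proof (intro equalityI image_subsetI subsetI)
      show "?ev \<phi> \<in> ?F" if "\<phi> \<in> Sur ?C G" for \<phi> using ev[OF that] by blast
      fix f assume f: "f \<in> ?F"
      then have f': "f \<in> {1..n} \<rightarrow> carrier G" by auto
      interpret \<Phi>: group_hom ?V G "Phi n f" using Phi_hom[OF f'] by unfold_locales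
      have kill: "Phi n f u = \<one>" if "u \<in> ?N" for u
        using f that iff[OF f'] by auto
      \<comment> \<open>Constancy on the cosets of the image of \<open>B\<close>, which lets
        \<open>Phi n f\<close> descend to the cokernel.\<close>
      have "Phi n f v = Phi n f w" if v: "v \<in> carrier ?V" and w: "w \<in> carrier ?V" and e: "?N #>\<^bsub>?V\<^esub> v = ?N #>\<^bsub>?V\<^esub> w" for v w
      proof -
        have "v \<in> ?N #>\<^bsub>?V\<^esub> w" using V.rcos_self[OF v Ns] e by simp
        then obtain u where u: "u \<in> ?N" "v = u \<otimes>\<^bsub>?V\<^esub> w" unfolding r_coset_def by blast
        moreover have "u \<in> carrier ?V" using u(1) Ns by (meson subgroup.mem_carrier)
        ultimately show ?thesis using w kill[OF u(1)] by (simp add: \<Phi>.hom_mult f' Phi_closed)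
      qed
      then obtain \<phi> where \<phi>: "\<phi> \<in> hom (?V Mod ?N) G" "\<And>v. v \<in> carrier ?V \<Longrightarrow> \<phi> (?N #>\<^bsub>?V\<^esub> v) = Phi n f v"
        using FactGroup_universal[OF \<Phi>.homh N] by blast
      \<comment> \<open>The universal property fixes values on the carrier only, whereas
        \<open>Sur\<close> consists of extensional functions.\<close>
      define \<phi>' where "\<phi>' = restrict \<phi> (carrier ?C)"
      have \<phi>': "\<phi>' (?N #>\<^bsub>?V\<^esub> v) = Phi n f v" if "v \<in> carrier ?V" for v
        using that \<phi>(2) by (auto simp: \<phi>'_def Cc)
      have h': "\<phi>' \<in> hom ?C G"
      proof -
        interpret C: group ?C unfolding C by (rule N.factorgroup_is_group)
        have "\<phi> \<in> hom ?C G" using \<phi>(1) unfolding C .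
        then show ?thesis unfolding \<phi>'_def hom_def by (auto simp: Pi_iff C.m_closed)
      qed
      have "\<phi>' ` carrier ?C = Phi n f ` carrier ?V"
        unfolding Cc image_image using \<phi>' by (intro image_cong) auto
      also have "\<dots> = carrier G" using Phi_image[OF f'] f by simp
      finally have "\<phi>' \<in> Sur ?C G" using h' by (simp add: Sur_def epi_def \<phi>'_def)
      moreover have "?ev \<phi>' = f"
        using f \<phi>' coord_one_closed Phi_coord[OF f'] by (auto simp: fun_eq_iff PiE_iff extensional_def)
      ultimately show "f \<in> ?ev ` Sur ?C G" by blast
    qed
  qed
  then show ?thesis by (rule bij_betw_same_card)
qed

end

section \<open>Random relations\<close>

lemma Zp_borel_coordinate: "(\<lambda>x. x K) \<in> Zp_borel p \<rightarrow>\<^sub>M count_space UNIV"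
proof -
  have m: "(\<lambda>x. x K) \<in> borel \<rightarrow>\<^sub>M count_space (UNIV :: int set)"
  proof (rule measurableI)
    fix S :: "int set"
    have "open ((\<lambda>x. x K) -` S)"
      by (rule open_vimage[OF Topological_Spaces.open_discrete continuous_on_product_coordinates])
    then show "(\<lambda>x. x K) -` S \<inter> space borel \<in> sets borel" by simp
  qed auto
  show ?thesis unfolding Zp_borel_def by (rule measurable_restrict_space1[OF m])
qed

context prob_space begin

lemma indep_column:
  fixes Y :: "nat \<Rightarrow> nat \<Rightarrow> 'a \<Rightarrow> nat"
  assumes ind: "indep_vars (\<lambda>_. count_space UNIV) (\<lambda>(l, j). Y l j) (I \<times> J)" and j: "j \<in> J"
  shows "indep_vars (\<lambda>_. count_space UNIV) (\<lambda>l. Y l j) I"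
proof -
  have "indep_vars (\<lambda>l. PiM {(l, j)} (\<lambda>_. count_space UNIV)) (\<lambda>l w. \<lambda>i\<in>{(l, j)}. (case i of (l, j) \<Rightarrow> Y l j) w) I"
    using j by (intro indep_vars_restrict[OF ind]) (auto simp: disjoint_family_on_def)
  then have "indep_vars (\<lambda>_. count_space UNIV) (\<lambda>l w. (\<lambda>y. y (l, j)) (\<lambda>i\<in>{(l, j)}. (case i of (l, j) \<Rightarrow> Y l j) w)) I"
    by (rule indep_vars_compose2) (auto intro: measurable_component_singleton)
  then show ?thesis by simp
qed

text \<open>Distinct columns occupy disjoint blocks of the index set, so events that each depend on
  a single column are independent.\<close>

lemma prob_columns:
  fixes Y :: "nat \<Rightarrow> nat \<Rightarrow> 'a \<Rightarrow> nat"
  assumes ind: "indep_vars (\<lambda>_. count_space UNIV) (\<lambda>(l, j). Y l j) (I \<times> J)" 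
    and fin: "finite I" "finite J" and J: "J \<noteq> {}"
  shows "prob {w \<in> space M. \<forall>j\<in>J. Q j (\<lambda>l\<in>I. Y l j w)} = (\<Prod>j\<in>J. prob {w \<in> space M. Q j (\<lambda>l\<in>I. Y l j w)})"
proof -
  \<comment> \<open>A finite product of copies of the discrete naturals is discrete, so an arbitrary
    predicate \<open>Q j\<close> is measurable.\<close>
  have cs: "PiM (I \<times> {j}) (\<lambda>_. count_space (UNIV :: nat set)) = count_space (I \<times> {j} \<rightarrow>\<^sub>E UNIV)" for j :: nat
    using fin by (intro count_space_PiM_finite) auto
  have "indep_vars (\<lambda>j. PiM (I \<times> {j}) (\<lambda>_. count_space UNIV)) (\<lambda>j w. \<lambda>i\<in>I \<times> {j}. (case i of (l, j) \<Rightarrow> Y l j) w) J"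
    by (intro indep_vars_restrict[OF ind]) (auto simp: disjoint_family_on_def)
  then have "indep_vars (\<lambda>_. count_space UNIV) 
      (\<lambda>j w. (\<lambda>y. Q j (\<lambda>l\<in>I. y (l, j))) (\<lambda>i\<in>I \<times> {j}. (case i of (l, j) \<Rightarrow> Y l j) w)) J"
    by (rule indep_vars_compose2) (simp add: cs)
  then have "indep_vars (\<lambda>_. count_space UNIV) (\<lambda>j w. Q j (\<lambda>l\<in>I. Y l j w)) J"
    by (simp cong: restrict_cong)
  from indep_varsD_finite[OF this J fin(2), of "\<lambda>_. {True}"]
  have "prob (\<Inter>j\<in>J. (\<lambda>w. Q j (\<lambda>l\<in>I. Y l j w)) -` {True} \<inter> space M) =
     (\<Prod>j\<in>J. prob ((\<lambda>w. Q j (\<lambda>l\<in>I. Y l j w)) -` {True} \<inter> space M))" by simp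
  also have "(\<Inter>j\<in>J. (\<lambda>w. Q j (\<lambda>l\<in>I. Y l j w)) -` {True} \<inter> space M) = {w \<in> space M. \<forall>j\<in>J. Q j (\<lambda>l\<in>I. Y l j w)}"
    using J by auto
  also have "(\<lambda>j. (\<lambda>w. Q j (\<lambda>l\<in>I. Y l j w)) -` {True} \<inter> space M) = (\<lambda>j. {w \<in> space M. Q j (\<lambda>l\<in>I. Y l j w)})"
    by auto
  finally show ?thesis .
qed

end

lemma sets_finite_family:
  fixes Y :: "'i \<Rightarrow> 'a \<Rightarrow> nat"
  assumes "finite I" and Y: "\<And>i. i \<in> I \<Longrightarrow> Y i \<in> M \<rightarrow>\<^sub>M count_space UNIV"
  shows "{w \<in> space M. Q (\<lambda>i\<in>I. Y i w)} \<in> sets M"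
proof -
  have "PiM I (\<lambda>_. count_space (UNIV :: nat set)) = count_space (I \<rightarrow>\<^sub>E UNIV)"
    using assms(1) by (intro count_space_PiM_finite) auto
  moreover have "(\<lambda>w. \<lambda>i\<in>I. Y i w) \<in> M \<rightarrow>\<^sub>M PiM I (\<lambda>_. count_space (UNIV :: nat set))"
    using Y by (intro measurable_restrict) auto
  ultimately have "(\<lambda>w. \<lambda>i\<in>I. Y i w) \<in> M \<rightarrow>\<^sub>M count_space (I \<rightarrow>\<^sub>E UNIV)" by simp
  then have "(\<lambda>w. Q (\<lambda>i\<in>I. Y i w)) \<in> M \<rightarrow>\<^sub>M count_space UNIV"
    by (rule measurable_compose[where g = Q]) simp
  then show ?thesis by (rule measurable_sets_Collect) auto
qed

text \<open>Residues of p-adic integers are nonnegative, so \<open>nat\<close> loses nothing, and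
  natural powers in the group can be used.\<close>

definition entry :: "nat \<Rightarrow> ('w \<Rightarrow> nat \<Rightarrow> nat \<Rightarrow> nat \<Rightarrow> int) \<Rightarrow> nat \<Rightarrow> nat \<Rightarrow> 'w \<Rightarrow> nat" where
  "entry K A l j w = nat (A w l j K)"

lemma balanced_matrix_entries:
  assumes M: "prob_space M" and p: "p > 0" and K: "K \<ge> 1" and A: "balanced_matrix p \<epsilon> n M A"
  shows "prob_space.indep_vars M (\<lambda>_. count_space UNIV) (\<lambda>(l, j). entry K A l j) ({1..n} \<times> {1..n})"
    and "\<And>l j w. l \<in> {1..n} \<Longrightarrow> j \<in> {1..n} \<Longrightarrow> w \<in> space M \<Longrightarrow> A w l j \<in> carrier (Zp p)"
    and "\<And>l j w. l \<in> {1..n} \<Longrightarrow> j \<in> {1..n} \<Longrightarrow> w \<in> space M \<Longrightarrow> entry K A l j w < p ^ K"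
    and "\<And>l j r. l \<in> {1..n} \<Longrightarrow> j \<in> {1..n} \<Longrightarrow> measure M {w \<in> space M. [entry K A l j w = r] (mod p)} \<le> 1 - \<epsilon>"
proof -
  interpret prob_space M by (rule M)
  have ind: "indep_vars (\<lambda>_. Zp_borel p) (\<lambda>(i, j) w. A w i j) ({1..n} \<times> {1..n})"
    and bal: "\<And>i j. i \<in> {1..n} \<Longrightarrow> j \<in> {1..n} \<Longrightarrow> balanced p \<epsilon> M (\<lambda>w. A w i j)"
    using A by (auto simp: balanced_matrix_def)
  have "(\<lambda>x. nat (x K)) \<in> Zp_borel p \<rightarrow>\<^sub>M count_space UNIV"
    by (rule measurable_compose[OF Zp_borel_coordinate]) simp
  then have "indep_vars (\<lambda>_. count_space UNIV) (\<lambda>i w. (\<lambda>x. nat (x K)) ((case i of (i, j) \<Rightarrow> \<lambda>w. A w i j) w)) ({1..n} \<times> {1..n})"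
    by (intro indep_vars_compose2[OF ind])
  also have "(\<lambda>i w. (\<lambda>x. nat (x K)) ((case i of (i, j) \<Rightarrow> \<lambda>w. A w i j) w)) = (\<lambda>(l, j). entry K A l j)"
    by (auto simp: fun_eq_iff entry_def)
  finally show "indep_vars (\<lambda>_. count_space UNIV) (\<lambda>(l, j). entry K A l j) ({1..n} \<times> {1..n})" .
  have sp: "space (Zp_borel p) = carrier (Zp p)" by (simp add: Zp_borel_def space_restrict_space)
  show c: "A w l j \<in> carrier (Zp p)" if "l \<in> {1..n}" "j \<in> {1..n}" "w \<in> space M" for l j w
    using bal[OF that(1,2)] that(3) measurable_space[of "\<lambda>w. A w l j" M "Zp_borel p" w]
    by (simp add: balanced_def sp)
  have e: "int (entry K A l j w) = A w l j K" if "l \<in> {1..n}" "j \<in> {1..n}" "w \<in> space M" for l j w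
  proof -
    have "0 \<le> A w l j K" using c[OF that] unfolding Zp_carrier_iff by blast
    then show ?thesis by (simp add: entry_def)
  qed
  show "entry K A l j w < p ^ K" if "l \<in> {1..n}" "j \<in> {1..n}" "w \<in> space M" for l j w
  proof -
    have "A w l j K < int p ^ K" using c[OF that] unfolding Zp_carrier_iff by blast
    then have "int (entry K A l j w) < int (p ^ K)" using e[OF that] by simp
    then show ?thesis by (simp only: of_nat_less_iff)
  qed
  show "prob {w \<in> space M. [entry K A l j w = r] (mod p)} \<le> 1 - \<epsilon>" if lj: "l \<in> {1..n}" "j \<in> {1..n}" for l j r
  proof -
    have "[entry K A l j w = r] (mod p) \<longleftrightarrow> [A w l j 1 = int r] (mod int p)" if w: "w \<in> space M" for w
    proof -
      \<comment> \<open>Here \<open>K \<ge> 1\<close> matters: the residue modulo p^K determines the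
        one modulo p, on which the balance condition is imposed.\<close>
      have "A w l j K mod int p ^ 1 = A w l j 1" using Zp_mod_le[OF c[OF lj w]] K by blast
      then have "[A w l j K = A w l j 1] (mod int p)" by (simp add: cong_def) (metis mod_mod_trivial)
      then show ?thesis by (metis e[OF lj w] cong_int_iff cong_sym cong_trans)
    qed
    then have "{w \<in> space M. [entry K A l j w = r] (mod p)} = {w \<in> space M. [A w l j 1 = int r] (mod int p)}" by blast
    then show ?thesis using bal[OF lj] by (simp add: balanced_def)
  qed
qed

context Zp_target begin

text \<open>The scalar shift touches column \<open>j\<close> only in its diagonal entry, so it
  contributes a single factor built from \<open>f j\<close>.\<close>

lemma finprod_add_scalar:
  assumes A: "\<And>i j. i \<in> {1..n} \<Longrightarrow> j \<in> {1..n} \<Longrightarrow> A i j \<in> carrier (Zp p)" and x: "x \<in> carrier (Zp p)"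
    and f: "f \<in> {1..n} \<rightarrow> carrier G" and j: "j \<in> {1..n}"
  shows "(\<Otimes>i\<in>{1..n}. f i [^] add_scalar (Zp p) A ([p] \<cdot>\<^bsub>Zp p\<^esub> x) i j K) =
     (\<Otimes>i\<in>{1..n}. f i [^] nat (A i j K)) \<otimes> (f j [^] x K) [^] p"
proof -
  have fi: "f i \<in> carrier G" if "i \<in> {1..n}" for i using f that by auto
  have "(\<Otimes>i\<in>{1..n}. f i [^] add_scalar (Zp p) A ([p] \<cdot>\<^bsub>Zp p\<^esub> x) i j K) = 
     (\<Otimes>i\<in>{1..n}. f i [^] nat (A i j K) \<otimes> (if j = i then (f i [^] x K) [^] p else \<one>))"
  proof (intro finprod_cong' refl)
    show "(\<lambda>i. f i [^] nat (A i j K) \<otimes> (if j = i then (f i [^] x K) [^] p else \<one>)) \<in> {1..n} \<rightarrow> carrier G"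
      using fi by auto
    fix i assume i: "i \<in> {1..n}"
    let ?c = "if i = j then int p * x K else 0"
    have "0 \<le> A i j K" using A[OF i j] unfolding Zp_carrier_iff by blast
    then have nat: "f i [^] A i j K = f i [^] nat (A i j K)" by (metis int_pow_int int_nat_eq)
    have "add_scalar (Zp p) A ([p] \<cdot>\<^bsub>Zp p\<^esub> x) i j K = (A i j K + ?c) mod int p ^ K"
      by (simp add: add_scalar_def Zp_simps Zp_add_pow[OF p x] mod_add_right_eq)
    then have "f i [^] add_scalar (Zp p) A ([p] \<cdot>\<^bsub>Zp p\<^esub> x) i j K = f i [^] (A i j K + ?c)"
      using int_pow_residue[OF fi[OF i]] by simp
    also have "\<dots> = f i [^] A i j K \<otimes> f i [^] ?c" using fi[OF i] by (rule int_pow_mult)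
    also have "f i [^] ?c = (if j = i then (f i [^] x K) [^] p else \<one>)"
    proof (cases "i = j")
      case True
      have "f i [^] (int p * x K) = (f i [^] x K) [^] int p"
        using fi[OF i] by (simp add: int_pow_pow mult.commute)
      then show ?thesis using True by (simp add: int_pow_int)
    qed simp
    finally show "f i [^] add_scalar (Zp p) A ([p] \<cdot>\<^bsub>Zp p\<^esub> x) i j K =
       f i [^] nat (A i j K) \<otimes> (if j = i then (f i [^] x K) [^] p else \<one>)" by (simp only: nat)
  qed
  also have "\<dots> = (\<Otimes>i\<in>{1..n}. f i [^] nat (A i j K)) \<otimes> (\<Otimes>i\<in>{1..n}. if j = i then (f i [^] x K) [^] p else \<one>)"
    using fi by (intro finprod_multf) auto
  also have "(\<Otimes>i\<in>{1..n}. if j = i then (f i [^] x K) [^] p else \<one>) = (f j [^] x K) [^] p"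
    using fi j by (intro finprod_singleton) auto
  finally show ?thesis .
qed

text \<open>Moving the deterministic shift to the right-hand side leaves, in each column, a random
  product that has to hit a fixed target.\<close>

lemma card_Sur_cok_add_scalar:
  assumes A: "\<And>i j. i \<in> {1..n} \<Longrightarrow> j \<in> {1..n} \<Longrightarrow> A i j \<in> carrier (Zp p)" and x: "x \<in> carrier (Zp p)"
  shows "card (Sur (cok (Zp p) n (add_scalar (Zp p) A ([p] \<cdot>\<^bsub>Zp p\<^esub> x))) G) =
    card {f \<in> {1..n} \<rightarrow>\<^sub>E carrier G. generate G (f ` {1..n}) = carrier G \<and>
     (\<forall>j\<in>{1..n}. (\<Otimes>i\<in>{1..n}. f i [^] nat (A i j K)) = inv ((f j [^] x K) [^] p))}"
proof -
  have "add_scalar (Zp p) A ([p] \<cdot>\<^bsub>Zp p\<^esub> x) i j \<in> carrier (Zp p)" if "i \<in> {1..n}" "j \<in> {1..n}" for i j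
    using A[OF that] x by (simp add: add_scalar_def R.add.nat_pow_closed)
  then have "card (Sur (cok (Zp p) n (add_scalar (Zp p) A ([p] \<cdot>\<^bsub>Zp p\<^esub> x))) G) = 
    card {f \<in> {1..n} \<rightarrow>\<^sub>E carrier G. generate G (f ` {1..n}) = carrier G \<and>
     (\<forall>j\<in>{1..n}. (\<Otimes>i\<in>{1..n}. f i [^] add_scalar (Zp p) A ([p] \<cdot>\<^bsub>Zp p\<^esub> x) i j K) = \<one>)}"
    by (rule card_Sur_cok)
  also have "\<dots> = card {f \<in> {1..n} \<rightarrow>\<^sub>E carrier G. generate G (f ` {1..n}) = carrier G \<and>
     (\<forall>j\<in>{1..n}. (\<Otimes>i\<in>{1..n}. f i [^] nat (A i j K)) = inv ((f j [^] x K) [^] p))}"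
  proof (intro arg_cong[where f = card] Collect_cong conj_cong ball_cong refl)
    fix f j assume f: "f \<in> {1..n} \<rightarrow>\<^sub>E carrier G" and j: "j \<in> {1..n}"
    have f': "f \<in> {1..n} \<rightarrow> carrier G" using f by auto
    have fi: "f i \<in> carrier G" if "i \<in> {1..n}" for i using f that by auto
    have c: "(\<Otimes>i\<in>{1..n}. f i [^] nat (A i j K)) \<in> carrier G" "(f j [^] x K) [^] p \<in> carrier G"
      using fi j by (auto intro!: finprod_closed simp: Pi_iff)
    have "u \<otimes> v = \<one> \<longleftrightarrow> u = inv v" if "u \<in> carrier G" "v \<in> carrier G" for u v
      using that inv_equality[of u v] by auto
    then show "((\<Otimes>i\<in>{1..n}. f i [^] add_scalar (Zp p) A ([p] \<cdot>\<^bsub>Zp p\<^esub> x) i j K) = \<one>) = 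
      ((\<Otimes>i\<in>{1..n}. f i [^] nat (A i j K)) = inv ((f j [^] x K) [^] p))"
      using c finprod_add_scalar[of n A x f j, OF A x f' j] by simp
  qed
  finally show ?thesis .
qed

end

section \<open>Random relations in one group\<close>

lemma (in comm_group) comm_group_subgroup:
  assumes "subgroup H G"
  shows "comm_group (G\<lparr>carrier := H\<rparr>)"
proof (rule group.group_comm_groupI)
  show "group (G\<lparr>carrier := H\<rparr>)" using assms by (rule subgroup.subgroup_is_group[OF _ is_group])
  fix x y assume "x \<in> carrier (G\<lparr>carrier := H\<rparr>)" "y \<in> carrier (G\<lparr>carrier := H\<rparr>)"
  then have "x \<in> carrier G" "y \<in> carrier G" using subgroup.subset[OF assms] by auto
  then show "x \<otimes>\<^bsub>G\<lparr>carrier := H\<rparr>\<^esub> y = y \<otimes>\<^bsub>G\<lparr>carrier := H\<rparr>\<^esub> x" by (simp add: m_comm)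
qed

lemma (in comm_group) finprod_subgroup:
  assumes H: "subgroup H G" and "finite I" "g \<in> I \<rightarrow> H"
  shows "finprod (G\<lparr>carrier := H\<rparr>) g I = finprod G g I"
  using assms(2,3)
proof (induction I rule: finite_induct)
  case empty
  interpret H: comm_group "G\<lparr>carrier := H\<rparr>" using H by (rule comm_group_subgroup)
  show ?case by simp
next
  case (insert i I)
  interpret H: comm_group "G\<lparr>carrier := H\<rparr>" using H by (rule comm_group_subgroup)
  have "g \<in> insert i I \<rightarrow> carrier G" using insert.prems subgroup.subset[OF H] by auto
  then show ?case using insert by (simp add: H.finprod_insert)
qed

lemma (in finite_comm_group) finite_comm_group_subgroup:
  assumes "subgroup H G"
  shows "finite_comm_group (G\<lparr>carrier := H\<rparr>)"
proof -
  interpret H: comm_group "G\<lparr>carrier := H\<rparr>" using assms by (rule comm_group_subgroup)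
  show ?thesis using finite_subset[OF subgroup.subset[OF assms] fin] by unfold_locales simp
qed

text \<open>The targets \<open>h\<close> are arbitrary: this is what absorbs the shifts of the random matrices.\<close>

theorem (in finite_comm_group) random_relations_tendsto:
  fixes \<epsilon> :: "nat \<Rightarrow> real" and M :: "nat \<Rightarrow> 'w measure" and Y :: "nat \<Rightarrow> nat \<Rightarrow> nat \<Rightarrow> 'w \<Rightarrow> nat"
  assumes p: "prime p" and exponent: "\<And>g. g \<in> carrier G \<Longrightarrow> g [^] (p ^ K) = \<one>"
    and \<epsilon>: "\<And>\<Delta>::real. \<Delta> > 0 \<Longrightarrow> \<forall>\<^sub>F n in sequentially. \<epsilon> n \<ge> \<Delta> * ln (real n) / real n"
    and \<epsilon>0: "\<And>n. n \<ge> 1 \<Longrightarrow> 0 < \<epsilon> n"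
    and M: "\<And>n. n \<ge> 1 \<Longrightarrow> prob_space (M n)"
    and ind: "\<And>n. n \<ge> 1 \<Longrightarrow> prob_space.indep_vars (M n) (\<lambda>_. count_space UNIV) (\<lambda>(l, j). Y n l j) ({1..n} \<times> {1..n})"
    and Y: "\<And>n l j w. n \<ge> 1 \<Longrightarrow> l \<in> {1..n} \<Longrightarrow> j \<in> {1..n} \<Longrightarrow> w \<in> space (M n) \<Longrightarrow> Y n l j w < p ^ K"
    and bal: "\<And>n l j r. n \<ge> 1 \<Longrightarrow> l \<in> {1..n} \<Longrightarrow> j \<in> {1..n} \<Longrightarrow>
        measure (M n) {w \<in> space (M n). [Y n l j w = r] (mod p)} \<le> 1 - \<epsilon> n"
    and h: "\<And>n f j. n \<ge> 1 \<Longrightarrow> f \<in> gens n \<Longrightarrow> j \<in> {1..n} \<Longrightarrow> h n f j \<in> carrier G"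
  shows "(\<lambda>n. \<Sum>f\<in>gens n. measure (M n) {w \<in> space (M n). \<forall>j\<in>{1..n}. (\<Otimes>l\<in>{1..n}. f l [^] Y n l j w) = h n f j})
     \<longlonglongrightarrow> 1"
proof -
  have "p ^ K > 0" using p by (simp add: prime_gt_0_nat)
  then obtain c0 where c0: "c0 > 0" "\<And>w::complex. w ^ (p ^ K) = 1 \<Longrightarrow> w \<noteq> 1 \<Longrightarrow> c0 \<le> 1 - Re w"
    using root_of_unity_gap by blast
  \<comment> \<open>\<open>gens_sum_tendsto\<close> asks for the column estimate for all tuples, but
    \<open>h\<close> is known to lie in the group only for generating ones; elsewhere the target is
    replaced by \<one>.\<close>
  define h' where "h' n f j = (if h n f j \<in> carrier G then h n f j else \<one>)" for n f j
  define P where "P n f j = measure (M n) {w \<in> space (M n). (\<Otimes>l\<in>{1..n}. f l [^] Y n l j w) = h' n f j}" for n f j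
  have lim: "(\<lambda>n. \<Sum>f\<in>gens n. \<Prod>j\<in>{1..n}. P n f j) \<longlonglongrightarrow> 1"
  proof (rule gens_sum_tendsto[OF \<epsilon> \<epsilon>0])
    show "c0 / 2 > 0" using c0 by simp
    fix n f j assume n: "(n::nat) \<ge> 1" and f: "f \<in> maps n" and j: "j \<in> {1..n}"
    show "\<bar>order G * P n f j - 1\<bar> \<le> (\<Sum>\<psi>\<in>chars G - {triv_char}. exp (- (c0 / 2 * \<epsilon> n) * wt n f \<psi>))"
      unfolding P_def
    proof (rule column_prob_bound[OF M[OF n] p exponent _ c0(2) _ _ _ f])
      show "prob_space.indep_vars (M n) (\<lambda>_. count_space UNIV) (\<lambda>l. Y n l j) {1..n}"
        by (rule prob_space.indep_column[OF M[OF n] ind[OF n] j])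
      show "h' n f j \<in> carrier G" by (simp add: h'_def)
    qed (use c0 Y[OF n _ j] bal[OF n _ j] in auto)
  qed (auto simp: P_def)
  have "(\<Sum>f\<in>gens n. measure (M n) {w \<in> space (M n). \<forall>j\<in>{1..n}. (\<Otimes>l\<in>{1..n}. f l [^] Y n l j w) = h n f j})
      = (\<Sum>f\<in>gens n. \<Prod>j\<in>{1..n}. P n f j)" if n: "n \<ge> 1" for n
  proof (intro sum.cong refl)
    fix f assume f: "f \<in> gens n"
    then have fm: "f \<in> maps n" by (simp add: gens_def)
    have e: "(\<Otimes>l\<in>{1..n}. f l [^] Y n l j w) = (\<Otimes>l\<in>{1..n}. f l [^] (\<lambda>l\<in>{1..n}. Y n l j w) l)" for j w
      by (intro finprod_cong') (use maps_mem[OF fm] in auto)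
    have "measure (M n) {w \<in> space (M n). \<forall>j\<in>{1..n}. (\<Otimes>l\<in>{1..n}. f l [^] Y n l j w) = h n f j} =
      measure (M n) {w \<in> space (M n). \<forall>j\<in>{1..n}. (\<Otimes>l\<in>{1..n}. f l [^] (\<lambda>l\<in>{1..n}. Y n l j w) l) = h n f j}"
      by (simp only: e)
    also have "\<dots> = (\<Prod>j\<in>{1..n}. measure (M n) {w \<in> space (M n). (\<Otimes>l\<in>{1..n}. f l [^] (\<lambda>l\<in>{1..n}. Y n l j w) l) = h n f j})"
      using n by (intro prob_space.prob_columns[OF M[OF n] ind[OF n], where Q = "\<lambda>j y. (\<Otimes>l\<in>{1..n}. f l [^] y l) = h n f j"]) auto
    also have "\<dots> = (\<Prod>j\<in>{1..n}. P n f j)"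
      unfolding P_def e[symmetric] using h[OF n f] by (intro prod.cong refl) (simp add: h'_def)
    finally show "measure (M n) {w \<in> space (M n). \<forall>j\<in>{1..n}. (\<Otimes>l\<in>{1..n}. f l [^] Y n l j w) = h n f j} = (\<Prod>j\<in>{1..n}. P n f j)" .
  qed
  then have "\<forall>\<^sub>F n in sequentially. (\<Sum>f\<in>gens n. \<Prod>j\<in>{1..n}. P n f j) = (\<Sum>f\<in>gens n. measure (M n) {w \<in> space (M n). \<forall>j\<in>{1..n}. (\<Otimes>l\<in>{1..n}. f l [^] Y n l j w) = h n f j})"
    by (intro eventually_mono[OF eventually_ge_at_top[of 1]]) (rule sym)
  then show ?thesis by (rule Lim_transform_eventually[OF lim])
qed

section \<open>Several cokernels\<close>

lemma product_group_proj_hom: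
  assumes "i \<in> I"
  shows "(\<lambda>g. g i) \<in> hom (product_group I G) (G i)"
  using assms by (auto intro!: homI)

lemma hom_comm_group_finprod:
  assumes A: "comm_group A" and B: "comm_group B" and h: "h \<in> hom A B" and S: "finite S" "g \<in> S \<rightarrow> carrier A"
  shows "h (finprod A g S) = finprod B (\<lambda>i. h (g i)) S"
proof -
  interpret A: comm_group A by (rule A)
  interpret B: comm_group B by (rule B)
  interpret group_hom A B h using h by unfold_locales
  show ?thesis using S
  proof (induction S rule: finite_induct)
    case (insert i S)
    then have "g j \<in> carrier A" if "j \<in> insert i S" for j using that by (auto simp: Pi_iff)
    then have "h (g i) \<in> carrier B" "(\<lambda>i. h (g i)) \<in> S \<rightarrow> carrier B" by auto
    then show ?case using insert by simp
  qed simp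
qed

text \<open>A common \<open>K\<close> lets the relations for all the \<open>G i\<close> be read from
  the same residues modulo p^K.\<close>

locale p_group_family =
  fixes p m K :: nat and G :: "nat \<Rightarrow> ('g, 'b) monoid_scheme" and x :: "nat \<Rightarrow> nat \<Rightarrow> int"
  assumes p: "prime p" and x: "\<And>i. i \<in> {1..m} \<Longrightarrow> x i \<in> carrier (Zp p)"
    and G: "\<And>i. i \<in> {1..m} \<Longrightarrow> finite_abelian_p_group p (G i)"
    and K: "\<And>i g. i \<in> {1..m} \<Longrightarrow> g \<in> carrier (G i) \<Longrightarrow> g [^]\<^bsub>G i\<^esub> (p ^ K) = \<one>\<^bsub>G i\<^esub>"
begin

abbreviation P :: "(nat \<Rightarrow> 'g) monoid" where "P \<equiv> product_group {1..m} G"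

text \<open>The endomorphism p T_x in multiplicative notation.\<close>

definition \<tau> :: "(nat \<Rightarrow> 'g) \<Rightarrow> nat \<Rightarrow> 'g" where
  "\<tau> g = T_map p m G x g [^]\<^bsub>P\<^esub> p"

lemma G_comm: "i \<in> {1..m} \<Longrightarrow> comm_group (G i)"
  using G by (simp add: finite_abelian_p_group_def)

lemma G_finite: "i \<in> {1..m} \<Longrightarrow> finite (carrier (G i))"
proof -
  assume i: "i \<in> {1..m}"
  then obtain k where k: "order (G i) = p ^ k" using G by (auto simp: finite_abelian_p_group_def)
  have "order (G i) > 0" unfolding k using p by (simp add: prime_gt_0_nat)
  then show ?thesis by (simp add: order_def card_gt_0_iff)
qed

lemma finite_comm_group_P: "finite_comm_group P"
proof -
  interpret comm_group P by (rule comm_group_product_group) (rule G_comm)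
  show ?thesis using G_finite by unfold_locales (auto intro!: finite_PiE)
qed

sublocale P: finite_comm_group P by (rule finite_comm_group_P)

lemma carrier_P_eqI:
  assumes "a \<in> carrier P" "b \<in> carrier P" "\<And>i. i \<in> {1..m} \<Longrightarrow> a i = b i"
  shows "a = b"
proof (rule PiE_ext)
  show "a \<in> (\<Pi>\<^sub>E i\<in>{1..m}. carrier (G i))" "b \<in> (\<Pi>\<^sub>E i\<in>{1..m}. carrier (G i))"
    using assms(1,2) by (simp_all only: carrier_product_group)
qed (rule assms(3))

lemma proj_hom:
  assumes "i \<in> {1..m}"
  shows "group_hom P (G i) (\<lambda>g. g i)"
  by (rule group_hom.intro[OF P.is_group comm_group.axioms(2)[OF G_comm[OF assms]]
        group_hom_axioms.intro[OF product_group_proj_hom[OF assms]]])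

lemma pow_P_coord: "g \<in> carrier P \<Longrightarrow> i \<in> {1..m} \<Longrightarrow> (g [^]\<^bsub>P\<^esub> (k::nat)) i = g i [^]\<^bsub>G i\<^esub> k"
  using group_hom.hom_nat_pow[OF proj_hom, of i g k] by simp

lemma P_exponent: "g \<in> carrier P \<Longrightarrow> g [^]\<^bsub>P\<^esub> (p ^ K) = \<one>\<^bsub>P\<^esub>"
proof (rule carrier_P_eqI)
  fix i assume g: "g \<in> carrier P" and i: "i \<in> {1..m}"
  then have "g i \<in> carrier (G i)" by auto
  then show "(g [^]\<^bsub>P\<^esub> (p ^ K)) i = \<one>\<^bsub>P\<^esub> i" using pow_P_coord[OF g i] K[OF i] i by simp
next
  show "g [^]\<^bsub>P\<^esub> (p ^ K) \<in> carrier P" if "g \<in> carrier P" using that by (rule P.nat_pow_closed)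
  show "\<one>\<^bsub>P\<^esub> \<in> carrier P" by (rule P.one_closed)
qed

text \<open>\<open>Zp_act\<close> uses the order of each single \<open>G i\<close> as modulus; by
  \<open>Zp_act_eq\<close> the common p^K gives the same action.\<close>

lemma T_map_eq:
  assumes "g \<in> carrier P"
  shows "T_map p m G x g = (\<lambda>i\<in>{1..m}. g i [^]\<^bsub>G i\<^esub> x i K)"
  unfolding T_map_def
proof (rule restrict_ext)
  fix i assume i: "i \<in> {1..m}"
  then have gi: "g i \<in> carrier (G i)" using assms by auto
  show "Zp_act p (G i) (x i) (g i) = g i [^]\<^bsub>G i\<^esub> x i K"
    by (rule Zp_act_eq[OF p G[OF i] x[OF i] gi K[OF i gi]])
qed

lemma T_map_closed: "g \<in> carrier P \<Longrightarrow> T_map p m G x g \<in> carrier P"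
proof -
  assume g: "g \<in> carrier P"
  have "g i [^]\<^bsub>G i\<^esub> x i K \<in> carrier (G i)" if i: "i \<in> {1..m}" for i
  proof -
    interpret comm_group "G i" using i by (rule G_comm)
    have "g i \<in> carrier (G i)" using g i by auto
    then show ?thesis by (rule int_pow_closed)
  qed
  then show ?thesis unfolding T_map_eq[OF g] by auto
qed

lemma \<tau>_coord:
  assumes "g \<in> carrier P" "i \<in> {1..m}"
  shows "\<tau> g i = (g i [^]\<^bsub>G i\<^esub> x i K) [^]\<^bsub>G i\<^esub> p"
  unfolding \<tau>_def using pow_P_coord[OF T_map_closed[OF assms(1)] assms(2)] assms(2)
  by (simp add: T_map_eq[OF assms(1)])

lemma \<tau>_closed: "g \<in> carrier P \<Longrightarrow> \<tau> g \<in> carrier P"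
  unfolding \<tau>_def by (intro P.nat_pow_closed T_map_closed)

lemma \<tau>_hom: "\<tau> \<in> hom P P"
proof (rule homI[OF \<tau>_closed])
  fix g h assume g: "g \<in> carrier P" and h: "h \<in> carrier P"
  show "\<tau> (g \<otimes>\<^bsub>P\<^esub> h) = \<tau> g \<otimes>\<^bsub>P\<^esub> \<tau> h"
  proof (rule carrier_P_eqI)
    fix i assume i: "i \<in> {1..m}"
    interpret comm_group "G i" using i by (rule G_comm)
    have c: "g i \<in> carrier (G i)" "h i \<in> carrier (G i)" using g h i by auto
    have gh: "g \<otimes>\<^bsub>P\<^esub> h \<in> carrier P" using g h by (rule P.m_closed)
    have "\<tau> (g \<otimes>\<^bsub>P\<^esub> h) i = ((g i \<otimes>\<^bsub>G i\<^esub> h i) [^]\<^bsub>G i\<^esub> x i K) [^]\<^bsub>G i\<^esub> p"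
      using \<tau>_coord[OF gh i] i by simp
    also have "\<dots> = (g i [^]\<^bsub>G i\<^esub> x i K) [^]\<^bsub>G i\<^esub> p \<otimes>\<^bsub>G i\<^esub> (h i [^]\<^bsub>G i\<^esub> x i K) [^]\<^bsub>G i\<^esub> p"
      using c by (simp add: int_pow_distrib nat_pow_distrib)
    also have "\<dots> = (\<tau> g \<otimes>\<^bsub>P\<^esub> \<tau> h) i" using \<tau>_coord[OF g i] \<tau>_coord[OF h i] i by simp
    finally show "\<tau> (g \<otimes>\<^bsub>P\<^esub> h) i = (\<tau> g \<otimes>\<^bsub>P\<^esub> \<tau> h) i" .
  next
    show "\<tau> (g \<otimes>\<^bsub>P\<^esub> h) \<in> carrier P" by (intro \<tau>_closed P.m_closed g h)
    show "\<tau> g \<otimes>\<^bsub>P\<^esub> \<tau> h \<in> carrier P" by (intro \<tau>_closed P.m_closed g h)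
  qed
qed

text \<open>\<open>F l i\<close> is the image in \<open>G i\<close> of the \<open>l\<close>-th standard basis vector.\<close>

definition tuples :: "nat \<Rightarrow> (nat \<Rightarrow> nat \<Rightarrow> 'g) set" where
  "tuples n = {F \<in> {1..n} \<rightarrow>\<^sub>E carrier P. \<forall>i\<in>{1..m}. generate (G i) ((\<lambda>l. F l i) ` {1..n}) = carrier (G i)}"

text \<open>All cokernels come from the same random entries and differ only in their shifts. Hence
  the systems over the single \<open>G i\<close>, having the exponents \<open>k l\<close> in common,
  merge into one system over \<open>P\<close>, with the shifts collected in \<tau>.\<close>

lemma relation_coord:
  fixes n :: nat
  assumes F: "F \<in> {1..n} \<rightarrow>\<^sub>E carrier P" and j: "j \<in> {1..n}"
  shows "(\<Otimes>\<^bsub>P\<^esub>l\<in>{1..n}. F l [^]\<^bsub>P\<^esub> (k l :: nat)) = inv\<^bsub>P\<^esub> (\<tau> (F j)) \<longleftrightarrow>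
    (\<forall>i\<in>{1..m}. (\<Otimes>\<^bsub>G i\<^esub>l\<in>{1..n}. F l i [^]\<^bsub>G i\<^esub> k l) = inv\<^bsub>G i\<^esub> ((F j i [^]\<^bsub>G i\<^esub> x i K) [^]\<^bsub>G i\<^esub> p))"
    (is "?L = ?R \<longleftrightarrow> _")
proof -
  have Fl: "F l \<in> carrier P" if "l \<in> {1..n}" for l using F that by (rule PiE_mem)
  have powc: "(\<lambda>l. F l [^]\<^bsub>P\<^esub> k l) \<in> {1..n} \<rightarrow> carrier P"
    by (rule Pi_I) (rule P.nat_pow_closed[OF Fl])
  then have L: "?L \<in> carrier P" by (rule P.finprod_closed)
  have R: "?R \<in> carrier P" by (intro P.inv_closed \<tau>_closed Fl j)
  have Li: "?L i = (\<Otimes>\<^bsub>G i\<^esub>l\<in>{1..n}. F l i [^]\<^bsub>G i\<^esub> k l)" if i: "i \<in> {1..m}" for i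
  proof -
    interpret comm_group "G i" using i by (rule G_comm)
    have "?L i = (\<Otimes>\<^bsub>G i\<^esub>l\<in>{1..n}. (F l [^]\<^bsub>P\<^esub> k l) i)"
    proof (rule hom_comm_group_finprod[where h = "\<lambda>g. g i" and A = P and B = "G i"])
      show "comm_group P" by (rule P.comm_group_axioms)
      show "comm_group (G i)" by (rule G_comm[OF i])
      show "(\<lambda>g. g i) \<in> hom P (G i)" by (rule product_group_proj_hom[OF i])
      show "(\<lambda>l. F l [^]\<^bsub>P\<^esub> k l) \<in> {1..n} \<rightarrow> carrier P" by (rule powc)
    qed simp
    also have "\<dots> = (\<Otimes>\<^bsub>G i\<^esub>l\<in>{1..n}. F l i [^]\<^bsub>G i\<^esub> k l)"
    proof (intro finprod_cong' refl)
      show "(F l [^]\<^bsub>P\<^esub> k l) i = F l i [^]\<^bsub>G i\<^esub> k l" if "l \<in> {1..n}" for l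
        using pow_P_coord[OF Fl[OF that] i] .
      show "(\<lambda>l. F l i [^]\<^bsub>G i\<^esub> k l) \<in> {1..n} \<rightarrow> carrier (G i)"
      proof (rule Pi_I)
        fix l assume "l \<in> {1..n}"
        then have "F l i \<in> carrier (G i)" using Fl i by fastforce
        then show "F l i [^]\<^bsub>G i\<^esub> k l \<in> carrier (G i)" by (rule nat_pow_closed)
      qed
    qed
    finally show ?thesis .
  qed
  have Ri: "?R i = inv\<^bsub>G i\<^esub> ((F j i [^]\<^bsub>G i\<^esub> x i K) [^]\<^bsub>G i\<^esub> p)" if i: "i \<in> {1..m}" for i
    using group_hom.hom_inv[OF proj_hom[OF i] \<tau>_closed[OF Fl[OF j]]] \<tau>_coord[OF Fl[OF j] i] by simp
  have "?L = ?R \<longleftrightarrow> (\<forall>i\<in>{1..m}. ?L i = ?R i)"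
    using carrier_P_eqI[OF L R] by auto
  then show ?thesis by (simp only: Li Ri cong: ball_cong)
qed

text \<open>A product of counts counts families, and exchanging the two indices turns a family of
  \<open>n\<close>-tuples in the \<open>G i\<close> into one \<open>n\<close>-tuple in
  \<open>P\<close>.\<close>

lemma prod_card_Sur:
  assumes A: "\<And>i j. i \<in> {1..n} \<Longrightarrow> j \<in> {1..n} \<Longrightarrow> A i j \<in> carrier (Zp p)"
  shows "(\<Prod>i=1..m. card (Sur (cok (Zp p) n (add_scalar (Zp p) A ([p] \<cdot>\<^bsub>Zp p\<^esub> x i))) (G i))) =
    card {F \<in> tuples n. \<forall>j\<in>{1..n}. (\<Otimes>\<^bsub>P\<^esub>l\<in>{1..n}. F l [^]\<^bsub>P\<^esub> nat (A l j K)) = inv\<^bsub>P\<^esub> (\<tau> (F j))}"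
    (is "_ = card ?R")
proof -
  define S where "S i = {f \<in> {1..n} \<rightarrow>\<^sub>E carrier (G i). generate (G i) (f ` {1..n}) = carrier (G i) \<and>
     (\<forall>j\<in>{1..n}. (\<Otimes>\<^bsub>G i\<^esub>l\<in>{1..n}. f l [^]\<^bsub>G i\<^esub> nat (A l j K)) = inv\<^bsub>G i\<^esub> ((f j [^]\<^bsub>G i\<^esub> x i K) [^]\<^bsub>G i\<^esub> p))}" for i
  have "(\<Prod>i=1..m. card (Sur (cok (Zp p) n (add_scalar (Zp p) A ([p] \<cdot>\<^bsub>Zp p\<^esub> x i))) (G i))) = (\<Prod>i\<in>{1..m}. card (S i))"
  proof (intro prod.cong refl)
    fix i assume i: "i \<in> {1..m}"
    interpret comm_group "G i" using i by (rule G_comm)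
    interpret Zp_target "G i" p K using p K[OF i] by unfold_locales (auto simp: prime_gt_0_nat)
    show "card (Sur (cok (Zp p) n (add_scalar (Zp p) A ([p] \<cdot>\<^bsub>Zp p\<^esub> x i))) (G i)) = card (S i)"
      unfolding S_def by (rule card_Sur_cok_add_scalar[OF A x[OF i]])
  qed
  also have "\<dots> = card (PiE {1..m} S)" by (simp add: card_PiE)
  also have "\<dots> = card ?R"
  proof (rule bij_betw_same_card)
    let ?tr = "\<lambda>f. \<lambda>l\<in>{1..n}. \<lambda>i\<in>{1..m}. f i l"
    let ?tr' = "\<lambda>F. \<lambda>i\<in>{1..m}. \<lambda>l\<in>{1..n}. F l i"
    have cong1: "(\<lambda>l. F l i) ` {1..n} = (\<lambda>l\<in>{1..n}. F l i) ` {1..n}" for F :: "nat \<Rightarrow> nat \<Rightarrow> 'g" and i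
      by (intro image_cong) auto
    have mem: "?tr' F \<in> PiE {1..m} S \<longleftrightarrow> F \<in> ?R" if F: "F \<in> {1..n} \<rightarrow>\<^sub>E carrier P" for F
    proof -
      have Fl: "F l i \<in> carrier (G i)" if "l \<in> {1..n}" "i \<in> {1..m}" for l i
        using PiE_mem[OF F that(1)] that(2) by (auto dest: PiE_mem)
      have Si: "(\<lambda>l\<in>{1..n}. F l i) \<in> S i \<longleftrightarrow> generate (G i) ((\<lambda>l. F l i) ` {1..n}) = carrier (G i) \<and>
         (\<forall>j\<in>{1..n}. (\<Otimes>\<^bsub>G i\<^esub>l\<in>{1..n}. F l i [^]\<^bsub>G i\<^esub> nat (A l j K)) = inv\<^bsub>G i\<^esub> ((F j i [^]\<^bsub>G i\<^esub> x i K) [^]\<^bsub>G i\<^esub> p))"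
        if i: "i \<in> {1..m}" for i
      proof -
        interpret comm_group "G i" using i by (rule G_comm)
        have "(\<lambda>l\<in>{1..n}. F l i) \<in> {1..n} \<rightarrow>\<^sub>E carrier (G i)" using Fl[OF _ i] by auto
        moreover have "(\<Otimes>\<^bsub>G i\<^esub>l\<in>{1..n}. (\<lambda>l\<in>{1..n}. F l i) l [^]\<^bsub>G i\<^esub> nat (A l j K)) = 
           (\<Otimes>\<^bsub>G i\<^esub>l\<in>{1..n}. F l i [^]\<^bsub>G i\<^esub> nat (A l j K))" for j
          using Fl[OF _ i] by (intro finprod_cong' refl) (auto intro!: nat_pow_closed)
        ultimately show ?thesis unfolding S_def mem_Collect_eq cong1[symmetric] by simp
      qed
      have "?tr' F \<in> PiE {1..m} S \<longleftrightarrow> (\<forall>i\<in>{1..m}. (\<lambda>l\<in>{1..n}. F l i) \<in> S i)"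
        by (rule restrict_PiE_iff)
      also have "\<dots> \<longleftrightarrow> (\<forall>i\<in>{1..m}. generate (G i) ((\<lambda>l. F l i) ` {1..n}) = carrier (G i) \<and>
         (\<forall>j\<in>{1..n}. (\<Otimes>\<^bsub>G i\<^esub>l\<in>{1..n}. F l i [^]\<^bsub>G i\<^esub> nat (A l j K)) = inv\<^bsub>G i\<^esub> ((F j i [^]\<^bsub>G i\<^esub> x i K) [^]\<^bsub>G i\<^esub> p)))"
        by (intro ball_cong refl Si)
      also have "\<dots> \<longleftrightarrow> F \<in> ?R"
      proof -
        have "(\<forall>j\<in>{1..n}. (\<Otimes>\<^bsub>P\<^esub>l\<in>{1..n}. F l [^]\<^bsub>P\<^esub> nat (A l j K)) = inv\<^bsub>P\<^esub> (\<tau> (F j))) \<longleftrightarrow>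
          (\<forall>j\<in>{1..n}. \<forall>i\<in>{1..m}. (\<Otimes>\<^bsub>G i\<^esub>l\<in>{1..n}. F l i [^]\<^bsub>G i\<^esub> nat (A l j K)) = inv\<^bsub>G i\<^esub> ((F j i [^]\<^bsub>G i\<^esub> x i K) [^]\<^bsub>G i\<^esub> p))"
          by (intro ball_cong refl relation_coord[OF F])
        then show ?thesis unfolding tuples_def mem_Collect_eq using F by blast
      qed
      finally show ?thesis .
    qed
    show "bij_betw ?tr (PiE {1..m} S) ?R"
    proof (rule bij_betw_byWitness[where f' = ?tr'])
      have tr: "?tr f \<in> {1..n} \<rightarrow>\<^sub>E carrier P" "?tr' (?tr f) = f" if f: "f \<in> PiE {1..m} S" for f
      proof -
        have fi: "f i \<in> {1..n} \<rightarrow>\<^sub>E carrier (G i)" if "i \<in> {1..m}" for i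
          using PiE_mem[OF f that] by (simp add: S_def)
        show "?tr f \<in> {1..n} \<rightarrow>\<^sub>E carrier P" using fi by (fastforce simp: PiE_iff)
        have "?tr' (?tr f) i = f i" for i
        proof (cases "i \<in> {1..m}")
          case True
          have "?tr' (?tr f) i = restrict (f i) {1..n}" using True by (auto intro!: restrict_ext)
          also have "\<dots> = f i" using fi[OF True] by (rule PiE_restrict)
          finally show ?thesis .
        next
          case False
          then show ?thesis using f by (auto simp: PiE_iff extensional_def)
        qed
        then show "?tr' (?tr f) = f" by (rule ext)
      qed
      have tr': "?tr (?tr' F) = F" if F: "F \<in> {1..n} \<rightarrow>\<^sub>E carrier P" for F
      proof
        fix l
        show "?tr (?tr' F) l = F l"
        proof (cases "l \<in> {1..n}")
          case True
          have "?tr (?tr' F) l = restrict (F l) {1..m}" using True by (auto intro!: restrict_ext)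
          also have "\<dots> = F l" using PiE_mem[OF F True] by (simp add: PiE_restrict)
          finally show ?thesis .
        next
          case False
          then show ?thesis using F by (auto simp: PiE_iff extensional_def)
        qed
      qed
      have RF: "F \<in> {1..n} \<rightarrow>\<^sub>E carrier P" if "F \<in> ?R" for F using that by (simp add: tuples_def)
      show "\<forall>f\<in>PiE {1..m} S. ?tr' (?tr f) = f" using tr(2) by blast
      show "\<forall>F\<in>?R. ?tr (?tr' F) = F" using tr' RF by blast
      show "?tr ` PiE {1..m} S \<subseteq> ?R"
      proof (rule image_subsetI)
        fix f assume f: "f \<in> PiE {1..m} S"
        have "?tr' (?tr f) \<in> PiE {1..m} S" using tr(2)[OF f] f by (simp only:)
        then show "?tr f \<in> ?R" using mem[OF tr(1)[OF f]] by blast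
      qed
      show "?tr' ` ?R \<subseteq> PiE {1..m} S" using mem RF by blast
    qed
  qed
  finally show ?thesis .
qed

section \<open>Sorting tuples by the subgroup they generate\<close>

lemma S_set_eq: "S_set p m G x = {H. subgroup H P \<and> (\<forall>i\<in>{1..m}. (\<lambda>g. g i) ` H = carrier (G i)) \<and> \<tau> ` H \<subseteq> H}"
  by (simp add: S_set_def \<tau>_def)

lemma tuples_mem: "F \<in> tuples n \<Longrightarrow> l \<in> {1..n} \<Longrightarrow> F l \<in> carrier P"
  unfolding tuples_def by (blast dest: PiE_mem)

lemma proj_generate:
  assumes F: "F \<in> {1..n} \<rightarrow>\<^sub>E carrier P" and i: "i \<in> {1..m}"
  shows "(\<lambda>g. g i) ` generate P (F ` {1..n}) = generate (G i) ((\<lambda>l. F l i) ` {1..n})"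
proof -
  have "F ` {1..n} \<subseteq> carrier P" using F by (blast dest: PiE_mem)
  from group_hom.generate_img[OF proj_hom[OF i] this] show ?thesis by (simp only: image_image)
qed

text \<open>The projection condition in \<open>tuples\<close> depends only on the generated
  subgroup, so it holds throughout the class of an \<open>H\<close> that projects onto every
  \<open>G i\<close>.\<close>

lemma tuples_generating:
  assumes H: "subgroup H P" "\<forall>i\<in>{1..m}. (\<lambda>g. g i) ` H = carrier (G i)"
  shows "{F \<in> tuples n. generate P (F ` {1..n}) = H} = finite_comm_group.gens (P\<lparr>carrier := H\<rparr>) n"
proof -
  interpret H: finite_comm_group "P\<lparr>carrier := H\<rparr>" using H(1) by (rule P.finite_comm_group_subgroup)
  have Hc: "H \<subseteq> carrier P" using H(1) by (rule subgroup.subset)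
  show ?thesis
  proof (intro equalityI subsetI)
    fix F assume F: "F \<in> {F \<in> tuples n. generate P (F ` {1..n}) = H}"
    then have FP: "F \<in> {1..n} \<rightarrow>\<^sub>E carrier P" and gen: "generate P (F ` {1..n}) = H" by (simp_all add: tuples_def)
    have FH: "F l \<in> H" if "l \<in> {1..n}" for l
      using generate.incl[of "F l" "F ` {1..n}" P] that unfolding gen by blast
    then have "F \<in> {1..n} \<rightarrow>\<^sub>E H" using FP by (auto simp: PiE_iff)
    moreover have "generate (P\<lparr>carrier := H\<rparr>) (F ` {1..n}) = H"
      using P.generate_consistent[OF _ H(1), of "F ` {1..n}"] FH gen by blast
    ultimately show "F \<in> H.gens n" unfolding H.gens_def H.maps_def by simp
  next
    fix F assume "F \<in> H.gens n"
    then have FH: "F \<in> {1..n} \<rightarrow>\<^sub>E H" and genH: "generate (P\<lparr>carrier := H\<rparr>) (F ` {1..n}) = H"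
      unfolding H.gens_def H.maps_def by simp_all
    have FP: "F \<in> {1..n} \<rightarrow>\<^sub>E carrier P" using FH Hc by (auto simp only: PiE_iff)
    have "F ` {1..n} \<subseteq> H" using FH by (blast dest: PiE_mem)
    then have gen: "generate P (F ` {1..n}) = H" using P.generate_consistent[OF _ H(1)] genH by blast
    have "generate (G i) ((\<lambda>l. F l i) ` {1..n}) = carrier (G i)" if "i \<in> {1..m}" for i
      using proj_generate[OF FP that] H(2) that unfolding gen by simp
    then show "F \<in> {F \<in> tuples n. generate P (F ` {1..n}) = H}"
      unfolding tuples_def using FP gen by blast
  qed
qed

lemma relation_imp_stable:
  assumes F: "F \<in> tuples n" and rel: "\<And>j. j \<in> {1..n} \<Longrightarrow> (\<Otimes>\<^bsub>P\<^esub>l\<in>{1..n}. F l [^]\<^bsub>P\<^esub> (k j l :: nat)) = inv\<^bsub>P\<^esub> (\<tau> (F j))"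
  shows "\<tau> ` generate P (F ` {1..n}) \<subseteq> generate P (F ` {1..n})"
proof -
  let ?H = "generate P (F ` {1..n})"
  have sub: "F ` {1..n} \<subseteq> carrier P" using tuples_mem[OF F] by blast
  then have H: "subgroup ?H P" by (rule P.generate_is_subgroup)
  interpret group_hom P P \<tau> using \<tau>_hom by unfold_locales
  have "\<tau> (F j) \<in> ?H" if j: "j \<in> {1..n}" for j
  proof -
    have "(\<Otimes>\<^bsub>P\<^esub>l\<in>{1..n}. F l [^]\<^bsub>P\<^esub> k j l) \<in> ?H"
    proof (rule P.finprod_in_subgroup[OF H])
      fix l assume "l \<in> {1..n}"
      then have "F l \<in> ?H" by (intro generate.incl imageI)
      then show "F l [^]\<^bsub>P\<^esub> k j l \<in> ?H" by (rule P.subgroup_nat_pow_closed[OF H])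
    qed simp
    then have "inv\<^bsub>P\<^esub> (inv\<^bsub>P\<^esub> (\<tau> (F j))) \<in> ?H"
      unfolding rel[OF j] by (rule subgroup.m_inv_closed[OF H])
    then show ?thesis using P.inv_inv[OF \<tau>_closed[OF tuples_mem[OF F j]]] by simp
  qed
  then have "generate P (\<tau> ` F ` {1..n}) \<subseteq> ?H"
    by (intro P.generate_subgroup_incl[OF _ H]) blast
  then show ?thesis using generate_img[OF sub] by simp
qed

theorem expectation_tendsto:
  fixes \<epsilon> :: "nat \<Rightarrow> real" and M :: "nat \<Rightarrow> 'w measure" and A :: "nat \<Rightarrow> 'w \<Rightarrow> nat \<Rightarrow> nat \<Rightarrow> nat \<Rightarrow> int"
  assumes K1: "K \<ge> 1"
    and \<epsilon>: "\<And>\<Delta>::real. \<Delta> > 0 \<Longrightarrow> \<forall>\<^sub>F n in sequentially. \<epsilon> n \<ge> \<Delta> * ln (real n) / real n"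
    and \<epsilon>0: "\<And>n. n \<ge> 1 \<Longrightarrow> 0 < \<epsilon> n"
    and M: "\<And>n. n \<ge> 1 \<Longrightarrow> prob_space (M n)"
    and A: "\<And>n. n \<ge> 1 \<Longrightarrow> balanced_matrix p (\<epsilon> n) n (M n) (A n)"
  shows "(\<lambda>n. prob_space.expectation (M n) (\<lambda>w. \<Prod>i=1..m.
             real (card (Sur (cok (Zp p) n (add_scalar (Zp p) (A n w) ([p] \<cdot>\<^bsub>Zp p\<^esub> x i))) (G i)))))
           \<longlonglongrightarrow> real (card (S_set p m G x))"
proof -
  have p0: "p > 0" using p by (rule prime_gt_0_nat)
  note entries = balanced_matrix_entries[OF M p0 K1 A]
  define ev where "ev n F = {w \<in> space (M n). \<forall>j\<in>{1..n}.
      (\<Otimes>\<^bsub>P\<^esub>l\<in>{1..n}. F l [^]\<^bsub>P\<^esub> entry K (A n) l j w) = inv\<^bsub>P\<^esub> (\<tau> (F j))}" for n F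
  define HH where "HH = {H. subgroup H P \<and> (\<forall>i\<in>{1..m}. (\<lambda>g. g i) ` H = carrier (G i))}"
  have finHH: "finite HH" using P.finite_subgroups by (rule finite_subset[rotated]) (auto simp: HH_def)
  have SH: "S_set p m G x \<subseteq> HH" by (auto simp: S_set_eq HH_def)
  have "tuples n \<subseteq> P.maps n" for n unfolding tuples_def P.maps_def by blast
  then have fin_tuples: "finite (tuples n)" for n using P.finite_maps by (rule finite_subset)

  have ev_sets: "ev n F \<in> sets (M n)" if n: "n \<ge> 1" and F: "F \<in> tuples n" for n F
  proof -
    let ?Y = "\<lambda>(l, j). entry K (A n) l j"
    let ?Q = "\<lambda>y. \<forall>j\<in>{1..n}. (\<Otimes>\<^bsub>P\<^esub>l\<in>{1..n}. F l [^]\<^bsub>P\<^esub> (y (l, j) :: nat)) = inv\<^bsub>P\<^esub> (\<tau> (F j))"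
    have "{w \<in> space (M n). ?Q (\<lambda>i\<in>{1..n} \<times> {1..n}. ?Y i w)} \<in> sets (M n)"
    proof (rule sets_finite_family)
      show "?Y i \<in> M n \<rightarrow>\<^sub>M count_space UNIV" if "i \<in> {1..n} \<times> {1..n}" for i
        using entries(1)[OF n n] that unfolding prob_space.indep_vars_def[OF M[OF n]] by (cases i) auto
    qed simp
    also have "{w \<in> space (M n). ?Q (\<lambda>i\<in>{1..n} \<times> {1..n}. ?Y i w)} = ev n F"
    proof -
      have "(\<Otimes>\<^bsub>P\<^esub>l\<in>{1..n}. F l [^]\<^bsub>P\<^esub> ((\<lambda>i\<in>{1..n} \<times> {1..n}. ?Y i w) (l, j)))
          = (\<Otimes>\<^bsub>P\<^esub>l\<in>{1..n}. F l [^]\<^bsub>P\<^esub> entry K (A n) l j w)" if j: "j \<in> {1..n}" for j w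
      proof (rule P.finprod_cong'[OF refl])
        show "(\<lambda>l. F l [^]\<^bsub>P\<^esub> entry K (A n) l j w) \<in> {1..n} \<rightarrow> carrier P"
          by (rule Pi_I) (rule P.nat_pow_closed[OF tuples_mem[OF F]])
      qed (use j in simp)
      then show ?thesis unfolding ev_def by simp
    qed
    finally show ?thesis .
  qed

  have "prob_space.expectation (M n) (\<lambda>w. \<Prod>i=1..m.
      real (card (Sur (cok (Zp p) n (add_scalar (Zp p) (A n w) ([p] \<cdot>\<^bsub>Zp p\<^esub> x i))) (G i))))
    = (\<Sum>H\<in>S_set p m G x. \<Sum>F\<in>finite_comm_group.gens (P\<lparr>carrier := H\<rparr>) n. measure (M n) (ev n F))"
    if n: "n \<ge> 1" for n
  proof -
    interpret prob_space "M n" by (rule M[OF n])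
    have "expectation (\<lambda>w. \<Prod>i=1..m. real (card (Sur (cok (Zp p) n (add_scalar (Zp p) (A n w) ([p] \<cdot>\<^bsub>Zp p\<^esub> x i))) (G i))))
      = expectation (\<lambda>w. \<Sum>F\<in>tuples n. indicator (ev n F) w)"
    proof (rule Bochner_Integration.integral_cong[OF refl])
      fix w assume w: "w \<in> space (M n)"
      have "(\<Prod>i=1..m. card (Sur (cok (Zp p) n (add_scalar (Zp p) (A n w) ([p] \<cdot>\<^bsub>Zp p\<^esub> x i))) (G i)))
        = card {F \<in> tuples n. \<forall>j\<in>{1..n}. (\<Otimes>\<^bsub>P\<^esub>l\<in>{1..n}. F l [^]\<^bsub>P\<^esub> nat (A n w l j K)) = inv\<^bsub>P\<^esub> (\<tau> (F j))}"
        by (rule prod_card_Sur) (rule entries(2)[OF n n _ _ w])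
      also have "\<dots> = card {F \<in> tuples n. w \<in> ev n F}" using w by (simp add: ev_def entry_def)
      finally have "(\<Prod>i=1..m. card (Sur (cok (Zp p) n (add_scalar (Zp p) (A n w) ([p] \<cdot>\<^bsub>Zp p\<^esub> x i))) (G i)))
        = card {F \<in> tuples n. w \<in> ev n F}" .
      then have "(\<Prod>i=1..m. real (card (Sur (cok (Zp p) n (add_scalar (Zp p) (A n w) ([p] \<cdot>\<^bsub>Zp p\<^esub> x i))) (G i))))
        = real (card {F \<in> tuples n. w \<in> ev n F})" by (simp only: flip: of_nat_prod)
      also have "\<dots> = (\<Sum>F\<in>tuples n. indicator (ev n F) w)"
        using fin_tuples by (simp add: indicator_def sum.If_cases Int_def)
      finally show "(\<Prod>i=1..m. real (card (Sur (cok (Zp p) n (add_scalar (Zp p) (A n w) ([p] \<cdot>\<^bsub>Zp p\<^esub> x i))) (G i))))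
        = (\<Sum>F\<in>tuples n. indicator (ev n F) w)" .
    qed
    also have "\<dots> = (\<Sum>F\<in>tuples n. expectation (indicator (ev n F)))"
      using ev_sets[OF n] by (intro Bochner_Integration.integral_sum) (simp add: emeasure_eq_measure)
    also have "\<dots> = (\<Sum>F\<in>tuples n. prob (ev n F))"
      using ev_sets[OF n] by (intro sum.cong refl) simp
    also have "\<dots> = (\<Sum>H\<in>HH. \<Sum>F\<in>{F \<in> tuples n. generate P (F ` {1..n}) = H}. prob (ev n F))"
    proof (rule sum.group[symmetric, OF fin_tuples finHH])
      show "(\<lambda>F. generate P (F ` {1..n})) ` tuples n \<subseteq> HH"
      proof (rule image_subsetI)
        fix F assume F: "F \<in> tuples n"
        then have FP: "F \<in> {1..n} \<rightarrow>\<^sub>E carrier P" by (simp add: tuples_def)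
        have "subgroup (generate P (F ` {1..n})) P"
          using tuples_mem[OF F] by (intro P.generate_is_subgroup) blast
        moreover have "\<forall>i\<in>{1..m}. (\<lambda>g. g i) ` generate P (F ` {1..n}) = carrier (G i)"
          using F proj_generate[OF FP] by (simp add: tuples_def)
        ultimately show "generate P (F ` {1..n}) \<in> HH" by (simp add: HH_def)
      qed
    qed
    also have "\<dots> = (\<Sum>H\<in>S_set p m G x. \<Sum>F\<in>{F \<in> tuples n. generate P (F ` {1..n}) = H}. prob (ev n F))"
    proof (rule sum.mono_neutral_right[OF finHH SH], rule ballI, rule sum.neutral, rule ballI)
      fix H F assume H: "H \<in> HH - S_set p m G x" and F: "F \<in> {F \<in> tuples n. generate P (F ` {1..n}) = H}"
      then have Ft: "F \<in> tuples n" and gen: "generate P (F ` {1..n}) = H" by simp_all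
      \<comment> \<open>Membership in \<open>HH\<close> leaves stability under \<tau> as the only
        condition that can fail; then no outcome satisfies all relations.\<close>
      have "\<not> \<tau> ` H \<subseteq> H" using H unfolding S_set_eq HH_def by blast
      then have "w \<notin> ev n F" for w
        using relation_imp_stable[OF Ft, of "\<lambda>j l. entry K (A n) l j w"] unfolding gen ev_def by blast
      then have "ev n F = {}" by blast
      then show "prob (ev n F) = 0" by simp
    qed
    also have "\<dots> = (\<Sum>H\<in>S_set p m G x. \<Sum>F\<in>finite_comm_group.gens (P\<lparr>carrier := H\<rparr>) n. prob (ev n F))"
      by (intro sum.cong refl tuples_generating) (auto simp: S_set_eq)
    finally show ?thesis .
  qed
  then have eq: "\<forall>\<^sub>F n in sequentially. (\<Sum>H\<in>S_set p m G x. \<Sum>F\<in>finite_comm_group.gens (P\<lparr>carrier := H\<rparr>) n. measure (M n) (ev n F))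
    = prob_space.expectation (M n) (\<lambda>w. \<Prod>i=1..m.
      real (card (Sur (cok (Zp p) n (add_scalar (Zp p) (A n w) ([p] \<cdot>\<^bsub>Zp p\<^esub> x i))) (G i))))"
    by (intro eventually_mono[OF eventually_ge_at_top[of 1]]) (rule sym)

  have "(\<lambda>n. \<Sum>F\<in>finite_comm_group.gens (P\<lparr>carrier := H\<rparr>) n. measure (M n) (ev n F)) \<longlonglongrightarrow> 1"
    if H: "H \<in> S_set p m G x" for H
  proof -
    have Hs: "subgroup H P" and stable: "\<tau> ` H \<subseteq> H" using H by (simp_all add: S_set_eq)
    interpret H: finite_comm_group "P\<lparr>carrier := H\<rparr>" using Hs by (rule P.finite_comm_group_subgroup)
    have mem: "F l \<in> H" if "F \<in> H.gens n" "l \<in> {1..n}" for F n l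
      using that H.maps_mem[of F n l] unfolding H.gens_def by simp
    have lim: "(\<lambda>n. \<Sum>f\<in>H.gens n. measure (M n) {w \<in> space (M n). \<forall>j\<in>{1..n}.
       (\<Otimes>\<^bsub>P\<lparr>carrier := H\<rparr>\<^esub>l\<in>{1..n}. f l [^]\<^bsub>P\<lparr>carrier := H\<rparr>\<^esub> entry K (A n) l j w) = inv\<^bsub>P\<^esub> (\<tau> (f j))}) \<longlonglongrightarrow> 1"
    proof (rule H.random_relations_tendsto[OF p _ \<epsilon> \<epsilon>0 M])
      show "g [^]\<^bsub>P\<lparr>carrier := H\<rparr>\<^esub> (p ^ K) = \<one>\<^bsub>P\<lparr>carrier := H\<rparr>\<^esub>" if "g \<in> carrier (P\<lparr>carrier := H\<rparr>)" for g
        using that P_exponent[of g] subgroup.mem_carrier[OF Hs, of g] P.nat_pow_consistent[of g "p ^ K" H] by simp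
      show "inv\<^bsub>P\<^esub> (\<tau> (f j)) \<in> carrier (P\<lparr>carrier := H\<rparr>)" if "f \<in> H.gens n" "j \<in> {1..n}" for n f j
        using mem[OF that] stable subgroup.m_inv_closed[OF Hs] by auto
    qed (use entries in auto)
    \<comment> \<open>Products and powers formed in the subgroup agree with those in
      \<open>P\<close>, so the events of the one-group theorem are the events
      \<open>ev\<close>.\<close>
    have "{w \<in> space (M n). \<forall>j\<in>{1..n}. (\<Otimes>\<^bsub>P\<lparr>carrier := H\<rparr>\<^esub>l\<in>{1..n}. f l [^]\<^bsub>P\<lparr>carrier := H\<rparr>\<^esub> entry K (A n) l j w) = inv\<^bsub>P\<^esub> (\<tau> (f j))} = ev n f"
      if f: "f \<in> H.gens n" for f n
    proof -
      have "(\<lambda>l. f l [^]\<^bsub>P\<^esub> entry K (A n) l j w) \<in> {1..n} \<rightarrow> H" for j w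
        by (rule Pi_I) (rule P.subgroup_nat_pow_closed[OF Hs mem[OF f]])
      then have "(\<Otimes>\<^bsub>P\<lparr>carrier := H\<rparr>\<^esub>l\<in>{1..n}. f l [^]\<^bsub>P\<lparr>carrier := H\<rparr>\<^esub> entry K (A n) l j w) = 
         (\<Otimes>\<^bsub>P\<^esub>l\<in>{1..n}. f l [^]\<^bsub>P\<^esub> entry K (A n) l j w)" for j w
        unfolding P.nat_pow_consistent[symmetric] by (intro P.finprod_subgroup[OF Hs]) auto
      then show ?thesis unfolding ev_def by (simp only:)
    qed
    then show ?thesis using lim by (simp cong: sum.cong)
  qed
  \<comment> \<open>The finite index set is the same for all \<open>n\<close>, so the limits add
    up.\<close>
  then have "(\<lambda>n. \<Sum>H\<in>S_set p m G x. \<Sum>F\<in>finite_comm_group.gens (P\<lparr>carrier := H\<rparr>) n. measure (M n) (ev n F))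
     \<longlonglongrightarrow> (\<Sum>H\<in>S_set p m G x. 1)"
    by (intro tendsto_sum)
  from Lim_transform_eventually[OF this eq] show ?thesis by simp
qed

end

theorem theorem4p5:
  fixes p m :: nat
    and x :: "nat \<Rightarrow> nat \<Rightarrow> int"
    and \<epsilon> :: "nat \<Rightarrow> real"
    and M :: "nat \<Rightarrow> 'w measure"
    and A :: "nat \<Rightarrow> 'w \<Rightarrow> nat \<Rightarrow> nat \<Rightarrow> nat \<Rightarrow> int"
    and G :: "nat \<Rightarrow> ('g, 'b) monoid_scheme"
  assumes "prime p"
    and "\<And>i. i \<in> {1..m} \<Longrightarrow> x i \<in> carrier (Zp p)"
    and "inj_on (\<lambda>i. x i 1) {1..m}"
    and "\<And>n. n \<ge> 1 \<Longrightarrow> 0 < \<epsilon> n \<and> \<epsilon> n < 1"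
    and "\<And>\<Delta>::real. \<Delta> > 0 \<Longrightarrow> \<forall>\<^sub>F n in sequentially. \<epsilon> n \<ge> \<Delta> * ln (real n) / real n"
    and "\<And>n. n \<ge> 1 \<Longrightarrow> prob_space (M n)"
    and "\<And>n. n \<ge> 1 \<Longrightarrow> balanced_matrix p (\<epsilon> n) n (M n) (A n)"
    and "\<And>i. i \<in> {1..m} \<Longrightarrow> finite_abelian_p_group p (G i)"
  shows "(\<lambda>n. prob_space.expectation (M n) (\<lambda>w. \<Prod>i=1..m.
             real (card (Sur (cok (Zp p) n (add_scalar (Zp p) (A n w) ([p] \<cdot>\<^bsub>Zp p\<^esub> x i))) (G i)))))
           \<longlonglongrightarrow> real (card (S_set p m G x))"
proof -
  have "\<exists>k. order (G i) = p ^ k" if "i \<in> {1..m}" for i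
    using assms(8)[OF that] by (simp add: finite_abelian_p_group_def)
  then obtain k where k: "\<And>i. i \<in> {1..m} \<Longrightarrow> order (G i) = p ^ k i" by metis
  \<comment> \<open>The sum bounds every \<open>k i\<close>, and \<open>Suc\<close> ensures
    \<open>K \<ge> 1\<close> even if all groups are trivial.\<close>
  define K where "K = Suc (\<Sum>i\<in>{1..m}. k i)"
  have kill: "g [^]\<^bsub>G i\<^esub> (p ^ K) = \<one>\<^bsub>G i\<^esub>" if i: "i \<in> {1..m}" and g: "g \<in> carrier (G i)" for i g
  proof -
    interpret comm_group "G i" using assms(8)[OF i] by (simp add: finite_abelian_p_group_def)
    have "k i \<le> (\<Sum>i\<in>{1..m}. k i)" using i by (intro member_le_sum) auto
    then have "p ^ K = order (G i) * p ^ (K - k i)" using k[OF i] by (simp add: K_def flip: power_add)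
    then have "g [^]\<^bsub>G i\<^esub> (p ^ K) = (g [^]\<^bsub>G i\<^esub> order (G i)) [^]\<^bsub>G i\<^esub> (p ^ (K - k i))"
      using g by (simp add: nat_pow_pow)
    then show ?thesis using g by (simp add: pow_order_eq_1)
  qed
  interpret p_group_family p m K G x
    using assms(1,2,8) kill by (rule p_group_family.intro)
  show ?thesis
    using assms by (intro expectation_tendsto[of \<epsilon>]) (auto simp: K_def)
qed

end
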